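(* Let $1\le p<\infty$. Assume that the metric measure space $X=(X,d,\mu)$ is complete, that $\mu$ is doubling, and that $X$ supports a $p$-Poincaré inequality. Let $U\subset X$ be quasiopen. Then every function $u\in N^{1,p}_{\rm loc}(U)$ is quasicontinuous.
   Context: Setting: $1\le p<\infty$, and $X=(X,d,\mu)$ is a metric space with metric $d$ and a positive complete Borel measure $\mu$ such that $\mu(B)<\infty$ for all open balls $B\subset X$. Write $B(x_0,r)=\{x\in X:d(x,x_0)<r\}$ and, for $B=B(x_0,r)$ and $\delta>0$, $\delta B=B(x_0,\delta r)$. Curves: a curve is a continuous mapping from an interval. Only compact rectifiable curves are considered; they are nonconstant unless otherwise stated and parameterized by arc length $ds$, so $\gamma:[0,l_\gamma]\to X$ with $l_\gamma$ the length of $\gamma$. Upper gradients: a nonnegative Borel function $g$ on $X$ is an upper gradient of $f:X\to[-\infty,\infty]$ if $|f(\gamma(0))-f(\gamma(l_\gamma))|\le\int_\gamma g\,ds$ for all nonconstant compact rectifiable curves $\gamma:[0,l_\gamma]\to X$, where the left-hand side is $\infty$ whenever at least one of its terms is infinite. Newtonian space and capacity: for measurable $f:X\to[-\infty,\infty]$ (defined everywhere, not just up to a.e. equivalence), $\|f\|_{N^{1,p}(X)}=\bigl(\int_X|f|^p\,d\mu+\inf_g\int_X g^p\,d\mu\bigr)^{1/p}$, with infimum over all upper gradients $g$ of $f$, and $N^{1,p}(X)=\{f:\|f\|_{N^{1,p}(X)}<\infty\}$. For $E\subset X$, $C_p(E)=\inf_u\|u\|_{N^{1,p}(X)}^p$,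 the infimum being over all $u\in N^{1,p}(X)$ with $u\ge1$ on $E$. For a measurable set $U\subset X$, $N^{1,p}(U)$ and the intrinsic capacity $C_p^U$ are defined in the same way with $X$ replaced by the metric measure space $(U,d|_U,\mu|_U)$. A function $u:U\to[-\infty,\infty]$ belongs to $N^{1,p}_{\rm loc}(U)$ if for every $x\in U$ there is $r_x>0$ such that $u\in N^{1,p}(U\cap B(x,r_x))$. Doubling: there is $C>0$ such that $0<\mu(2B)\le C\mu(B)<\infty$ for all balls $B$. $p$-Poincaré inequality: there are constants $C>0$ and $\lambda\ge1$ such that for all balls $B\subset X$, all integrable functions $f$ on $X$ and all upper gradients $g$ of $f$, $$\frac1{\mu(B)}\int_B|f-f_B|\,d\mu\le C\,\mathrm{diam}(B)\Bigl(\frac1{\mu(\lambda B)}\int_{\lambda B}g^p\,d\mu\Bigr)^{1/p},\qquad f_B=\frac1{\mu(B)}\int_B f\,d\mu.$$ A set $U\subset X$ is quasiopen if for every $\varepsilon>0$ there is an open set $G\subset X$ with $C_p(G)<\varepsilon$ and $G\cup U$ open. Quasiopen sets are known to be measurable. Quasicontinuity: for measurable $U\subset X$, a function $u:U\to[-\infty,\infty]$ is $C_p^U$-quasicontinuous (resp. $C_p$-quasicontinuous) if for every $\varepsilon>0$ there is a relatively open set $G\subset U$ with $C_p^U(G)<\varepsilon$ (resp. an open set $G\subset X$ with $C_p(G)<\varepsilon$) such that $u|_{U\setminus G}$ is finite and continuous. On quasiopen $U$ the two notions are equivalent, and "quasicontinuous" may be read in either sense. *)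

theory Defs
  imports "HOL-Analysis.Analysis"
begin

text \<open>
  The ambient metric space X is the type \<^typ>\<open>'a\<close>, so X is \<^term>\<open>UNIV\<close>.  A set S is regarded
  as the metric measure space (S, d restricted to S, M restricted to S), and every notion below
  that depends on the space takes S as a parameter.  Functions on S are total functions of which
  only the values on S matter.
\<close>

text \<open>The measure is defined exactly on the completion of the Borel sigma-algebra.\<close>

definition complete_Borel_measure :: "'a::topological_space measure \<Rightarrow> bool" where
  "complete_Borel_measure M \<longleftrightarrow> (\<exists>N. sets N = sets borel \<and> M = completion N)"

text \<open>Real powers on the extended half-line, for exponents \<open>s > 0\<close>.\<close>

definition epowr :: "ennreal \<Rightarrow> real \<Rightarrow> ennreal" where
  "epowr x s = (if x = \<infinity> then \<infinity> else ennreal (enn2real x powr s))"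


subsection \<open>Curves and upper gradients\<close>

text \<open>
  The partitions need not contain the endpoints, which does not change the supremum.
\<close>

definition curve_length :: "(real \<Rightarrow> 'a::metric_space) \<Rightarrow> real \<Rightarrow> real \<Rightarrow> ennreal" where
  "curve_length \<gamma> a b =
     (SUP (n, t) \<in> {(n :: nat, t :: nat \<Rightarrow> real). mono_on {..n} t \<and> t ` {..n} \<subseteq> {a..b}}.
        \<Sum>i<n. ennreal (dist (\<gamma> (t i)) (\<gamma> (t (Suc i)))))"

text \<open>
  Nonconstant compact rectifiable curves in S, parameterized by arc length; \<open>l\<close> is the length,
  and nonconstancy is \<open>l > 0\<close>.
\<close>

definition arc_length_curve :: "'a::metric_space set \<Rightarrow> real \<Rightarrow> (real \<Rightarrow> 'a) \<Rightarrow> bool" where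
  "arc_length_curve S l \<gamma> \<longleftrightarrow>
     0 < l \<and> continuous_on {0..l} \<gamma> \<and> \<gamma> ` {0..l} \<subseteq> S \<and>
     (\<forall>t\<in>{0..l}. curve_length \<gamma> 0 t = ennreal t)"

definition ext_diff :: "ereal \<Rightarrow> ereal \<Rightarrow> ennreal" where
  "ext_diff a b = (if \<bar>a\<bar> = \<infinity> \<or> \<bar>b\<bar> = \<infinity> then \<infinity> else e2ennreal \<bar>a - b\<bar>)"

definition upper_gradient ::
    "'a::metric_space set \<Rightarrow> ('a \<Rightarrow> ereal) \<Rightarrow> ('a \<Rightarrow> ennreal) \<Rightarrow> bool" where
  "upper_gradient S f g \<longleftrightarrow>
     g \<in> borel_measurable (restrict_space borel S) \<and>
     (\<forall>l \<gamma>. arc_length_curve S l \<gamma> \<longrightarrow>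
        ext_diff (f (\<gamma> 0)) (f (\<gamma> l)) \<le> (\<integral>\<^sup>+t\<in>{0..l}. g (\<gamma> t) \<partial>lborel))"


subsection \<open>Newtonian spaces and capacity\<close>

definition newton_norm ::
    "real \<Rightarrow> 'a::metric_space measure \<Rightarrow> 'a set \<Rightarrow> ('a \<Rightarrow> ereal) \<Rightarrow> ennreal" where
  "newton_norm p M S f =
     epowr ((\<integral>\<^sup>+x. epowr (e2ennreal \<bar>f x\<bar>) p \<partial>restrict_space M S) +
            (INF g\<in>{g. upper_gradient S f g}. \<integral>\<^sup>+x. epowr (g x) p \<partial>restrict_space M S))
       (1 / p)"

definition newton ::
    "real \<Rightarrow> 'a::metric_space measure \<Rightarrow> 'a set \<Rightarrow> ('a \<Rightarrow> ereal) set" where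
  "newton p M S =
     {f. f \<in> borel_measurable (restrict_space M S) \<and> newton_norm p M S f < \<infinity>}"

definition newton_loc ::
    "real \<Rightarrow> 'a::metric_space measure \<Rightarrow> 'a set \<Rightarrow> ('a \<Rightarrow> ereal) set" where
  "newton_loc p M S = {f. \<forall>x\<in>S. \<exists>r>0. f \<in> newton p M (S \<inter> ball x r)}"

definition capacity ::
    "real \<Rightarrow> 'a::metric_space measure \<Rightarrow> 'a set \<Rightarrow> 'a set \<Rightarrow> ennreal" where
  "capacity p M S E =
     (INF u\<in>{u \<in> newton p M S. \<forall>x\<in>E. 1 \<le> u x}. epowr (newton_norm p M S u) p)"

definition quasiopen :: "real \<Rightarrow> 'a::metric_space measure \<Rightarrow> 'a set \<Rightarrow> bool" where
  "quasiopen p M U \<longleftrightarrow>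
     (\<forall>\<epsilon>>0. \<exists>G. open G \<and> capacity p M UNIV G < ennreal \<epsilon> \<and> open (G \<union> U))"

text \<open>
  \<open>intrinsic_quasicontinuous\<close> uses the capacity of the space U and relatively open sets,
  \<open>quasicontinuous\<close> the capacity and the open sets of the ambient space.
\<close>

definition intrinsic_quasicontinuous ::
    "real \<Rightarrow> 'a::metric_space measure \<Rightarrow> 'a set \<Rightarrow> ('a \<Rightarrow> ereal) \<Rightarrow> bool" where
  "intrinsic_quasicontinuous p M U u \<longleftrightarrow>
     (\<forall>\<epsilon>>0. \<exists>G. openin (top_of_set U) G \<and> capacity p M U G < ennreal \<epsilon> \<and>
        (\<forall>x\<in>U - G. \<bar>u x\<bar> \<noteq> \<infinity>) \<and> continuous_on (U - G) u)"

definition quasicontinuous ::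
    "real \<Rightarrow> 'a::metric_space measure \<Rightarrow> 'a set \<Rightarrow> ('a \<Rightarrow> ereal) \<Rightarrow> bool" where
  "quasicontinuous p M U u \<longleftrightarrow>
     (\<forall>\<epsilon>>0. \<exists>G. open G \<and> capacity p M UNIV G < ennreal \<epsilon> \<and>
        (\<forall>x\<in>U - G. \<bar>u x\<bar> \<noteq> \<infinity>) \<and> continuous_on (U - G) u)"


subsection \<open>Doubling and the Poincare inequality\<close>

definition doubling :: "'a::metric_space measure \<Rightarrow> bool" where
  "doubling M \<longleftrightarrow>
     (\<exists>C::real. C > 0 \<and> (\<forall>x r. r > 0 \<longrightarrow>
        0 < emeasure M (ball x (2 * r)) \<and>
        emeasure M (ball x (2 * r)) \<le> ennreal C * emeasure M (ball x r) \<and>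
        emeasure M (ball x r) < \<infinity>))"

text \<open>
  Below \<open>f\<close> is integrable, hence finite almost everywhere, so that the convention
  \<open>real_of_ereal (\<plusminus>\<infinity>) = 0\<close> does not affect its mean value.
\<close>

definition ball_mean :: "'a::metric_space measure \<Rightarrow> 'a set \<Rightarrow> ('a \<Rightarrow> ereal) \<Rightarrow> real" where
  "ball_mean M B f = (LINT x:B|M. real_of_ereal (f x)) / measure M B"

definition poincare_inequality :: "real \<Rightarrow> 'a::metric_space measure \<Rightarrow> bool" where
  "poincare_inequality p M \<longleftrightarrow>
     (\<exists>C \<Lambda> :: real. C > 0 \<and> \<Lambda> \<ge> 1 \<and>
        (\<forall>x r f g. r > 0 \<and>
           f \<in> borel_measurable M \<and> (\<integral>\<^sup>+y. e2ennreal \<bar>f y\<bar> \<partial>M) < \<infinity> \<and>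
           upper_gradient UNIV f g \<longrightarrow>
           (\<integral>\<^sup>+y\<in>ball x r. e2ennreal \<bar>f y - ereal (ball_mean M (ball x r) f)\<bar> \<partial>M)
               / emeasure M (ball x r)
             \<le> ennreal (C * diameter (ball x r)) *
               epowr ((\<integral>\<^sup>+y\<in>ball x (\<Lambda> * r). epowr (g y) p \<partial>M)
                        / emeasure M (ball x (\<Lambda> * r))) (1 / p)))"

end

theory Submission
  imports Defs "HOL-Library.Diagonal_Subsequence"
begin

text \<open>
  Doubling and completeness make \<open>X\<close> proper.  Let \<open>f : X \<rightarrow> [0,1]\<close> have bounded support and an
  upper gradient, which may be taken lower semicontinuous and at least 1; call it \<open>h\<close>.  By
  Lusin's theorem \<open>f\<close> is continuous on a closed set \<open>F\<close> such that \<open>h\<^sup>p\<close> has small integral off \<open>F\<close>.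
  Let \<open>T f x\<close> be the infimum of \<open>f(y) + \<integral> h ds\<close> over curves from \<open>x\<close> to points \<open>y \<in> F\<close>, capped
  at 1.  By compactness of curves of bounded length in a proper space, \<open>T f\<close> is lower
  semicontinuous, and \<open>1 - T (1 - f) \<le> f \<le> T f\<close> with equality on \<open>F\<close>.  The gap between the two
  bounds vanishes on \<open>F\<close>, has upper gradient \<open>2h\<close> off \<open>F\<close>, and hence exceeds a given number only
  on an open set of small capacity.  Off a countable union of such sets \<open>f\<close> is a uniform limit of
  lower and of upper semicontinuous functions, hence continuous.

  For quasiopen \<open>U\<close>, choose an open \<open>G\<close> with \<open>G \<union> U\<close> open and a function \<open>w\<close> of small norm with
  \<open>w = 1\<close> on \<open>G\<close>.  Locally the function \<open>\<zeta> = (\<psi> - w)\<^sup>+\<close>, where \<open>\<psi>\<close> is a Lipschitz cutoff, vanishes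
  outside \<open>U\<close>, so that the products of \<open>\<zeta>\<close> with bounded functions of \<open>u\<close> extend by zero to \<open>X\<close>, and
  the first part applies to them.
\<close>

subsection \<open>Powers on the extended half-line\<close>

text \<open>The exceptional sets must be open, while a capacity estimate by itself controls
  arbitrary superlevel sets. Squeezing \<open>f\<close> between semicontinuous functions resolves
  this: the gap exceeds \<open>\<delta>\<close> exactly where a sum of two lower semicontinuous
  functions exceeds \<open>1 + \<delta>\<close>, which is an open set. Lower semicontinuity of
  \<open>h\<close> is what Fatou's lemma needs when curves converge, and \<open>1 \<le> h\<close>
  bounds the length of every curve of cost below 1. It also makes \<open>h\<close> dominate the gap,
  so that one integral off \<open>F\<close> controls both terms of the Newtonian norm. Quasiopen
  \<open>U\<close> adds three obstacles. Upper gradients of \<open>u\<close> control only curves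
  inside \<open>U\<close>, whereas curves in \<open>X\<close> leave and re-enter it; cutting at the
  zeros of \<open>\<zeta>\<close> deals with that. The function \<open>u\<close> may be infinite on
  a set that is a priori only null; every upper gradient of \<open>u\<close> is one of the indicator
  of this set, and after the cutoff its gradient can be concentrated on a null set, up to an
  arbitrarily small multiple. Finally, countably many balls are needed, each with its own cutoff;
  the set \<open>{w > 1/4}\<close> is common to all of them, so its capacity is paid for
  once.\<close>

lemma epowr_ennreal: "0 \<le> a \<Longrightarrow> epowr (ennreal a) s = ennreal (a powr s)"
  by (simp add: epowr_def)

lemma epowr_top [simp]: "epowr top s = top"
  by (simp add: epowr_def)

lemma epowr_0 [simp]: "epowr 0 s = 0"
  by (simp add: epowr_def)

lemma epowr_1 [simp]: "epowr 1 s = 1"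
  by (simp add: epowr_def)

lemma epowr_one_right [simp]: "epowr x 1 = x"
  by (simp add: epowr_def less_top[symmetric])

lemma epowr_mono:
  assumes "x \<le> y" "0 \<le> s"
  shows "epowr x s \<le> epowr y s"
proof (cases "y = top")
  case False
  then have "x \<noteq> top" using assms(1) top.extremum_uniqueI by fastforce
  then show ?thesis using False assms
    by (auto simp: epowr_def less_top[symmetric] intro!: ennreal_leI powr_mono2 enn2real_mono)
qed simp

lemma epowr_epowr: "epowr (epowr x s) t = epowr x (s * t)"
  by (auto simp: epowr_def powr_powr)

lemma epowr_cmult: "0 < c \<Longrightarrow> epowr (ennreal c * x) s = ennreal (c powr s) * epowr x s"
proof (cases "x = top")
  case True
  moreover assume "0 < c"
  ultimately show ?thesis by (simp add: ennreal_mult_top)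
next
  case False
  assume "0 < c"
  obtain r where r: "x = ennreal r" "0 \<le> r" using False by (cases x) auto
  have "epowr (ennreal (c * r)) s = ennreal ((c * r) powr s)"
    using \<open>0 < c\<close> r by (intro epowr_ennreal) auto
  then show ?thesis using \<open>0 < c\<close> r
    by (simp add: epowr_ennreal ennreal_mult[symmetric] powr_mult)
qed

lemma epowr_less_top_iff [simp]: "epowr x s < top \<longleftrightarrow> x < top"
  by (simp add: epowr_def less_top[symmetric])

lemma epowr_measurable [measurable]:
  "(\<lambda>x. epowr x s) \<in> borel_measurable borel"
  unfolding epowr_def by measurable

lemma epowr_add_le:
  assumes "0 \<le> s"
  shows "epowr (x + y) s \<le> ennreal (2 powr s) * (epowr x s + epowr y s)"
proof -
  have "x + y \<le> ennreal 2 * max x y"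
    by (metis add_mono ennreal_numeral max.cobounded1 max.cobounded2 mult_2 zero_le_numeral)
  then have "epowr (x + y) s \<le> ennreal (2 powr s) * epowr (max x y) s"
    using epowr_mono[OF _ assms] epowr_cmult[of 2 "max x y" s] by fastforce
  also have "epowr (max x y) s \<le> epowr x s + epowr y s"
    by (cases "x \<le> y") (auto simp: max_def add_increasing add_increasing2)
  finally show ?thesis by (simp add: mult_left_mono)
qed

lemma epowr_SUP_le:
  assumes "0 < s" "\<And>i. i \<in> I \<Longrightarrow> epowr (f i) s \<le> b"
  shows "epowr (SUP i\<in>I. f i) s \<le> b"
proof -
  have "f i \<le> epowr b (1 / s)" if "i \<in> I" for i
    using epowr_mono[OF assms(2)[OF that], of "1 / s"] assms(1) by (simp add: epowr_epowr)
  then have "epowr (SUP i\<in>I. f i) s \<le> epowr (epowr b (1 / s)) s"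
    using assms(1) by (intro epowr_mono SUP_least) auto
  then show ?thesis using assms(1) by (simp add: epowr_epowr)
qed

lemma suminf_half_ennreal:
  assumes "0 \<le> e"
  shows "(\<Sum>n. ennreal (e * (1/2) ^ Suc n)) = ennreal e"
  using assms sums_mult[OF power_half_series, of e] by (intro suminf_ennreal_eq) auto

lemma le_suminf_ennreal: "f k \<le> (\<Sum>i. f i :: ennreal)"
  using sum_le_suminf[of f "{k}"] by simp

subsection \<open>Regularity of finite Borel measures on metric spaces\<close>

text \<open>The open neighbourhoods given by \<open>infdist x C < 1 / Suc n\<close> decrease to the
  closed set \<open>C\<close>, and a finite measure is continuous along decreasing
  sequences.\<close>

lemma closed_outer_approx:
  fixes Q :: "'a::metric_space measure"
  assumes "finite_measure Q" "sets Q = sets borel" "closed C" "(0::real) < e"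
  shows "\<exists>V. open V \<and> C \<subseteq> V \<and> emeasure Q (V - C) < ennreal e"
proof (cases "C = {}")
  case True
  then show ?thesis using assms by (intro exI[of _ "{}"]) auto
next
  case False
  interpret finite_measure Q by fact
  define V where "V n = {x. infdist x C < 1 / real (Suc n)}" for n
  have op: "open (V n)" for n
    unfolding V_def by (intro open_Collect_less continuous_intros)
  have int: "(\<Inter>n. V n - C) = {}"
  proof -
    have "x \<in> C" if "\<And>n. x \<in> V n" for x
    proof (rule ccontr)
      assume "x \<notin> C"
      then have "infdist x C > 0"
        using in_closed_iff_infdist_zero[OF assms(3) False] infdist_nonneg[of x C] by force
      then obtain n where "1 / real (Suc n) < infdist x C"
        using nat_approx_posE by blast
      with that[of n] show False by (simp add: V_def)
    qed
    then show ?thesis by auto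
  qed
  have "(\<lambda>n. emeasure Q (V n - C)) \<longlonglongrightarrow> emeasure Q (\<Inter>n. V n - C)"
  proof (rule Lim_emeasure_decseq)
    show "range (\<lambda>n. V n - C) \<subseteq> sets Q"
      using op assms by auto
    show "decseq (\<lambda>n. V n - C)"
      unfolding decseq_def V_def
    proof (intro allI impI subsetI)
      fix m n :: nat and x assume "m \<le> n" and x: "x \<in> {x. infdist x C < 1 / real (Suc n)} - C"
      then have "1 / real (Suc n) \<le> 1 / real (Suc m)" by (simp add: frac_le)
      with x show "x \<in> {x. infdist x C < 1 / real (Suc m)} - C" by auto
    qed
  qed auto
  then have "(\<lambda>n. emeasure Q (V n - C)) \<longlonglongrightarrow> 0" unfolding int by simp
  then have "\<forall>\<^sub>F n in sequentially. emeasure Q (V n - C) < ennreal e"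
    using assms(4) by (intro order_tendstoD) auto
  then obtain n where "emeasure Q (V n - C) < ennreal e"
    using eventually_happens trivial_limit_sequentially by blast
  moreover have "C \<subseteq> V n" by (auto simp: V_def)
  ultimately show ?thesis using op by blast
qed

text \<open>Induction over the sigma-algebra generated by the closed sets. Bounding
  \<open>V - F\<close> approximates from both sides at once and is symmetric under complements,
  which swap the roles of \<open>F\<close> and \<open>V\<close>.\<close>

lemma borel_regular:
  fixes Q :: "'a::metric_space measure"
  assumes fin: "finite_measure Q" and Q: "sets Q = sets borel" and "A \<in> sets borel"
  shows "\<forall>e>0::real. \<exists>F V. closed F \<and> open V \<and> F \<subseteq> A \<and> A \<subseteq> V \<and> emeasure Q (V - F) < ennreal e"
proof -
  interpret finite_measure Q by fact
  have "A \<in> sigma_sets UNIV {S. closed S}"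
    using assms(3) by (simp add: borel_eq_closed)
  then show ?thesis
  proof (induction rule: sigma_sets.induct)
    case (Basic C)
    then have "closed C" by simp
    with closed_outer_approx[OF fin Q this] show ?case by (metis order_refl)
  next
    case Empty
    show ?case by (intro allI impI, rule exI[of _ "{}"], rule exI[of _ "{}"]) auto
  next
    case (Compl A)
    show ?case
    proof (intro allI impI)
      fix e :: real assume "0 < e"
      from Compl.IH[rule_format, OF this]
      obtain F V where "closed F" "open V" "F \<subseteq> A" "A \<subseteq> V" "emeasure Q (V - F) < ennreal e"
        by (elim exE conjE)
      moreover have "- F - - V = V - F" by auto
      ultimately show "\<exists>F V. closed F \<and> open V \<and> F \<subseteq> UNIV - A \<and> UNIV - A \<subseteq> V \<and> emeasure Q (V - F) < ennreal e"
        by (intro exI[of _ "- V"] exI[of _ "- F"]) auto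
    qed
  next
    case (Union A)
    show ?case
    proof (intro allI impI)
      fix e :: real assume e: "0 < e"
      then have "\<forall>i. \<exists>F V. closed F \<and> open V \<and> F \<subseteq> A i \<and> A i \<subseteq> V \<and>
          emeasure Q (V - F) < ennreal (e / 2 * (1/2) ^ Suc i)"
        using Union.IH by auto
      then obtain F V where FV: "\<And>i. closed (F i)" "\<And>i. open (V i)" "\<And>i. F i \<subseteq> A i" "\<And>i. A i \<subseteq> V i"
          "\<And>i::nat. emeasure Q (V i - F i) < ennreal (e / 2 * (1/2) ^ Suc i)"
        by metis
      let ?V = "\<Union>i. V i"
      have m: "V i \<in> sets Q" "F i \<in> sets Q" for i using FV Q by auto
      have "emeasure Q (?V - (\<Union>i. F i)) \<le> emeasure Q (\<Union>i. V i - F i)"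
        using m by (intro emeasure_mono) auto
      also have "\<dots> \<le> (\<Sum>i. emeasure Q (V i - F i))"
        using m by (intro emeasure_subadditive_countably) auto
      also have "\<dots> \<le> (\<Sum>i. ennreal (e / 2 * (1/2) ^ Suc i))"
        using FV(5) by (intro suminf_le) (auto intro: less_imp_le)
      also have "\<dots> = ennreal (e / 2)" using e by (intro suminf_half_ennreal) auto
      also have "\<dots> < ennreal e" using e by (simp add: ennreal_less_iff)
      finally have less: "emeasure Q (?V - (\<Union>i. F i)) < ennreal e" .
      \<comment> \<open>The full union of the \<open>F i\<close> need not be closed. Continuity from
        above lets a finite union do, at the price of the slack between \<open>e / 2\<close> and
        \<open>e\<close>.\<close>
      have "(\<lambda>n. emeasure Q (?V - (\<Union>i\<le>n. F i))) \<longlonglongrightarrow> emeasure Q (\<Inter>n. ?V - (\<Union>i\<le>n. F i))"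
        using m by (intro Lim_emeasure_decseq) (auto simp: decseq_def intro: order_trans)
      also have "(\<Inter>n. ?V - (\<Union>i\<le>n. F i)) = ?V - (\<Union>i. F i)" by auto
      finally have "\<forall>\<^sub>F n in sequentially. emeasure Q (?V - (\<Union>i\<le>n. F i)) < ennreal e"
        using less by (intro order_tendstoD) auto
      then obtain n where n: "emeasure Q (?V - (\<Union>i\<le>n. F i)) < ennreal e"
        using eventually_happens trivial_limit_sequentially by blast
      show "\<exists>F V. closed F \<and> open V \<and> F \<subseteq> \<Union>(range A) \<and> \<Union>(range A) \<subseteq> V \<and> emeasure Q (V - F) < ennreal e"
      proof (intro exI conjI)
        show "closed (\<Union>i\<le>n. F i)" using FV by (intro closed_UN) auto
        show "open ?V" using FV by auto
        show "(\<Union>i\<le>n. F i) \<subseteq> \<Union>(range A)" "\<Union>(range A) \<subseteq> ?V" using FV(3,4) by blast+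
      qed (rule n)
    qed
  qed
qed

lemma borel_regular_closed:
  fixes Q :: "'a::metric_space measure"
  assumes "finite_measure Q" "sets Q = sets borel" "A \<in> sets borel" "(0::real) < e"
  obtains F where "closed F" "F \<subseteq> A" "emeasure Q (A - F) < ennreal e"
proof -
  obtain F V where FV: "closed F" "open V" "F \<subseteq> A" "A \<subseteq> V" "emeasure Q (V - F) < ennreal e"
    using borel_regular[OF assms(1-3), rule_format, OF assms(4)] by (elim exE conjE)
  then have "emeasure Q (A - F) \<le> emeasure Q (V - F)"
    using assms(2) by (intro emeasure_mono) auto
  with FV that show ?thesis by force
qed

lemma borel_regular_open:
  fixes Q :: "'a::metric_space measure"
  assumes "finite_measure Q" "sets Q = sets borel" "A \<in> sets borel" "(0::real) < e"
  obtains V where "open V" "A \<subseteq> V" "emeasure Q (V - A) < ennreal e"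
proof -
  obtain F V where FV: "closed F" "open V" "F \<subseteq> A" "A \<subseteq> V" "emeasure Q (V - F) < ennreal e"
    using borel_regular[OF assms(1-3), rule_format, OF assms(4)] by (elim exE conjE)
  then have "emeasure Q (V - A) \<le> emeasure Q (V - F)"
    using assms(2) by (intro emeasure_mono) auto
  with FV that show ?thesis by force
qed

text \<open>For each rational \<open>q\<close>, all of \<open>A\<close> up to small measure splits
  into two closed sets, one inside \<open>f < q\<close> and one inside \<open>q \<le> f\<close>. On
  the intersection \<open>K\<close> of these unions both conditions are relatively closed, hence
  both are relatively open, for every \<open>q\<close>; this is continuity.\<close>

lemma lusin_closed:
  fixes Q :: "'a::metric_space measure" and f :: "'a \<Rightarrow> real"
  assumes fin: "finite_measure Q" and Q: "sets Q = sets borel" and A: "A \<in> sets borel"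
    and f [measurable]: "f \<in> borel_measurable borel" and e: "0 < e"
  obtains K where "closed K" "K \<subseteq> A" "emeasure Q (A - K) < ennreal e" "continuous_on K f"
proof -
  \<comment> \<open>Each rational costs twice \<open>?d n\<close>, so the total is
    \<open>e / 2\<close>, strictly below \<open>e\<close>.\<close>
  let ?d = "\<lambda>n. e / 4 * (1/2) ^ Suc n"
  have "\<exists>K1 K2. closed K1 \<and> closed K2 \<and> K1 \<subseteq> A \<inter> {x. f x < of_rat q} \<and> K2 \<subseteq> A \<inter> {x. of_rat q \<le> f x} \<and>
     emeasure Q (A - (K1 \<union> K2)) \<le> ennreal (2 * ?d n)" for n and q :: rat
  proof -
    have 1: "A \<inter> {x. f x < of_rat q} \<in> sets borel" "A \<inter> {x. of_rat q \<le> f x} \<in> sets borel"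
      using A by measurable
    have d: "0 < ?d n" using e by auto
    obtain K1 where K1: "closed K1" "K1 \<subseteq> A \<inter> {x. f x < of_rat q}" "emeasure Q (A \<inter> {x. f x < of_rat q} - K1) < ennreal (?d n)"
      using borel_regular_closed[OF fin Q 1(1) d] by blast
    obtain K2 where K2: "closed K2" "K2 \<subseteq> A \<inter> {x. of_rat q \<le> f x}" "emeasure Q (A \<inter> {x. of_rat q \<le> f x} - K2) < ennreal (?d n)"
      using borel_regular_closed[OF fin Q 1(2) d] by blast
    have "emeasure Q (A - (K1 \<union> K2)) \<le> emeasure Q ((A \<inter> {x. f x < of_rat q} - K1) \<union> (A \<inter> {x. of_rat q \<le> f x} - K2))"
      using 1 K1 K2 Q by (intro emeasure_mono) auto
    also have "\<dots> \<le> emeasure Q (A \<inter> {x. f x < of_rat q} - K1) + emeasure Q (A \<inter> {x. of_rat q \<le> f x} - K2)"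
      using 1 K1 K2 Q by (intro emeasure_subadditive) auto
    also have "\<dots> \<le> ennreal (?d n) + ennreal (?d n)"
      using K1 K2 by (intro add_mono) auto
    also have "\<dots> = ennreal (2 * ?d n)" using d by (subst ennreal_plus[symmetric]) auto
    finally show ?thesis using K1 K2 by blast
  qed
  then have "\<forall>n. \<exists>K1 K2. closed K1 \<and> closed K2 \<and> K1 \<subseteq> A \<inter> {x. f x < of_rat (from_nat n)} \<and>
     K2 \<subseteq> A \<inter> {x. of_rat (from_nat n) \<le> f x} \<and>
     emeasure Q (A - (K1 \<union> K2)) \<le> ennreal (2 * ?d n)" by blast
  then obtain K1 K2 where K: "\<And>n. closed (K1 n)" "\<And>n. closed (K2 n)"
    "\<And>n. K1 n \<subseteq> A \<inter> {x. f x < of_rat (from_nat n)}" "\<And>n. K2 n \<subseteq> A \<inter> {x. of_rat (from_nat n) \<le> f x}"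
    "\<And>n. emeasure Q (A - (K1 n \<union> K2 n)) \<le> ennreal (2 * ?d n)"
    by metis
  define K where "K = (\<Inter>n. K1 n \<union> K2 n)"
  have Km: "K1 n \<in> sets Q" "K2 n \<in> sets Q" for n using K Q by auto
  have closedK: "closed K" unfolding K_def using K by auto
  have "emeasure Q (A - K) = emeasure Q (\<Union>n. A - (K1 n \<union> K2 n))"
    by (rule arg_cong[of _ _ "emeasure Q"]) (auto simp: K_def)
  also have "\<dots> \<le> (\<Sum>n. emeasure Q (A - (K1 n \<union> K2 n)))"
    using Km A Q by (intro emeasure_subadditive_countably) auto
  also have "\<dots> \<le> (\<Sum>n. ennreal (e/2 * (1/2) ^ Suc n))"
    using K(5) by (intro suminf_le) auto
  also have "\<dots> = ennreal (e / 2)" using e by (intro suminf_half_ennreal) auto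
  also have "\<dots> < ennreal e" using e by (simp add: ennreal_less_iff)
  finally have less: "emeasure Q (A - K) < ennreal e" .
  have "continuous_on K f"
    unfolding continuous_on_def
  proof
    fix x assume x: "x \<in> K"
    show "(f \<longlongrightarrow> f x) (at x within K)"
    proof (rule order_tendstoI)
      fix a assume "a < f x"
      then obtain q where q: "a < of_rat q" "of_rat q < f x" using of_rat_dense by blast
      let ?n = "to_nat q"
      have "x \<in> - K1 ?n" using K(3)[of ?n] q by auto
      moreover have "a < f y" if "y \<in> K" "y \<in> - K1 ?n" for y
        using that K(4)[of ?n] q by (force simp: K_def)
      ultimately show "\<forall>\<^sub>F y in at x within K. a < f y"
        unfolding eventually_at_topological using K(1)[of ?n] by (intro exI[of _ "- K1 ?n"]) auto
    next
      fix a assume "f x < a"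
      then obtain q where q: "f x < of_rat q" "of_rat q < a" using of_rat_dense by blast
      let ?n = "to_nat q"
      have "x \<in> - K2 ?n" using K(4)[of ?n] q by auto
      moreover have "f y < a" if "y \<in> K" "y \<in> - K2 ?n" for y
        using that K(3)[of ?n] q by (force simp: K_def)
      ultimately show "\<forall>\<^sub>F y in at x within K. f y < a"
        unfolding eventually_at_topological using K(2)[of ?n] by (intro exI[of _ "- K2 ?n"]) auto
    qed
  qed
  moreover have "K \<subseteq> A" using K(3)[of 0] K(4)[of 0] by (auto simp: K_def)
  ultimately show ?thesis using that closedK less by blast
qed

text \<open>Since \<open>1 \<le> p\<close>, the coefficients at least double from one layer to the
  next, so the sum over the active layers is at most twice its last term. If layer \<open>n\<close>
  is active, its coefficient is at most \<open>2 powr p\<close> times the p-th power of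
  \<open>g x\<close>.\<close>

lemma dyadic_layer_sum:
  assumes "1 \<le> p"
  shows "(\<Sum>k. ennreal ((2 ^ Suc k) powr p) * indicator {x. ennreal (2 ^ k) < g x} x)
     \<le> ennreal (2 * 2 powr p) * epowr (g x) p"
proof -
  let ?c = "\<lambda>k. ennreal ((2 ^ Suc k) powr p)"
  have c: "2 * ?c k \<le> ?c (Suc k)" for k
  proof -
    have "2 powr 1 \<le> (2::real) powr p" using assms by (intro powr_mono) auto
    moreover have "((2::real) ^ Suc (Suc k)) powr p = 2 powr p * (2 ^ Suc k) powr p"
      using powr_mult[of "2::real" "2 ^ Suc k" p] by simp
    ultimately have "2 * (2 ^ Suc k) powr p \<le> ((2::real) ^ Suc (Suc k)) powr p"
      by (simp add: mult_right_mono)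
    then show ?thesis
      by (metis ennreal_leI ennreal_mult ennreal_numeral powr_ge_zero zero_le_numeral)
  qed
  have up: "?c n \<le> ennreal (2 powr p) * epowr (g x) p" if "ennreal (2 ^ n) < g x" for n
  proof -
    have "?c n = ennreal (2 powr p) * epowr (ennreal (2 ^ n)) p"
      by (simp add: epowr_ennreal ennreal_mult[symmetric] powr_mult)
    also have "\<dots> \<le> ennreal (2 powr p) * epowr (g x) p"
      using that assms by (intro mult_left_mono epowr_mono) auto
    finally show ?thesis .
  qed
  define S where "S n = (\<Sum>k<n. ?c k * indicator {x. ennreal (2 ^ k) < g x} x)" for n
  \<comment> \<open>The first bound is what carries the induction: it lets the newest coefficient
    absorb all earlier terms.\<close>
  have "S n \<le> ?c n \<and> S n \<le> ennreal (2 * 2 powr p) * epowr (g x) p" for n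
  proof (induction n)
    case (Suc n)
    show ?case
    proof (cases "ennreal (2 ^ n) < g x")
      case True
      then have "S (Suc n) = S n + ?c n" by (simp add: S_def)
      also have "\<dots> \<le> ?c n + ?c n"
        by (rule add_mono[OF conjunct1[OF Suc.IH] order_refl])
      also have "\<dots> = 2 * ?c n" by (rule mult_2[symmetric])
      finally have 1: "S (Suc n) \<le> 2 * ?c n" .
      also have "\<dots> \<le> 2 * (ennreal (2 powr p) * epowr (g x) p)"
        by (rule mult_left_mono[OF up[OF True]]) simp
      also have "\<dots> = ennreal (2 * 2 powr p) * epowr (g x) p"
        by (simp add: ennreal_mult mult.assoc)
      finally show ?thesis using order_trans[OF 1 c[of n]] by blast
    next
      case False
      then have "S (Suc n) = S n" by (simp add: S_def)
      moreover have "?c n \<le> ?c (Suc n)"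
        using assms by (intro ennreal_leI powr_mono2) auto
      ultimately show ?thesis using Suc.IH order_trans by metis
    qed
  qed (simp add: S_def)
  then show ?thesis unfolding S_def
    by (intro suminf_le_const) auto
qed

text \<open>
  As in the Vitali--Caratheodory theorem, but without control of the norm: replacing the
  layers \<open>{g > 2 ^ k}\<close> by open sets of almost the same measure suffices.
\<close>

lemma lsc_majorant:
  fixes Q :: "'a::metric_space measure" and g :: "'a \<Rightarrow> ennreal"
  assumes fin: "finite_measure Q" and Q: "sets Q = sets borel" and p: "1 \<le> p"
    and g [measurable]: "g \<in> borel_measurable borel" and int: "(\<integral>\<^sup>+x. epowr (g x) p \<partial>Q) < \<infinity>"
  obtains h :: "'a \<Rightarrow> ennreal" where "\<And>a. open {x. a < h x}" "\<And>x. g x \<le> h x" "\<And>x. 1 \<le> h x"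
    "(\<integral>\<^sup>+x. epowr (h x) p \<partial>Q) < \<infinity>"
proof -
  interpret finite_measure Q by fact
  let ?c = "\<lambda>k. (2 ^ Suc k) powr p :: real"
  define A where "A k = {x. ennreal (2 ^ k) < g x}" for k :: nat
  have A[measurable]: "A k \<in> sets borel" for k unfolding A_def by measurable
  have cpos: "0 < ?c k" for k by simp
  \<comment> \<open>Dividing by the layer coefficient makes the weighted excess of all the
    \<open>V k\<close> over the \<open>A k\<close> sum to at most 1.\<close>
  have "\<forall>k. \<exists>V. open V \<and> A k \<subseteq> V \<and> emeasure Q (V - A k) < ennreal ((1/2) ^ Suc k / ?c k)"
    using borel_regular_open[OF fin Q A] cpos
    by (metis divide_pos_pos half_gt_zero_iff zero_less_one zero_less_power)
  then obtain V where V: "\<And>k. open (V k)" "\<And>k. A k \<subseteq> V k"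
    "\<And>k. emeasure Q (V k - A k) < ennreal ((1/2) ^ Suc k / ?c k)"
    by metis
  have Vm[measurable]: "V k \<in> sets Q" "A k \<in> sets Q" "V k \<in> sets borel" for k using V Q by auto
  \<comment> \<open>Layer \<open>k\<close> carries the value \<open>2 ^ Suc k\<close> because it has
    to dominate \<open>g\<close> where \<open>2 ^ k < g x \<le> 2 ^ Suc k\<close>; the constant 1
    covers \<open>g x \<le> 1\<close>.\<close>
  define h where "h x = max 1 (SUP k. ennreal (2 ^ Suc k) * indicator (V k) x)" for x
  have op: "open {x. a < h x}" for a
  proof (cases "a < 1")
    case True
    then have "{x. a < h x} = UNIV" by (auto simp: h_def less_max_iff_disj)
    then show ?thesis by simp
  next
    case False
    then have "{x. a < h x} = (\<Union>k\<in>{k. a < ennreal (2 ^ Suc k)}. V k)"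
      by (auto simp: h_def less_max_iff_disj less_SUP_iff indicator_def split: if_splits)
    then show ?thesis using V by auto
  qed
  have gh: "g x \<le> h x" for x
  proof (cases "g x \<le> 1")
    case True
    then show ?thesis by (auto simp: h_def intro: order_trans)
  next
    case False
    define B where "B = (SUP k. ennreal (2 ^ Suc k) * indicator (V k) x)"
    have le: "ennreal (2 ^ Suc k) \<le> B" if "ennreal (2 ^ k) < g x" for k
    proof -
      have "x \<in> V k" using that V(2) by (auto simp: A_def)
      then show ?thesis unfolding B_def by (intro SUP_upper2[of k]) auto
    qed
    \<comment> \<open>If \<open>B < g x\<close>, then each active layer gives
      \<open>2 ^ Suc k \<le> B < g x\<close>, which activates the next layer. All layers are then
      active and \<open>B\<close> is infinite.\<close>
    have "g x \<le> B"
    proof (rule ccontr)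
      assume B: "\<not> g x \<le> B"
      have "ennreal (2 ^ k) < g x" for k
      proof (induction k)
        case 0 then show ?case using False by simp
      next
        case (Suc k) then show ?case using le[of k] B by auto
      qed
      then have all: "ennreal (2 ^ Suc k) \<le> B" for k using le by blast
      have "B \<noteq> top" using B by auto
      then obtain b where b: "B = ennreal b" "0 \<le> b" by (cases B) auto
      obtain k where "b < 2 ^ k" using real_arch_pow[of 2 b] by auto
      also have "(2::real) ^ k \<le> 2 ^ Suc k" by simp
      finally show False using all[of k] b by (simp add: ennreal_le_iff)
    qed
    then show ?thesis unfolding h_def B_def by (rule max.coboundedI2)
  qed
  have hp: "epowr (h x) p \<le> 1 + (\<Sum>k. ennreal (?c k) * indicator (V k) x)" for x
  proof -
    have "epowr (SUP k. ennreal (2 ^ Suc k) * indicator (V k) x) p \<le> (\<Sum>k. ennreal (?c k) * indicator (V k) x)"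
    proof (rule epowr_SUP_le)
      fix k
      have "epowr (ennreal (2 ^ Suc k) * indicator (V k) x) p = ennreal (?c k) * indicator (V k) x"
        by (auto simp: indicator_def epowr_ennreal simp del: power_Suc)
      also have "\<dots> \<le> (\<Sum>k. ennreal (?c k) * indicator (V k) x)"
        by (rule le_suminf_ennreal[of "\<lambda>k. ennreal (?c k) * indicator (V k) x"])
      finally show "epowr (ennreal (2 ^ Suc k) * indicator (V k) x) p \<le> (\<Sum>k. ennreal (?c k) * indicator (V k) x)" .
    qed (use p in auto)
    then show ?thesis unfolding h_def
      by (auto simp: max_def add_increasing add_increasing2)
  qed
  have "(\<integral>\<^sup>+x. epowr (h x) p \<partial>Q) \<le> (\<integral>\<^sup>+x. 1 + (\<Sum>k. ennreal (?c k) * indicator (V k) x) \<partial>Q)"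
    by (intro nn_integral_mono hp)
  also have "\<dots> = emeasure Q (space Q) + (\<Sum>k. ennreal (?c k) * emeasure Q (V k))"
    by (simp add: nn_integral_add nn_integral_suminf nn_integral_cmult del: power_Suc)
  also have "(\<Sum>k. ennreal (?c k) * emeasure Q (V k)) \<le> (\<Sum>k. ennreal (?c k) * emeasure Q (A k) + ennreal (1 * (1/2) ^ Suc k))"
  proof (intro suminf_le)
    fix k
    have "emeasure Q (V k) \<le> emeasure Q (A k) + emeasure Q (V k - A k)"
      using emeasure_subadditive[of "A k" Q "V k - A k"] Un_absorb1[OF V(2)[of k]] by simp
    also have "\<dots> \<le> emeasure Q (A k) + ennreal ((1/2) ^ Suc k / ?c k)"
      using V(3)[of k] by (intro add_mono) auto
    finally have "ennreal (?c k) * emeasure Q (V k) \<le> ennreal (?c k) * (emeasure Q (A k) + ennreal ((1/2) ^ Suc k / ?c k))"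
      by (intro mult_left_mono) auto
    also have "\<dots> = ennreal (?c k) * emeasure Q (A k) + ennreal (1 * (1/2) ^ Suc k)"
      using cpos[of k] by (simp add: distrib_left ennreal_mult[symmetric] del: power_Suc)
    finally show "ennreal (?c k) * emeasure Q (V k) \<le> ennreal (?c k) * emeasure Q (A k) + ennreal (1 * (1/2) ^ Suc k)" .
  qed auto
  also have "\<dots> = (\<Sum>k. ennreal (?c k) * emeasure Q (A k)) + ennreal 1"
    by (simp only: suminf_add[OF summableI summableI, symmetric] suminf_half_ennreal[OF zero_le_one])
  also have "(\<Sum>k. ennreal (?c k) * emeasure Q (A k)) = (\<integral>\<^sup>+x. (\<Sum>k. ennreal (?c k) * indicator (A k) x) \<partial>Q)"
    by (simp add: nn_integral_suminf nn_integral_cmult del: power_Suc)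
  also have "\<dots> \<le> (\<integral>\<^sup>+x. ennreal (2 * 2 powr p) * epowr (g x) p \<partial>Q)"
    using dyadic_layer_sum[OF p] by (intro nn_integral_mono) (auto simp: A_def)
  also have "\<dots> = ennreal (2 * 2 powr p) * (\<integral>\<^sup>+x. epowr (g x) p \<partial>Q)"
    using g Q by (intro nn_integral_cmult) (simp add: measurable_compose[OF _ epowr_measurable] cong: measurable_cong_sets)
  finally have "(\<integral>\<^sup>+x. epowr (h x) p \<partial>Q) \<le> emeasure Q (space Q) + (ennreal (2 * 2 powr p) * (\<integral>\<^sup>+x. epowr (g x) p \<partial>Q) + ennreal 1)"
    by (simp add: add_mono)
  also have "\<dots> < \<infinity>"
    using int less_top[THEN iffD1, OF emeasure_finite[of "space Q"]]
    by (auto simp: ennreal_mult_less_top)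
  finally have fin_h: "(\<integral>\<^sup>+x. epowr (h x) p \<partial>Q) < \<infinity>" .
  have "1 \<le> h x" for x by (simp add: h_def)
  then show ?thesis by (rule that[OF op gh _ fin_h])
qed

subsection \<open>Length of curves\<close>

lemma curve_length_leI:
  assumes "\<And>n t. mono_on {..n::nat} t \<Longrightarrow> t ` {..n} \<subseteq> {a..b} \<Longrightarrow>
     (\<Sum>i<n. ennreal (dist (\<gamma> (t i)) (\<gamma> (t (Suc i))))) \<le> c"
  shows "curve_length \<gamma> a b \<le> c"
  unfolding curve_length_def using assms by (intro SUP_least) auto

lemma curve_length_geI:
  assumes "mono_on {..n::nat} t" "t ` {..n} \<subseteq> {a..b}"
  shows "(\<Sum>i<n. ennreal (dist (\<gamma> (t i)) (\<gamma> (t (Suc i))))) \<le> curve_length \<gamma> a b"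
  unfolding curve_length_def using assms
  by (intro SUP_upper2[of "(n, t)"]) auto

lemma curve_length_ge_dist:
  assumes "a \<le> s" "s \<le> t" "t \<le> b"
  shows "ennreal (dist (\<gamma> s) (\<gamma> t)) \<le> curve_length \<gamma> a b"
proof -
  let ?t = "\<lambda>i::nat. if i = 0 then s else t"
  have "mono_on {..1} ?t" "?t ` {..1} \<subseteq> {a..b}" using assms by (auto simp: mono_on_def)
  from curve_length_geI[OF this, of \<gamma>] show ?thesis by simp
qed

lemma curve_length_reparam_le:
  assumes "mono_on {a..b} \<sigma>" "\<sigma> ` {a..b} \<subseteq> {a'..b'}" "\<And>x. x \<in> {a..b} \<Longrightarrow> \<delta> x = \<gamma> (\<sigma> x)"
  shows "curve_length \<delta> a b \<le> curve_length \<gamma> a' b'"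
proof (rule curve_length_leI)
  fix n and t :: "nat \<Rightarrow> real"
  assume t: "mono_on {..n} t" "t ` {..n} \<subseteq> {a..b}"
  then have "(\<Sum>i<n. ennreal (dist (\<delta> (t i)) (\<delta> (t (Suc i))))) =
     (\<Sum>i<n. ennreal (dist (\<gamma> ((\<sigma> \<circ> t) i)) (\<gamma> ((\<sigma> \<circ> t) (Suc i)))))"
    using assms(3) by (intro sum.cong) (auto simp: image_subset_iff)
  also have "\<dots> \<le> curve_length \<gamma> a' b'"
  proof (rule curve_length_geI)
    show "mono_on {..n} (\<sigma> \<circ> t)"
      using t assms(1) by (force simp: mono_on_def image_subset_iff)
    show "(\<sigma> \<circ> t) ` {..n} \<subseteq> {a'..b'}"
      using t(2) assms(2) by (force simp: image_subset_iff)
  qed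
  finally show "(\<Sum>i<n. ennreal (dist (\<delta> (t i)) (\<delta> (t (Suc i))))) \<le> curve_length \<gamma> a' b'" .
qed

lemma curve_length_shift: "curve_length (\<lambda>t. \<gamma> (c + t)) a b = curve_length \<gamma> (c + a) (c + b)"
proof (rule antisym)
  show "curve_length (\<lambda>t. \<gamma> (c + t)) a b \<le> curve_length \<gamma> (c + a) (c + b)"
    by (rule curve_length_reparam_le[where \<sigma> = "\<lambda>t. c + t"]) (auto simp: mono_on_def)
  show "curve_length \<gamma> (c + a) (c + b) \<le> curve_length (\<lambda>t. \<gamma> (c + t)) a b"
    by (rule curve_length_reparam_le[where \<sigma> = "\<lambda>t. t - c"]) (auto simp: mono_on_def)
qed

text \<open>For one inequality a partition is clipped at \<open>b\<close> from both sides by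
  \<open>min\<close> and \<open>max\<close>; for the other, two partitions are concatenated.\<close>

lemma curve_length_append:
  assumes "a \<le> b" "b \<le> c"
  shows "curve_length \<gamma> a c = curve_length \<gamma> a b + curve_length \<gamma> b c"
proof (rule antisym)
  show "curve_length \<gamma> a c \<le> curve_length \<gamma> a b + curve_length \<gamma> b c"
  proof (rule curve_length_leI)
    fix n and t :: "nat \<Rightarrow> real"
    assume t: "mono_on {..n} t" "t ` {..n} \<subseteq> {a..c}"
    let ?t1 = "\<lambda>i. min (t i) b" and ?t2 = "\<lambda>i. max (t i) b"
    have "ennreal (dist (\<gamma> (t i)) (\<gamma> (t (Suc i)))) \<le>
        ennreal (dist (\<gamma> (?t1 i)) (\<gamma> (?t1 (Suc i)))) + ennreal (dist (\<gamma> (?t2 i)) (\<gamma> (?t2 (Suc i))))"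
      if "i < n" for i
    proof -
      have "t i \<le> t (Suc i)" using t that by (auto simp: mono_on_def)
      then have "dist (\<gamma> (t i)) (\<gamma> (t (Suc i))) \<le>
        dist (\<gamma> (?t1 i)) (\<gamma> (?t1 (Suc i))) + dist (\<gamma> (?t2 i)) (\<gamma> (?t2 (Suc i)))"
        by (auto simp: min_def max_def dist_triangle)
      then show ?thesis by (simp add: ennreal_leI flip: ennreal_plus)
    qed
    then have "(\<Sum>i<n. ennreal (dist (\<gamma> (t i)) (\<gamma> (t (Suc i))))) \<le>
      (\<Sum>i<n. ennreal (dist (\<gamma> (?t1 i)) (\<gamma> (?t1 (Suc i)))) + ennreal (dist (\<gamma> (?t2 i)) (\<gamma> (?t2 (Suc i)))))"
      by (intro sum_mono) auto
    also have "\<dots> \<le> curve_length \<gamma> a b + curve_length \<gamma> b c"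
      unfolding sum.distrib
    proof (intro add_mono curve_length_geI)
      show "mono_on {..n} ?t1" "mono_on {..n} ?t2"
        using t(1) by (fastforce simp: mono_on_def min_def max_def)+
      show "?t1 ` {..n} \<subseteq> {a..b}" "?t2 ` {..n} \<subseteq> {b..c}"
        using t(2) assms by (auto simp: image_subset_iff)
    qed
    finally show "(\<Sum>i<n. ennreal (dist (\<gamma> (t i)) (\<gamma> (t (Suc i))))) \<le> curve_length \<gamma> a b + curve_length \<gamma> b c" .
  qed
next
  have key: "(\<Sum>i<n. ennreal (dist (\<gamma> (t i)) (\<gamma> (t (Suc i))))) +
       (\<Sum>i<m. ennreal (dist (\<gamma> (s i)) (\<gamma> (s (Suc i))))) \<le> curve_length \<gamma> a c"
    if t: "mono_on {..n} t" "t ` {..n} \<subseteq> {a..b}" and s: "mono_on {..m} s" "s ` {..m} \<subseteq> {b..c}"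
    for n m :: nat and s t :: "nat \<Rightarrow> real"
  proof -
    \<comment> \<open>The increment with index \<open>n\<close> joins \<open>t n\<close> to
      \<open>s 0\<close> and belongs to neither partition. Dropping it only decreases the sum, so
      the index sets skip from \<open>{..<n}\<close> to \<open>Suc n\<close>.\<close>
    let ?r = "\<lambda>i. if i \<le> n then t i else s (i - Suc n)"
    let ?d = "\<lambda>i. ennreal (dist (\<gamma> (?r i)) (\<gamma> (?r (Suc i))))"
    have "(\<Sum>i<m. ennreal (dist (\<gamma> (s i)) (\<gamma> (s (Suc i))))) = sum ?d {Suc n..<Suc n + m}"
      using sum.shift_bounds_nat_ivl[of ?d 0 "Suc n" m]
      by (simp add: atLeast0LessThan add.commute)
    moreover have "(\<Sum>i<n. ennreal (dist (\<gamma> (t i)) (\<gamma> (t (Suc i))))) = sum ?d {..<n}"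
      by (intro sum.cong) auto
    ultimately have "(\<Sum>i<n. ennreal (dist (\<gamma> (t i)) (\<gamma> (t (Suc i))))) +
       (\<Sum>i<m. ennreal (dist (\<gamma> (s i)) (\<gamma> (s (Suc i))))) = sum ?d ({..<n} \<union> {Suc n..<Suc n + m})"
      by (subst sum.union_disjoint) auto
    also have "\<dots> \<le> sum ?d {..<Suc n + m}"
      by (intro sum_mono2) auto
    also have "\<dots> \<le> curve_length \<gamma> a c"
    proof (rule curve_length_geI)
      show "?r ` {..Suc n + m} \<subseteq> {a..c}"
      proof
        fix y assume "y \<in> ?r ` {..Suc n + m}"
        then obtain i where i: "i \<le> Suc n + m" "y = ?r i" unfolding image_iff atMost_iff by blast
        show "y \<in> {a..c}"
        proof (cases "i \<le> n")
          case True
          then have "t i \<in> {a..b}" using t(2) by blast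
          then show ?thesis using True i assms by auto
        next
          case False
          then have "s (i - Suc n) \<in> {b..c}" using s(2) i by (intro subsetD[OF s(2)]) auto
          then show ?thesis using False i assms by auto
        qed
      qed
      show "mono_on {..Suc n + m} ?r"
      proof (rule mono_onI)
        fix i j assume ij: "i \<in> {..Suc n + m}" "j \<in> {..Suc n + m}" "i \<le> j"
        consider "j \<le> n" | "i \<le> n" "n < j" | "n < i" using ij by linarith
        then show "?r i \<le> ?r j"
        proof cases
          case 1
          then show ?thesis using t(1) ij by (auto simp: mono_on_def)
        next
          case 2
          then have "t i \<le> b" "b \<le> s (j - Suc n)"
            using t(2) s(2) ij by (auto simp: image_subset_iff)
          then show ?thesis using 2 by auto
        next
          case 3
          then have "s (i - Suc n) \<le> s (j - Suc n)" using ij by (intro mono_onD[OF s(1)]) auto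
          then show ?thesis using 3 ij by auto
        qed
      qed
    qed
    finally show ?thesis .
  qed
  have "(\<Sum>i<n. ennreal (dist (\<gamma> (t i)) (\<gamma> (t (Suc i))))) + curve_length \<gamma> b c \<le> curve_length \<gamma> a c"
    if t: "mono_on {..n} t" "t ` {..n} \<subseteq> {a..b}" for n :: nat and t
  proof -
    let ?I = "{(n :: nat, t :: nat \<Rightarrow> real). mono_on {..n} t \<and> t ` {..n} \<subseteq> {b..c}}"
    have "(0, \<lambda>_. b) \<in> ?I" using assms by (auto simp: mono_on_def)
    then have "?I \<noteq> {}" by blast
    then show ?thesis
      unfolding curve_length_def[of _ b c] ennreal_SUP_add_right[OF \<open>?I \<noteq> {}\<close>]
      using key[OF t] by (intro SUP_least) auto
  qed
  then show "curve_length \<gamma> a b + curve_length \<gamma> b c \<le> curve_length \<gamma> a c"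
  proof -
    let ?I = "{(n :: nat, t :: nat \<Rightarrow> real). mono_on {..n} t \<and> t ` {..n} \<subseteq> {a..b}}"
    assume *: "\<And>n t. mono_on {..n::nat} t \<Longrightarrow> t ` {..n} \<subseteq> {a..b} \<Longrightarrow>
       (\<Sum>i<n. ennreal (dist (\<gamma> (t i)) (\<gamma> (t (Suc i))))) + curve_length \<gamma> b c \<le> curve_length \<gamma> a c"
    have "(0, \<lambda>_. a) \<in> ?I" using assms by (auto simp: mono_on_def)
    then have "?I \<noteq> {}" by blast
    then show ?thesis
      unfolding curve_length_def[of _ a b] ennreal_SUP_add_left[OF \<open>?I \<noteq> {}\<close>, symmetric]
      using * by (intro SUP_least) auto
  qed
qed

lemma arc_length_curve_length:
  assumes "arc_length_curve S l \<gamma>" "0 \<le> s" "s \<le> t" "t \<le> l"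
  shows "curve_length \<gamma> s t = ennreal (t - s)"
proof -
  have "curve_length \<gamma> 0 s = ennreal s" "curve_length \<gamma> 0 t = ennreal t"
    using assms by (auto simp: arc_length_curve_def)
  moreover have "ennreal t = ennreal s + ennreal (t - s)"
    using assms by (subst ennreal_plus[symmetric]) auto
  ultimately have "ennreal s + curve_length \<gamma> s t = ennreal s + ennreal (t - s)"
    using assms curve_length_append[of 0 s t \<gamma>] by simp
  then show ?thesis by simp
qed

lemma arc_length_curve_dist:
  assumes "arc_length_curve S l \<gamma>" "s \<in> {0..l}" "t \<in> {0..l}"
  shows "dist (\<gamma> s) (\<gamma> t) \<le> \<bar>s - t\<bar>"
proof -
  have *: "dist (\<gamma> s) (\<gamma> t) \<le> t - s" if "0 \<le> s" "s \<le> t" "t \<le> l" for s t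
  proof -
    have "ennreal (dist (\<gamma> s) (\<gamma> t)) \<le> ennreal (t - s)"
      using curve_length_ge_dist[of s s t t \<gamma>] that
      unfolding arc_length_curve_length[OF assms(1) that] by simp
    then show ?thesis using that by (subst (asm) ennreal_le_iff) auto
  qed
  show ?thesis using *[of s t] *[of t s] assms by (cases "s \<le> t") (auto simp: dist_commute)
qed

lemma arc_length_curve_subcurve:
  assumes "arc_length_curve S l \<gamma>" "0 \<le> s" "s < t" "t \<le> l" "\<gamma> ` {s..t} \<subseteq> T"
  shows "arc_length_curve T (t - s) (\<lambda>r. \<gamma> (s + r))"
  unfolding arc_length_curve_def
proof (intro conjI ballI)
  have "continuous_on {0..l} \<gamma>" using assms(1) by (simp add: arc_length_curve_def)
  then show "continuous_on {0..t - s} (\<lambda>r. \<gamma> (s + r))"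
    by (rule continuous_on_compose2) (use assms(2-4) in \<open>auto intro!: continuous_intros\<close>)
  show "(\<lambda>r. \<gamma> (s + r)) ` {0..t - s} \<subseteq> T" using assms(5) by auto
  fix r assume "r \<in> {0..t - s}"
  then show "curve_length (\<lambda>r. \<gamma> (s + r)) 0 r = ennreal r"
    using assms(2-4) arc_length_curve_length[OF assms(1,2), of "s + r"]
    by (simp add: curve_length_shift)
qed (use assms(2-5) in auto)

section \<open>Integrals along curves and along their subcurves\<close>

lemma curve_integrand_measurable:
  fixes g :: "'a::metric_space \<Rightarrow> ennreal"
  assumes "g \<in> borel_measurable (restrict_space borel S)" "continuous_on {s..t::real} \<gamma>" "\<gamma> ` {s..t} \<subseteq> S"
  shows "(\<lambda>r. g (\<gamma> r) * indicator {s..t} r) \<in> borel_measurable borel"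
proof -
  have "\<gamma> \<in> measurable (restrict_space borel {s..t}) (restrict_space borel S)"
    using assms by (intro measurable_restrict_space2 borel_measurable_continuous_on_restrict)
      (auto simp: space_restrict_space)
  then have "(\<lambda>r. g (\<gamma> r)) \<in> borel_measurable (restrict_space borel {s..t})"
    using assms(1) by (rule measurable_compose)
  then show ?thesis by (subst (asm) borel_measurable_restrict_space_iff_ennreal) auto
qed

lemma nn_integral_shift:
  fixes f :: "real \<Rightarrow> ennreal"
  assumes "f \<in> borel_measurable borel"
  shows "(\<integral>\<^sup>+x. f (c + x) \<partial>lborel) = (\<integral>\<^sup>+x. f x \<partial>lborel)"
  using nn_integral_real_affine[OF assms, of 1 c] by simp

lemma nn_integral_reflect:
  fixes f :: "real \<Rightarrow> ennreal"
  assumes "f \<in> borel_measurable borel"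
  shows "(\<integral>\<^sup>+x. f (c - x) \<partial>lborel) = (\<integral>\<^sup>+x. f x \<partial>lborel)"
  using nn_integral_real_affine[OF assms, of "-1" c] by simp

lemma ext_diff_ereal [simp]: "ext_diff (ereal a) (ereal b) = ennreal \<bar>a - b\<bar>"
  by (simp add: ext_diff_def)

text \<open>The whole curve may lie in a larger set \<open>T\<close>; only the piece over
  \<open>{s..t}\<close> has to stay in \<open>S\<close>. This is how a gradient known on a subset is
  used on curves of the ambient space.\<close>

lemma upper_gradient_subcurve:
  fixes F :: "'a::metric_space \<Rightarrow> ereal"
  assumes ug: "upper_gradient S F g" and arc: "arc_length_curve T l \<gamma>"
    and st: "0 \<le> s" "s < t" "t \<le> l" and S: "\<gamma> ` {s..t} \<subseteq> S"
  shows "ext_diff (F (\<gamma> s)) (F (\<gamma> t)) \<le> (\<integral>\<^sup>+r\<in>{s..t}. g (\<gamma> r) \<partial>lborel)"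
proof -
  have "ext_diff (F (\<gamma> (s + 0))) (F (\<gamma> (s + (t - s)))) \<le> (\<integral>\<^sup>+r\<in>{0..t - s}. g (\<gamma> (s + r)) \<partial>lborel)"
    using ug[unfolded upper_gradient_def, THEN conjunct2, rule_format, OF arc_length_curve_subcurve[OF arc st S]] .
  also have "\<dots> = (\<integral>\<^sup>+r. g (\<gamma> (s + r)) * indicator {s..t} (s + r) \<partial>lborel)"
    by (intro nn_integral_cong) (auto simp: indicator_def)
  also have "\<dots> = (\<integral>\<^sup>+r. g (\<gamma> r) * indicator {s..t} r \<partial>lborel)"
  proof (rule nn_integral_shift)
    show "(\<lambda>r. g (\<gamma> r) * indicator {s..t} r) \<in> borel_measurable borel"
      using ug arc st S unfolding upper_gradient_def arc_length_curve_def
      by (intro curve_integrand_measurable[where S = S]) (auto elim!: continuous_on_subset)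
  qed
  finally show ?thesis by simp
qed

subsection \<open>Arc length reparametrization of Lipschitz curves\<close>

text \<open>The intersection is an interval that may miss its endpoints, so its length is recovered
  from compact subintervals through \<open>Inf\<close> and \<open>Sup\<close>. It transfers a bound
  from compact intervals to the components of an open set.\<close>

lemma connected_Int_Icc_emeasure_le:
  fixes C :: "real set"
  assumes C: "connected C" "C \<in> sets borel"
    and b: "\<And>a b. 0 \<le> a \<Longrightarrow> a \<le> b \<Longrightarrow> b \<le> L \<Longrightarrow> {a..b} \<subseteq> C \<Longrightarrow> ennreal (b - a) \<le> m"
  shows "emeasure lborel (C \<inter> {0..L}) \<le> m"
proof (cases "C \<inter> {0..L} = {}")
  case False
  define J where "J = C \<inter> {0..L}"
  have J: "is_interval J" unfolding J_def
    using C by (intro is_interval_Int) (auto simp: is_interval_connected_1 is_interval_cc)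
  have bd: "bdd_below J" "bdd_above J" unfolding J_def by auto
  have sub: "J \<subseteq> {Inf J..Sup J}" using bd by (auto intro: cInf_lower cSup_upper)
  have ne: "J \<noteq> {}" using False by (simp add: J_def)
  then have le: "Inf J \<le> Sup J" using sub by force
  have *: "ennreal (b - a) \<le> m" if "a \<in> J" "b \<in> J" "a \<le> b" for a b
  proof -
    have "{a..b} \<subseteq> J" using that J unfolding is_interval_1 by (meson atLeastAtMost_iff subsetI)
    then show ?thesis using that by (intro b) (auto simp: J_def)
  qed
  have "ennreal (Sup J - Inf J) \<le> m"
  proof (cases "m = top")
    case False
    then obtain r where r: "m = ennreal r" "0 \<le> r" by (cases m) auto
    have "Sup J \<le> Inf J + r"
    proof (rule cSup_least[OF ne])
      fix b assume b: "b \<in> J"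
      have "b - r \<le> Inf J"
      proof (rule cInf_greatest[OF ne])
        fix a assume "a \<in> J"
        with b *[of a b] r show "b - r \<le> a" by (cases "a \<le> b") (auto simp: ennreal_le_iff)
      qed
      then show "b \<le> Inf J + r" by simp
    qed
    then show ?thesis using r by (auto intro!: ennreal_leI)
  qed auto
  moreover have "emeasure lborel J \<le> emeasure lborel {Inf J..Sup J}"
    using sub by (intro emeasure_mono) auto
  ultimately show ?thesis using le by (simp add: J_def)
qed simp

text \<open>A 1-Lipschitz map does not stretch, so preimages are at least as long as images. For
  compact intervals this follows from the intermediate value theorem and monotonicity, for open sets
  by splitting into countably many components, and for Borel sets by outer regularity of the image
  measure.\<close>

lemma distr_lipschitz_ge:
  fixes S :: "real \<Rightarrow> real"
  assumes mono: "mono_on {0..l} S" and lip: "\<And>s t. s \<in> {0..l} \<Longrightarrow> t \<in> {0..l} \<Longrightarrow> \<bar>S s - S t\<bar> \<le> \<bar>s - t\<bar>"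
    and S: "S 0 = 0" "S l = L" and l: "0 \<le> l" and A: "A \<in> sets borel"
  shows "emeasure lborel (A \<inter> {0..L}) \<le> emeasure (distr (restrict_space lborel {0..l}) borel S) A"
proof -
  define R where "R = restrict_space lborel {0..l}"
  define \<nu> where "\<nu> = distr R borel S"
  have cont: "continuous_on {0..l} S"
    by (rule lipschitz_on_continuous_on[of 1]) (auto intro!: lipschitz_onI lip simp: dist_real_def)
  have "S \<in> borel_measurable (restrict_space borel {0..l})"
    using cont by (rule borel_measurable_continuous_on_restrict)
  moreover have sets_R: "sets R = sets (restrict_space borel {0..l})"
    unfolding R_def by (intro sets_restrict_space_cong) simp
  ultimately have SR: "S \<in> borel_measurable R" by (simp cong: measurable_cong_sets)
  have spR: "space R = {0..l}" unfolding R_def by (simp add: space_restrict_space)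
  have emR: "emeasure R B = emeasure lborel B" if "B \<subseteq> {0..l}" for B
    unfolding R_def using that by (intro emeasure_restrict_space) auto
  have em: "emeasure \<nu> B = emeasure lborel (S -` B \<inter> {0..l})" if "B \<in> sets borel" for B
    unfolding \<nu>_def using that SR spR emR by (simp add: emeasure_distr)
  have fin: "finite_measure \<nu>"
    by (rule finite_measureI) (use em[of UNIV] l in \<open>simp add: \<nu>_def\<close>)
  have interval: "ennreal (b - a) \<le> emeasure \<nu> C"
    if C: "C \<in> sets borel" "0 \<le> a" "a \<le> b" "b \<le> L" "{a..b} \<subseteq> C" for a b C
  proof -
    obtain s where s: "0 \<le> s" "s \<le> l" "S s = a"
      using IVT'[of S 0 a l] cont S C(2-4) l by auto
    obtain t where t: "0 \<le> t" "t \<le> l" "S t = b"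
      using IVT'[of S 0 b l] cont S C(2-4) l by auto
    show ?thesis
    proof (cases "s \<le> t")
      case True
      have "{s..t} \<subseteq> S -` C \<inter> {0..l}"
      proof
        fix r assume r: "r \<in> {s..t}"
        then have "S s \<le> S r" "S r \<le> S t" using s t by (auto intro!: mono_onD[OF mono])
        with r s t C(5) show "r \<in> S -` C \<inter> {0..l}" by auto
      qed
      moreover have "S -` C \<inter> {0..l} \<in> sets lborel"
        using measurable_sets[OF SR C(1)] spR sets_R
        by (auto simp: sets_restrict_space_iff)
      ultimately have "emeasure lborel {s..t} \<le> emeasure \<nu> C"
        using C by (simp add: em emeasure_mono)
      moreover have "b - a \<le> t - s" using lip[of s t] s t True by auto
      then have "ennreal (b - a) \<le> ennreal (t - s)" by (rule ennreal_leI)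
      ultimately show ?thesis using True by (simp add: order_trans[OF \<open>ennreal (b - a) \<le> ennreal (t - s)\<close>])
    next
      case False
      then have "b \<le> a" using mono_onD[OF mono, of t s] s t by auto
      then show ?thesis by (simp add: ennreal_neg)
    qed
  qed
  have opn: "emeasure lborel (V \<inter> {0..L}) \<le> emeasure \<nu> V" if V: "open V" for V
  proof -
    let ?C = "components V"
    have oC: "open C" if "C \<in> ?C" for C using that V by (rule open_components[rotated])
    have disj: "disjoint ?C"
      using pairwise_disjoint_components[of V] by (simp add: pairwise_def disjnt_def disjoint_def)
    have cC: "countable ?C"
      using disj oC by (intro countable_disjoint_open_subsets) auto
    have eq: "V = (\<Union>C\<in>?C. C)" by simp
    have "emeasure lborel (V \<inter> {0..L}) = emeasure lborel (\<Union>C\<in>?C. C \<inter> {0..L})"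
      by (subst (1) eq) (simp only: UN_extend_simps)
    also have "\<dots> = (\<integral>\<^sup>+C. emeasure lborel (C \<inter> {0..L}) \<partial>count_space ?C)"
      using disj oC by (intro emeasure_UN_countable cC) (auto simp: disjoint_family_on_def disjoint_def)
    also have "\<dots> \<le> (\<integral>\<^sup>+C. emeasure \<nu> C \<partial>count_space ?C)"
      using oC interval in_components_connected
      by (intro nn_integral_mono connected_Int_Icc_emeasure_le) auto
    also have "\<dots> = emeasure \<nu> (\<Union>C\<in>?C. C)"
      using disj oC by (intro emeasure_UN_countable[symmetric] cC)
        (auto simp: disjoint_family_on_def disjoint_def \<nu>_def)
    finally show ?thesis by simp
  qed
  have "emeasure lborel (A \<inter> {0..L}) \<le> emeasure \<nu> A"
  proof (rule ennreal_le_epsilon)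
    fix e :: real assume "0 < e"
    moreover have "sets \<nu> = sets borel" by (simp add: \<nu>_def)
    ultimately obtain V where V: "open V" "A \<subseteq> V" "emeasure \<nu> (V - A) < ennreal e"
      using borel_regular_open[OF fin _ A] by metis
    have "emeasure lborel (A \<inter> {0..L}) \<le> emeasure lborel (V \<inter> {0..L})"
      using V by (intro emeasure_mono) auto
    also have "\<dots> \<le> emeasure \<nu> V" by (rule opn[OF V(1)])
    also have "\<dots> \<le> emeasure \<nu> A + emeasure \<nu> (V - A)"
      using emeasure_subadditive[of A \<nu> "V - A"] Un_absorb1[OF V(2)] A V by (simp add: \<nu>_def)
    also have "\<dots> \<le> emeasure \<nu> A + ennreal e"
      using V(3) by (intro add_mono) auto
    finally show "emeasure lborel (A \<inter> {0..L}) \<le> emeasure \<nu> A + ennreal e" .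
  qed
  then show ?thesis by (simp add: \<nu>_def R_def)
qed

text \<open>One half of the change of variables formula, for a map that may be constant on
  intervals. It follows by comparing the image of Lebesgue measure with Lebesgue measure
  itself.\<close>

lemma nn_integral_lipschitz_reparam_le:
  fixes S :: "real \<Rightarrow> real" and \<phi> :: "real \<Rightarrow> ennreal"
  assumes mono: "mono_on {0..l} S" and lip: "\<And>s t. s \<in> {0..l} \<Longrightarrow> t \<in> {0..l} \<Longrightarrow> \<bar>S s - S t\<bar> \<le> \<bar>s - t\<bar>"
    and S: "S 0 = 0" "S l = L" and l: "0 \<le> l" and \<phi> [measurable]: "\<phi> \<in> borel_measurable borel"
  shows "(\<integral>\<^sup>+r\<in>{0..L}. \<phi> r \<partial>lborel) \<le> (\<integral>\<^sup>+t\<in>{0..l}. \<phi> (S t) \<partial>lborel)"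
proof -
  let ?\<nu> = "distr (restrict_space lborel {0..l}) borel S"
  have cont: "continuous_on {0..l} S"
    by (rule lipschitz_on_continuous_on[of 1]) (auto intro!: lipschitz_onI lip simp: dist_real_def)
  then have "S \<in> borel_measurable (restrict_space borel {0..l})"
    by (rule borel_measurable_continuous_on_restrict)
  moreover have sets_R: "sets (restrict_space lborel {0..l}) = sets (restrict_space borel {0..l})"
    by (intro sets_restrict_space_cong) simp
  ultimately have SR: "S \<in> borel_measurable (restrict_space lborel {0..l})"
    by (simp cong: measurable_cong_sets)
  have "(\<integral>\<^sup>+r\<in>{0..L}. \<phi> r \<partial>lborel) = (\<integral>\<^sup>+r. \<phi> r \<partial>density lborel (indicator {0..L}))"
    by (subst nn_integral_density) (auto simp: mult.commute)
  also have "\<dots> \<le> (\<integral>\<^sup>+r. \<phi> r \<partial>?\<nu>)"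
  proof (rule nn_integral_mono_measure)
    have "emeasure (density lborel (indicator {0..L})) A \<le> emeasure ?\<nu> A" if "A \<in> sets borel" for A
      using distr_lipschitz_ge[OF mono lip S l that] that
      by (simp add: emeasure_density Int_commute flip: indicator_inter_arith)
    then show "density lborel (indicator {0..L}) \<le> ?\<nu>"
      by (subst le_measure) auto
  qed simp
  also have "\<dots> = (\<integral>\<^sup>+t. \<phi> (S t) \<partial>restrict_space lborel {0..l})"
    using SR by (intro nn_integral_distr) auto
  also have "\<dots> = (\<integral>\<^sup>+t\<in>{0..l}. \<phi> (S t) \<partial>lborel)"
    by (intro nn_integral_restrict_space) simp
  finally show ?thesis .
qed

lemma curve_length_lipschitz_le:
  assumes "1-lipschitz_on UNIV c" "a \<le> b"
  shows "curve_length c a b \<le> ennreal (b - a)"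
proof (rule curve_length_leI)
  fix n and t :: "nat \<Rightarrow> real"
  assume t: "mono_on {..n} t" "t ` {..n} \<subseteq> {a..b}"
  have "(\<Sum>i<n. ennreal (dist (c (t i)) (c (t (Suc i))))) = ennreal (\<Sum>i<n. dist (c (t i)) (c (t (Suc i))))"
    by (simp add: sum_ennreal)
  also have "\<dots> \<le> ennreal (\<Sum>i<n. t (Suc i) - t i)"
  proof (intro ennreal_leI sum_mono)
    fix i assume "i \<in> {..<n}"
    then have "t i \<le> t (Suc i)" using t(1) by (auto simp: mono_on_def)
    then show "dist (c (t i)) (c (t (Suc i))) \<le> t (Suc i) - t i"
      using lipschitz_onD[OF assms(1), of "t i" "t (Suc i)"] by (simp add: dist_real_def)
  qed
  also have "(\<Sum>i<n. t (Suc i) - t i) = t n - t 0" by (rule sum_lessThan_telescope)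
  also have "ennreal (t n - t 0) \<le> ennreal (b - a)"
    using t(2) by (intro ennreal_leI) (auto simp: image_subset_iff intro!: diff_mono)
  finally show "(\<Sum>i<n. ennreal (dist (c (t i)) (c (t (Suc i))))) \<le> ennreal (b - a)" .
qed

text \<open>\<open>S t\<close> is the length of \<open>c\<close> on \<open>{0..t}\<close>. Since
  \<open>c\<close> does not move where \<open>S\<close> is constant, \<open>c\<close> factors
  through \<open>S\<close>, and the factor is \<open>\<gamma>\<close>. Distinct endpoints guarantee
  that \<open>L\<close> is positive.\<close>

lemma lipschitz_curve_arc_length:
  fixes c :: "real \<Rightarrow> 'a::metric_space"
  assumes c: "1-lipschitz_on UNIV c" and l: "0 \<le> l" and ne: "c 0 \<noteq> c l"
  obtains L \<gamma> and S :: "real \<Rightarrow> real" where "arc_length_curve UNIV L \<gamma>" "\<gamma> 0 = c 0" "\<gamma> L = c l"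
    "mono_on {0..l} S" "\<And>s t. s \<in> {0..l} \<Longrightarrow> t \<in> {0..l} \<Longrightarrow> \<bar>S s - S t\<bar> \<le> \<bar>s - t\<bar>"
    "S 0 = 0" "S l = L" "\<And>t. t \<in> {0..l} \<Longrightarrow> \<gamma> (S t) = c t"
proof -
  define S where "S t = enn2real (curve_length c 0 t)" for t
  have fin: "curve_length c a b < top" if "a \<le> b" for a b
    using curve_length_lipschitz_le[OF c that] ennreal_less_top le_less_trans by blast
  have S: "ennreal (S t) = curve_length c 0 t" if "0 \<le> t" for t
    unfolding S_def using fin[OF that] by simp
  have S0: "0 \<le> S t" for t by (simp add: S_def)
  have diff: "curve_length c s t = ennreal (S t - S s)" "S s \<le> S t" if st: "0 \<le> s" "s \<le> t" for s t
  proof -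
    obtain r where r: "curve_length c s t = ennreal r" "0 \<le> r"
      using fin[OF st(2)] by (cases "curve_length c s t") auto
    then have "ennreal (S t) = ennreal (S s + r)"
      using curve_length_append[OF st, of c] S[of s] S[of t] st S0 by simp
    then have "S t = S s + r" using S0 r by (subst (asm) ennreal_inj) auto
    then show "curve_length c s t = ennreal (S t - S s)" "S s \<le> S t" using r by auto
  qed
  have lip: "\<bar>S s - S t\<bar> \<le> \<bar>s - t\<bar>" if "0 \<le> s" "0 \<le> t" for s t
  proof -
    have *: "S t - S s \<le> t - s" if "0 \<le> s" "s \<le> t" for s t
      using curve_length_lipschitz_le[OF c that(2)] diff[OF that] that by (simp add: ennreal_le_iff)
    show ?thesis using *[of s t] *[of t s] diff(2)[of s t] diff(2)[of t s] that by (cases "s \<le> t") auto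
  qed
  have dist: "dist (c s) (c t) \<le> \<bar>S s - S t\<bar>" if "0 \<le> s" "0 \<le> t" for s t
  proof -
    have *: "dist (c s) (c t) \<le> S t - S s" if "0 \<le> s" "s \<le> t" for s t
    proof -
      have "ennreal (dist (c s) (c t)) \<le> ennreal (S t - S s)"
        using curve_length_ge_dist[of s s t t c] that diff(1)[OF that] by simp
      then show ?thesis using diff(2)[OF that] by (simp add: ennreal_le_iff)
    qed
    show ?thesis using *[of s t] *[of t s] that by (cases "s \<le> t") (auto simp: dist_commute)
  qed
  have mono: "mono_on {0..l} S" using diff(2) by (auto simp: mono_on_def)
  have S00: "S 0 = 0" using curve_length_lipschitz_le[OF c, of 0 0] by (simp add: S_def)
  define L where "L = S l"
  have L: "0 < L"
  proof -
    have "0 < dist (c 0) (c l)" using ne by simp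
    also have "\<dots> \<le> L" using dist[of 0 l] l S00 S0[of l] by (auto simp: L_def)
    finally show ?thesis .
  qed
  have cont: "continuous_on {0..l} S"
    by (rule lipschitz_on_continuous_on[of 1]) (auto intro!: lipschitz_onI lip simp: dist_real_def)
  \<comment> \<open>\<open>\<sigma>\<close> is an arbitrary right inverse of \<open>S\<close> and
    may jump. It is monotone because \<open>S\<close> is, and its jumps are invisible after
    composition with \<open>c\<close>.\<close>
  have "\<forall>r\<in>{0..L}. \<exists>t\<in>{0..l}. S t = r"
    using IVT'[of S 0 _ l] cont S00 l by (force simp: L_def)
  then obtain \<sigma> where \<sigma>: "\<And>r. r \<in> {0..L} \<Longrightarrow> \<sigma> r \<in> {0..l}" "\<And>r. r \<in> {0..L} \<Longrightarrow> S (\<sigma> r) = r"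
    by metis
  have \<sigma>_mono: "\<sigma> r \<le> \<sigma> r'" if "r \<in> {0..L}" "r' \<in> {0..L}" "r \<le> r'" for r r'
  proof (rule ccontr)
    assume "\<not> \<sigma> r \<le> \<sigma> r'"
    then have "r' \<le> r" using diff(2)[of "\<sigma> r'" "\<sigma> r"] \<sigma> that by auto
    then show False using that \<open>\<not> \<sigma> r \<le> \<sigma> r'\<close> by auto
  qed
  define \<gamma> where "\<gamma> r = c (\<sigma> r)" for r
  have \<gamma>S: "\<gamma> (S t) = c t" if "t \<in> {0..l}" for t
  proof -
    have r: "S t \<in> {0..L}" using diff(2)[of t l] that S0 by (auto simp: L_def)
    have "0 \<le> \<sigma> (S t)" using \<sigma>(1)[OF r] by simp
    then have "dist (\<gamma> (S t)) (c t) \<le> 0"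
      using dist[of "\<sigma> (S t)" t] \<sigma>(2)[OF r] that by (simp add: \<gamma>_def)
    then show ?thesis by simp
  qed
  have arc: "arc_length_curve UNIV L \<gamma>"
    unfolding arc_length_curve_def
  proof (intro conjI ballI)
    have "dist (\<gamma> r) (\<gamma> r') \<le> \<bar>r - r'\<bar>" if "r \<in> {0..L}" "r' \<in> {0..L}" for r r'
      using dist[of "\<sigma> r" "\<sigma> r'"] \<sigma>[OF that(1)] \<sigma>[OF that(2)] by (simp add: \<gamma>_def)
    then show "continuous_on {0..L} \<gamma>"
      by (intro lipschitz_on_continuous_on[of 1] lipschitz_onI) (auto simp: dist_real_def)
    fix r assume r: "r \<in> {0..L}"
    then have \<sigma>r: "0 \<le> \<sigma> r" "\<sigma> r \<le> l" "S (\<sigma> r) = r" using \<sigma>[OF r] by auto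
    \<comment> \<open>Each of the two curves is a monotone reparametrization of the other, by
      \<open>\<sigma>\<close> and by \<open>S\<close>, so their lengths agree.\<close>
    have "curve_length \<gamma> 0 r \<le> curve_length c 0 (\<sigma> r)"
    proof (rule curve_length_reparam_le)
      show "mono_on {0..r} \<sigma>" using \<sigma>_mono r by (auto simp: mono_on_def)
      show "\<sigma> ` {0..r} \<subseteq> {0..\<sigma> r}" using \<sigma>_mono \<sigma>(1) r by force
    qed (simp add: \<gamma>_def)
    moreover have "curve_length c 0 (\<sigma> r) \<le> curve_length \<gamma> 0 r"
    proof (rule curve_length_reparam_le)
      show "mono_on {0..\<sigma> r} S" using diff(2) by (auto simp: mono_on_def)
      show "S ` {0..\<sigma> r} \<subseteq> {0..r}" using diff(2)[of _ "\<sigma> r"] \<sigma>r S0 by auto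
    qed (use \<gamma>S \<sigma>r in auto)
    ultimately show "curve_length \<gamma> 0 r = ennreal r"
      using S[OF \<sigma>r(1)] \<sigma>r(3) by simp
  qed (use L in auto)
  have "\<gamma> 0 = c 0" "\<gamma> L = c l" using \<gamma>S[of 0] \<gamma>S[of l] S00 l by (simp_all add: L_def)
  then show ?thesis
    by (rule that[OF arc _ _ mono _ S00 L_def[symmetric] \<gamma>S]) (use lip in auto)
qed

text \<open>Upper gradients are tested on arc length parametrizations, but limits of curves are
  merely 1-Lipschitz. Passing to arc length can only decrease the integral, as the speed of
  \<open>c\<close> is at most 1. When the endpoints coincide, the left side is 0.\<close>

lemma upper_gradient_lipschitz_curve:
  fixes f :: "'a::metric_space \<Rightarrow> real" and l :: real
  assumes ug: "upper_gradient UNIV (\<lambda>x. ereal (f x)) h"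
    and c: "1-lipschitz_on UNIV c" and l: "0 \<le> l"
  shows "ennreal \<bar>f (c 0) - f (c l)\<bar> \<le> (\<integral>\<^sup>+t\<in>{0..l}. h (c t) \<partial>lborel)"
proof (cases "c 0 = c l")
  case False
  obtain L \<gamma> and S :: "real \<Rightarrow> real" where arc: "arc_length_curve UNIV L \<gamma>" and \<gamma>: "\<gamma> 0 = c 0" "\<gamma> L = c l"
    and S: "mono_on {0..l} S" "\<And>s t. s \<in> {0..l} \<Longrightarrow> t \<in> {0..l} \<Longrightarrow> \<bar>S s - S t\<bar> \<le> \<bar>s - t\<bar>"
    "S 0 = 0" "S l = L" "\<And>t. t \<in> {0..l} \<Longrightarrow> \<gamma> (S t) = c t"
    using lipschitz_curve_arc_length[OF c l False] by metis
  let ?\<phi> = "\<lambda>r. h (\<gamma> r) * indicator {0..L} r"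
  have m: "?\<phi> \<in> borel_measurable borel"
    using ug arc unfolding upper_gradient_def arc_length_curve_def
    by (intro curve_integrand_measurable[where S = UNIV]) auto
  have "ennreal \<bar>f (c 0) - f (c l)\<bar> \<le> (\<integral>\<^sup>+r\<in>{0..L}. h (\<gamma> r) \<partial>lborel)"
    using ug[unfolded upper_gradient_def, THEN conjunct2, rule_format, OF arc] \<gamma> by simp
  also have "\<dots> = (\<integral>\<^sup>+r\<in>{0..L}. ?\<phi> r \<partial>lborel)"
    by (intro nn_integral_cong) (auto simp: indicator_def)
  also have "\<dots> \<le> (\<integral>\<^sup>+t\<in>{0..l}. ?\<phi> (S t) \<partial>lborel)"
    by (rule nn_integral_lipschitz_reparam_le[OF S(1,2,3,4) l m])
  also have "\<dots> \<le> (\<integral>\<^sup>+t\<in>{0..l}. h (c t) \<partial>lborel)"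
    using S(5) by (intro nn_integral_mono) (auto simp: indicator_def)
  finally show ?thesis .
qed simp

text \<open>A version of the Arzela--Ascoli theorem; pointwise convergence is enough to apply Fatou's
  lemma to integrals along the curves.\<close>

lemma lipschitz_curves_convergent_subsequence:
  fixes c :: "nat \<Rightarrow> real \<Rightarrow> 'a::metric_space"
  assumes K: "compact K" and cK: "\<And>n t. c n t \<in> K" and lip: "\<And>n. 1-lipschitz_on UNIV (c n)"
  obtains r \<gamma> where "strict_mono r" "1-lipschitz_on UNIV \<gamma>" "\<And>t. (\<lambda>n. c (r n) t) \<longlonglongrightarrow> \<gamma> t"
proof -
  define P where "P n s \<longleftrightarrow> (\<exists>L. (\<lambda>k. c (s k) (of_rat (from_nat n))) \<longlonglongrightarrow> L)" for n and s :: "nat \<Rightarrow> nat"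
  interpret subseqs P
  proof
    fix n and s :: "nat \<Rightarrow> nat"
    have "\<forall>k. c (s k) (of_rat (from_nat n)) \<in> K" using cK by auto
    then obtain L r where "strict_mono r" "((\<lambda>k. c (s k) (of_rat (from_nat n))) \<circ> r) \<longlonglongrightarrow> L"
      using K unfolding compact_eq_seq_compact_metric seq_compact_def by metis
    then show "\<exists>r'. strict_mono r' \<and> P n (s \<circ> r')" unfolding P_def by (auto simp: o_def)
  qed
  have P: "P k diagseq" for k
  proof -
    have "P k (diagseq \<circ> ((+) (Suc k)))"
    proof (rule diagseq_holds)
      fix r s n assume "strict_mono (r :: nat \<Rightarrow> nat)" "P n s"
      then obtain L where "(\<lambda>k. c (s k) (of_rat (from_nat n))) \<longlonglongrightarrow> L" unfolding P_def by blast
      from LIMSEQ_subseq_LIMSEQ[OF this \<open>strict_mono r\<close>]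
      show "P n (s \<circ> r)" unfolding P_def by (auto simp: o_def)
    qed
    then obtain L where "(\<lambda>i. c (diagseq (i + Suc k)) (of_rat (from_nat k))) \<longlonglongrightarrow> L"
      unfolding P_def by (auto simp: o_def add.commute)
    then have "(\<lambda>i. c (diagseq i) (of_rat (from_nat k))) \<longlonglongrightarrow> L" by (rule LIMSEQ_offset)
    then show ?thesis unfolding P_def by blast
  qed
  have "\<exists>L. (\<lambda>i. c (diagseq i) t) \<longlonglongrightarrow> L" for t
  proof -
    have "Cauchy (\<lambda>i. c (diagseq i) t)"
      unfolding Cauchy_def
    proof (intro allI impI)
      fix e :: real assume "0 < e"
      \<comment> \<open>Convergence is known at rational parameters only; the common Lipschitz bound
        transfers the Cauchy property to \<open>t\<close> at the cost of two thirds of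
        \<open>e\<close>.\<close>
      then obtain q where q: "t < of_rat q" "of_rat q < t + e / 3"
        using of_rat_dense[of t "t + e / 3"] by auto
      from P[of "to_nat q"] have "Cauchy (\<lambda>i. c (diagseq i) (of_rat q))"
        unfolding P_def using LIMSEQ_imp_Cauchy by auto
      then obtain N where N: "\<And>m n. N \<le> m \<Longrightarrow> N \<le> n \<Longrightarrow>
          dist (c (diagseq m) (of_rat q)) (c (diagseq n) (of_rat q)) < e / 3"
        using \<open>0 < e\<close> unfolding Cauchy_def by (metis divide_pos_pos zero_less_numeral)
      have cl: "dist (c i t) (c i (of_rat q)) < e / 3" for i
        using lipschitz_onD[OF lip, of t "of_rat q" i] q by (auto simp: dist_real_def)
      have "dist (c (diagseq m) t) (c (diagseq n) t) < e" if "N \<le> m" "N \<le> n" for m n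
      proof -
        have "dist (c (diagseq m) t) (c (diagseq n) t) \<le> dist (c (diagseq m) t) (c (diagseq m) (of_rat q)) +
            (dist (c (diagseq m) (of_rat q)) (c (diagseq n) (of_rat q)) + dist (c (diagseq n) (of_rat q)) (c (diagseq n) t))"
          by (meson add_left_mono dist_triangle order_trans)
        then show ?thesis using N[OF that] cl[of "diagseq m"] cl[of "diagseq n"]
          by (simp add: dist_commute)
      qed
      then show "\<exists>M. \<forall>m\<ge>M. \<forall>n\<ge>M. dist (c (diagseq m) t) (c (diagseq n) t) < e" by blast
    qed
    then show ?thesis
      using compact_imp_complete[OF K] cK unfolding complete_def by metis
  qed
  then obtain \<gamma> where \<gamma>: "\<And>t. (\<lambda>i. c (diagseq i) t) \<longlonglongrightarrow> \<gamma> t" by metis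
  have "1-lipschitz_on UNIV \<gamma>"
  proof (rule lipschitz_onI)
    fix s t :: real
    have "(\<lambda>i. dist (c (diagseq i) s) (c (diagseq i) t)) \<longlonglongrightarrow> dist (\<gamma> s) (\<gamma> t)"
      by (intro tendsto_dist \<gamma>)
    then show "dist (\<gamma> s) (\<gamma> t) \<le> 1 * dist s t"
      by (rule LIMSEQ_le_const2) (use lipschitz_onD[OF lip] in auto)
  qed simp
  then show ?thesis using that[OF subseq_diagseq] \<gamma> by blast
qed

subsection \<open>The curve infimum\<close>

text \<open>
  Unlike arc length parametrizations, 1-Lipschitz curves are closed under pointwise limits.  Only
  the values of \<open>c\<close> on \<open>{0..l}\<close> matter.
\<close>

definition curve_inf :: "('a::metric_space \<Rightarrow> real) \<Rightarrow> 'a set \<Rightarrow> ('a \<Rightarrow> ennreal) \<Rightarrow> 'a \<Rightarrow> ennreal" where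
  "curve_inf f F h x = min 1
     (INF (c, l)\<in>{(c :: real \<Rightarrow> 'a, l :: real). 1-lipschitz_on UNIV c \<and> 0 \<le> l \<and> c 0 = x \<and> c l \<in> F}.
        ennreal (f (c l)) + (\<integral>\<^sup>+t\<in>{0..l}. h (c t) \<partial>lborel))"

lemma curve_inf_le_1: "curve_inf f F h x \<le> 1"
  by (simp add: curve_inf_def)

lemma curve_inf_le:
  fixes c :: "real \<Rightarrow> 'a::metric_space" and l :: real
  assumes "1-lipschitz_on UNIV c" "0 \<le> l" "c 0 = x" "c l \<in> F"
  shows "curve_inf f F h x \<le> ennreal (f (c l)) + (\<integral>\<^sup>+t\<in>{0..l}. h (c t) \<partial>lborel)"
  unfolding curve_inf_def using assms
  by (intro min.coboundedI2 INF_lower2[of "(c, l)"]) auto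

lemma curve_inf_geI:
  fixes x :: "'a::metric_space"
  assumes "a \<le> 1" "\<And>(c :: real \<Rightarrow> 'a) (l :: real). 1-lipschitz_on UNIV c \<Longrightarrow> 0 \<le> l \<Longrightarrow> c 0 = x \<Longrightarrow> c l \<in> F \<Longrightarrow>
     a \<le> ennreal (f (c l)) + (\<integral>\<^sup>+t\<in>{0..l}. h (c t) \<partial>lborel)"
  shows "a \<le> curve_inf f F h x"
  unfolding curve_inf_def using assms by (intro min.boundedI INF_greatest) auto

lemma curve_inf_lessE:
  fixes x :: "'a::metric_space"
  assumes "curve_inf f F h x < a" "a \<le> 1"
  obtains c :: "real \<Rightarrow> 'a" and l :: real where "1-lipschitz_on UNIV c" "0 \<le> l" "c 0 = x" "c l \<in> F"
     "ennreal (f (c l)) + (\<integral>\<^sup>+t\<in>{0..l}. h (c t) \<partial>lborel) < a"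
proof -
  have "(INF (c, l)\<in>{(c :: real \<Rightarrow> 'a, l :: real). 1-lipschitz_on UNIV c \<and> 0 \<le> l \<and> c 0 = x \<and> c l \<in> F}.
        ennreal (f (c l)) + (\<integral>\<^sup>+t\<in>{0..l}. h (c t) \<partial>lborel)) < a"
    using assms unfolding curve_inf_def min_less_iff_disj by auto
  then show ?thesis using that unfolding INF_less_iff by auto
qed

text \<open>Competitors in \<open>curve_inf\<close> are defined on the whole line. Freezing a curve
  outside \<open>{0..l}\<close> supplies the missing values without changing the cost.\<close>

lemma lipschitz_clamp:
  assumes "\<And>s t. s \<in> {0..l} \<Longrightarrow> t \<in> {0..l} \<Longrightarrow> dist (c s) (c t) \<le> \<bar>s - t\<bar>" "0 \<le> (l::real)"
  shows "1-lipschitz_on UNIV (\<lambda>t. c (max 0 (min l t)))"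
proof (rule lipschitz_onI)
  fix s t :: real
  have "dist (c (max 0 (min l s))) (c (max 0 (min l t))) \<le> \<bar>max 0 (min l s) - max 0 (min l t)\<bar>"
    using assms(2) by (intro assms(1)) auto
  also have "\<dots> \<le> \<bar>s - t\<bar>" by (auto simp: max_def min_def)
  finally show "dist (c (max 0 (min l s))) (c (max 0 (min l t))) \<le> 1 * dist s t"
    by (simp add: dist_real_def)
qed simp

lemma borel_measurable_lsc:
  fixes h :: "'a::topological_space \<Rightarrow> ennreal"
  assumes "\<And>a. open {x. a < h x}"
  shows "h \<in> borel_measurable borel"
  by (rule borel_measurableI_greater) (use assms in auto)

lemma lipschitz_UNIV_measurable:
  fixes c :: "real \<Rightarrow> 'a::metric_space"
  assumes "1-lipschitz_on UNIV c"
  shows "c \<in> borel_measurable borel"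
  using lipschitz_on_continuous_on[OF assms] by (rule borel_measurable_continuous_onI)

lemma lipschitz_integrand_measurable:
  fixes c :: "real \<Rightarrow> 'a::metric_space" and h :: "'a \<Rightarrow> ennreal"
  assumes "h \<in> borel_measurable borel" "1-lipschitz_on UNIV c"
  shows "(\<lambda>t. h (c t) * indicator {a..b} t) \<in> borel_measurable borel"
  using measurable_compose[OF lipschitz_UNIV_measurable[OF assms(2)] assms(1)]
  by (intro borel_measurable_times_ennreal borel_measurable_indicator) auto

text \<open>Follow \<open>c\<close> and then a nearly optimal curve from \<open>c l\<close>. If the
  value at \<open>c l\<close> is the cap 1, there is nothing to prove.\<close>

lemma curve_inf_step:
  fixes c :: "real \<Rightarrow> 'a::metric_space" and l :: real
  assumes h: "h \<in> borel_measurable borel" and c: "1-lipschitz_on UNIV c" and l: "0 \<le> l"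
  shows "curve_inf f F h (c 0) \<le> curve_inf f F h (c l) + (\<integral>\<^sup>+t\<in>{0..l}. h (c t) \<partial>lborel)"
proof (cases "curve_inf f F h (c l) < 1")
  case False
  then have "1 \<le> curve_inf f F h (c l)" by simp
  then show ?thesis using curve_inf_le_1[of f F h "c 0"] by (meson add_increasing2 order_trans zero_le)
next
  case True
  show ?thesis
  proof (rule ennreal_le_epsilon)
    fix e :: real assume e: "0 < e"
    let ?T = "curve_inf f F h (c l)"
    have "?T \<noteq> top" using True by auto
    then have "?T < ?T + ennreal e"
      using e by (cases ?T) (auto simp: ennreal_less_iff simp flip: ennreal_plus)
    then have "?T < min 1 (?T + ennreal e)" using True by simp
    then obtain d :: "real \<Rightarrow> 'a" and m :: real where d: "1-lipschitz_on UNIV d" "0 \<le> m" "d 0 = c l" "d m \<in> F"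
      and cost: "ennreal (f (d m)) + (\<integral>\<^sup>+t\<in>{0..m}. h (d t) \<partial>lborel) < min 1 (?T + ennreal e)"
      by (rule curve_inf_lessE) auto
    define b where "b t = (if t \<le> l then c t else d (t - l))" for t
    have b: "1-lipschitz_on UNIV b"
    proof -
      have *: "dist (b s) (b t) \<le> t - s" if "s \<le> t" for s t
      proof -
        consider "t \<le> l" | "l < s" | "s \<le> l" "l < t" using that by linarith
        then show ?thesis
        proof cases
          case 3
          have "dist (b s) (b t) \<le> dist (c s) (c l) + dist (d 0) (d (t - l))"
            using 3 d(3) by (simp add: b_def dist_triangle)
          also have "\<dots> \<le> dist s l + dist 0 (t - l)"
            using lipschitz_onD[OF c, of s l] lipschitz_onD[OF d(1), of 0 "t - l"] by simp
          finally show ?thesis using 3 by (simp add: dist_real_def)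
        qed (use that lipschitz_onD[OF c, of s t] lipschitz_onD[OF d(1), of "s - l" "t - l"] in
            \<open>auto simp: b_def dist_real_def\<close>)
      qed
      show ?thesis
      proof (rule lipschitz_onI)
        fix s t :: real
        show "dist (b s) (b t) \<le> 1 * dist s t"
          using *[of s t] *[of t s] by (cases "s \<le> t") (auto simp: dist_commute dist_real_def)
      qed simp
    qed
    have bm: "b (l + m) = d m" using d l by (auto simp: b_def)
    have "(\<integral>\<^sup>+t\<in>{0..l + m}. h (b t) \<partial>lborel)
      \<le> (\<integral>\<^sup>+t. h (c t) * indicator {0..l} t + h (d (- l + t)) * indicator {0..m} (- l + t) \<partial>lborel)"
      by (intro nn_integral_mono) (auto simp: b_def indicator_def)
    also have "\<dots> = (\<integral>\<^sup>+t\<in>{0..l}. h (c t) \<partial>lborel) + (\<integral>\<^sup>+t. h (d (- l + t)) * indicator {0..m} (- l + t) \<partial>lborel)"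
      using lipschitz_integrand_measurable[OF h c]
        measurable_compose[OF _ lipschitz_integrand_measurable[OF h d(1)], of "\<lambda>t. - l + t" lborel]
      by (intro nn_integral_add) auto
    also have "(\<integral>\<^sup>+t. h (d (- l + t)) * indicator {0..m} (- l + t) \<partial>lborel) = (\<integral>\<^sup>+t\<in>{0..m}. h (d t) \<partial>lborel)"
      by (rule nn_integral_shift[OF lipschitz_integrand_measurable[OF h d(1)]])
    finally have int: "(\<integral>\<^sup>+t\<in>{0..l + m}. h (b t) \<partial>lborel) \<le>
        (\<integral>\<^sup>+t\<in>{0..l}. h (c t) \<partial>lborel) + (\<integral>\<^sup>+t\<in>{0..m}. h (d t) \<partial>lborel)" .
    have "curve_inf f F h (c 0) \<le> ennreal (f (b (l + m))) + (\<integral>\<^sup>+t\<in>{0..l + m}. h (b t) \<partial>lborel)"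
      using b l d bm by (intro curve_inf_le) (auto simp: b_def)
    also have "\<dots> \<le> (ennreal (f (d m)) + (\<integral>\<^sup>+t\<in>{0..m}. h (d t) \<partial>lborel)) + (\<integral>\<^sup>+t\<in>{0..l}. h (c t) \<partial>lborel)"
      unfolding bm using int by (simp add: add.assoc add.commute add_left_mono)
    also have "\<dots> \<le> (?T + ennreal e) + (\<integral>\<^sup>+t\<in>{0..l}. h (c t) \<partial>lborel)"
      using cost by (intro add_right_mono) auto
    finally show "curve_inf f F h (c 0) \<le> ?T + (\<integral>\<^sup>+t\<in>{0..l}. h (c t) \<partial>lborel) + ennreal e"
      by (simp add: ac_simps)
  qed
qed

text \<open>The two inequalities together say that \<open>h\<close> is an upper gradient of the
  curve infimum; the second one runs the curve backwards.\<close>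

lemma curve_inf_arc:
  assumes h: "h \<in> borel_measurable borel" and arc: "arc_length_curve UNIV l \<gamma>"
  shows "curve_inf f F h (\<gamma> 0) \<le> curve_inf f F h (\<gamma> l) + (\<integral>\<^sup>+t\<in>{0..l}. h (\<gamma> t) \<partial>lborel)"
    and "curve_inf f F h (\<gamma> l) \<le> curve_inf f F h (\<gamma> 0) + (\<integral>\<^sup>+t\<in>{0..l}. h (\<gamma> t) \<partial>lborel)"
proof -
  have l: "0 \<le> l" using arc by (simp add: arc_length_curve_def)
  let ?c = "\<lambda>t. \<gamma> (max 0 (min l t))"
  have c: "1-lipschitz_on UNIV ?c"
    using arc_length_curve_dist[OF arc] l by (rule lipschitz_clamp)
  have int: "(\<integral>\<^sup>+t\<in>{0..l}. h (?c t) \<partial>lborel) = (\<integral>\<^sup>+t\<in>{0..l}. h (\<gamma> t) \<partial>lborel)"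
    by (intro nn_integral_cong) (auto simp: indicator_def)
  show "curve_inf f F h (\<gamma> 0) \<le> curve_inf f F h (\<gamma> l) + (\<integral>\<^sup>+t\<in>{0..l}. h (\<gamma> t) \<partial>lborel)"
    using curve_inf_step[OF h c l, of f F] l int by simp
  have c': "1-lipschitz_on UNIV (\<lambda>t. ?c (l - t))"
  proof (rule lipschitz_onI)
    fix s t :: real
    show "dist (?c (l - s)) (?c (l - t)) \<le> 1 * dist s t"
      using lipschitz_onD[OF c, of "l - s" "l - t"] by (simp add: dist_real_def abs_minus_commute)
  qed simp
  have "(\<integral>\<^sup>+t\<in>{0..l}. h (?c (l - t)) \<partial>lborel) = (\<integral>\<^sup>+t. h (?c (l - t)) * indicator {0..l} (l - t) \<partial>lborel)"
    by (intro nn_integral_cong) (auto simp: indicator_def)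
  also have "\<dots> = (\<integral>\<^sup>+t\<in>{0..l}. h (?c t) \<partial>lborel)"
    by (rule nn_integral_reflect[OF lipschitz_integrand_measurable[OF h c]])
  finally show "curve_inf f F h (\<gamma> l) \<le> curve_inf f F h (\<gamma> 0) + (\<integral>\<^sup>+t\<in>{0..l}. h (\<gamma> t) \<partial>lborel)"
    using curve_inf_step[OF h c' l, of f F] l int by simp
qed

lemma lsc_liminf:
  fixes h :: "'a::topological_space \<Rightarrow> ennreal"
  assumes "\<And>a. open {x. a < h x}" "z \<longlonglongrightarrow> x"
  shows "h x \<le> liminf (\<lambda>n. h (z n))"
  unfolding le_Liminf_iff
proof (intro allI impI)
  fix a assume "a < h x"
  then show "\<forall>\<^sub>F n in sequentially. a < h (z n)"
    using topological_tendstoD[OF assms(2) assms(1)[of a]] by simp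
qed

text \<open>Nearly optimal curves from points converging to \<open>y\<close> subconverge to a curve
  from \<open>y\<close>. Its end lies in the closed set \<open>F\<close>, where \<open>f\<close> is
  continuous, and the integrals pass to the limit by Fatou's lemma. Levels \<open>a \<ge> 1\<close>
  are trivial because of the cap.\<close>

lemma curve_inf_lsc:
  fixes f :: "'a::metric_space \<Rightarrow> real"
  assumes proper: "\<And>(x::'a) r. compact (cball x r)"
    and h: "\<And>a. open {x. a < h x}" and h1: "\<And>x. 1 \<le> h x"
    and F: "closed F" and f: "continuous_on F f" and f0: "\<And>x. 0 \<le> f x"
  shows "closed {x. curve_inf f F h x \<le> a}"
proof (cases "1 \<le> a")
  case True
  then have "{x. curve_inf f F h x \<le> a} = UNIV" using curve_inf_le_1 order_trans by blast
  then show ?thesis by simp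
next
  case False
  then obtain \<alpha> where \<alpha>: "a = ennreal \<alpha>" "0 \<le> \<alpha>" "\<alpha> < 1"
    by (cases a) (auto simp: ennreal_less_iff not_le)
  have hm: "h \<in> borel_measurable borel" using h by (rule borel_measurable_lsc)
  show ?thesis
    unfolding closed_sequential_limits
  proof (intro allI impI, elim conjE)
    fix x y assume x: "\<forall>n. x n \<in> {x. curve_inf f F h x \<le> a}" and lim: "x \<longlonglongrightarrow> y"
    \<comment> \<open>The bound by \<open>1 - \<alpha>\<close> keeps the admissible cost
      \<open>\<alpha> + e n\<close> at most 1, below the cap. The same bound later gives
      \<open>l n \<le> 1\<close>.\<close>
    define e where "e n = min (1 - \<alpha>) (1 / real (Suc n))" for n
    have e: "0 < e n" "\<alpha> + e n \<le> 1" for n using \<alpha> by (auto simp: e_def)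
    have elim: "e \<longlonglongrightarrow> 0"
    proof (rule tendsto_sandwich[of "\<lambda>_. 0" e sequentially "\<lambda>n. 1 / real (Suc n)"])
      show "(\<lambda>n. 1 / real (Suc n)) \<longlonglongrightarrow> 0" by (rule LIMSEQ_Suc[OF lim_1_over_n])
      show "\<forall>\<^sub>F n in sequentially. 0 \<le> e n" by (simp add: less_imp_le[OF e(1)])
      show "\<forall>\<^sub>F n in sequentially. e n \<le> 1 / real (Suc n)" by (simp add: e_def)
    qed simp
    define good where "good n c l \<longleftrightarrow> 1-lipschitz_on UNIV c \<and> 0 \<le> l \<and> c 0 = x n \<and> c l \<in> F \<and>
        ennreal (f (c l)) + (\<integral>\<^sup>+t\<in>{0..l}. h (c t) \<partial>lborel) < ennreal (\<alpha> + e n)"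
      for n and c :: "real \<Rightarrow> 'a" and l :: real
    have "\<exists>c l. good n c l" for n
    proof -
      have "curve_inf f F h (x n) \<le> ennreal \<alpha>" using x \<alpha> by auto
      also have "\<dots> < ennreal (\<alpha> + e n)" using e[of n] \<alpha> by (simp add: ennreal_less_iff del: ennreal_plus)
      finally show ?thesis
      proof (rule curve_inf_lessE)
        show "ennreal (\<alpha> + e n) \<le> 1" using e[of n] ennreal_leI[OF e(2), of n] by simp
      qed (auto simp: good_def)
    qed
    then obtain c0 l where "\<And>n. good n (c0 n) (l n)" by metis
    then have c0: "\<And>n. 1-lipschitz_on UNIV (c0 n)" "\<And>n. 0 \<le> l n" "\<And>n. c0 n 0 = x n"
      "\<And>n. c0 n (l n) \<in> F"
      "\<And>n. ennreal (f (c0 n (l n))) + (\<integral>\<^sup>+t\<in>{0..l n}. h (c0 n t) \<partial>lborel) < ennreal (\<alpha> + e n)"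
      unfolding good_def by simp_all
    \<comment> \<open>Freezing the curves outside \<open>{0..l n}\<close> keeps all of them in one
      compact ball, also at parameters that do not enter the cost.\<close>
    define c where "c n t = c0 n (max 0 (min (l n) t))" for n t
    have c: "1-lipschitz_on UNIV (c n)" "c n 0 = x n" "c n (l n) \<in> F" for n
    proof -
      show "1-lipschitz_on UNIV (c n)" unfolding c_def
        using lipschitz_onD[OF c0(1)[of n]] c0(2) by (intro lipschitz_clamp) (auto simp: dist_real_def)
    qed (use c0 in \<open>auto simp: c_def\<close>)
    have cost: "ennreal (f (c n (l n))) + (\<integral>\<^sup>+t\<in>{0..l n}. h (c n t) \<partial>lborel) < ennreal (\<alpha> + e n)" for n
    proof -
      have "(\<integral>\<^sup>+t\<in>{0..l n}. h (c n t) \<partial>lborel) = (\<integral>\<^sup>+t\<in>{0..l n}. h (c0 n t) \<partial>lborel)"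
        by (intro nn_integral_cong) (auto simp: indicator_def c_def)
      then show ?thesis using c0(2,5)[of n] by (simp add: c_def)
    qed
    have l1: "l n \<le> 1" for n
    proof -
      have "ennreal (l n) = (\<integral>\<^sup>+t\<in>{0..l n}. 1 \<partial>lborel)" using c0(2)[of n] by simp
      also have "\<dots> \<le> (\<integral>\<^sup>+t\<in>{0..l n}. h (c n t) \<partial>lborel)"
        using h1 by (intro nn_integral_mono) (auto simp: indicator_def)
      also have "\<dots> \<le> ennreal (f (c n (l n))) + (\<integral>\<^sup>+t\<in>{0..l n}. h (c n t) \<partial>lborel)" by simp
      also have "\<dots> \<le> ennreal (\<alpha> + e n)" using cost[of n] by (rule less_imp_le)
      finally show ?thesis using e[of n] \<alpha> c0(2)[of n] by (subst (asm) ennreal_le_iff) auto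
    qed
    obtain D where D: "\<And>n. dist y (x n) \<le> D"
    proof -
      have "bounded (range x)" using lim convergent_imp_bounded by blast
      then show ?thesis using that bounded_any_center[of "range x" y] by auto
    qed
    have cK: "c n t \<in> cball y (D + 1)" for n t
    proof -
      have "dist y (c n t) \<le> dist y (x n) + dist (c0 n 0) (c n t)"
        using c0(3)[of n] by (simp add: dist_triangle)
      also have "dist (c0 n 0) (c n t) \<le> dist 0 (max 0 (min (l n) t))"
        using lipschitz_onD[OF c0(1)[of n], of 0 "max 0 (min (l n) t)"] by (simp add: c_def)
      also have "\<dots> \<le> 1" using c0(2)[of n] l1[of n] by (auto simp: dist_real_def)
      finally show ?thesis using D[of n] by (simp add: add_mono)
    qed
    have "\<forall>n. l n \<in> {0..1}" using c0(2) l1 by auto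
    then obtain m r1 where m: "m \<in> {0..1}" "strict_mono r1" "(l \<circ> r1) \<longlonglongrightarrow> m"
      using compact_Icc[of 0 "1::real"] unfolding compact_eq_seq_compact_metric seq_compact_def by metis
    obtain r2 \<gamma> where r2: "strict_mono r2" "1-lipschitz_on UNIV \<gamma>" "\<And>t. (\<lambda>n. c (r1 (r2 n)) t) \<longlonglongrightarrow> \<gamma> t"
      by (rule lipschitz_curves_convergent_subsequence[of "cball y (D + 1)" "\<lambda>n. c (r1 n)", OF proper cK c(1)]) (rule that)
    define r where "r n = r1 (r2 n)" for n
    have rm: "strict_mono r" using m(2) r2(1) unfolding r_def strict_mono_def by auto
    have \<gamma>lim: "(\<lambda>n. c (r n) t) \<longlonglongrightarrow> \<gamma> t" for t using r2(3) by (simp add: r_def)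
    have llim: "(\<lambda>n. l (r n)) \<longlonglongrightarrow> m"
      using LIMSEQ_subseq_LIMSEQ[OF m(3) r2(1)] by (simp add: o_def r_def)
    have "(\<lambda>n. x (r n)) \<longlonglongrightarrow> y" using LIMSEQ_subseq_LIMSEQ[OF lim rm] by (simp add: o_def)
    then have \<gamma>0: "\<gamma> 0 = y" using LIMSEQ_unique[OF \<gamma>lim[of 0]] c(2) by simp
    have endlim: "(\<lambda>n. c (r n) (l (r n))) \<longlonglongrightarrow> \<gamma> m"
    proof -
      have lim0: "(\<lambda>n. dist (l (r n)) m + dist (c (r n) m) (\<gamma> m)) \<longlonglongrightarrow> 0 + 0"
        by (intro tendsto_add iffD1[OF tendsto_dist_iff llim] iffD1[OF tendsto_dist_iff \<gamma>lim])
      have bd: "norm (dist (c (r n) (l (r n))) (\<gamma> m)) \<le> dist (l (r n)) m + dist (c (r n) m) (\<gamma> m)" for n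
      proof -
        have "dist (c (r n) (l (r n))) (\<gamma> m) \<le> dist (c (r n) (l (r n))) (c (r n) m) + dist (c (r n) m) (\<gamma> m)"
          by (rule dist_triangle)
        then show ?thesis using lipschitz_onD[OF c(1)[of "r n"], of "l (r n)" m] by simp
      qed
      have "(\<lambda>n. dist (c (r n) (l (r n))) (\<gamma> m)) \<longlonglongrightarrow> 0"
        by (rule Lim_null_comparison[OF always_eventually[OF allI[OF bd]]]) (use lim0 in simp)
      then show ?thesis by (rule iffD2[OF tendsto_dist_iff])
    qed
    have \<gamma>F: "\<gamma> m \<in> F"
      by (rule closed_sequentially[OF F _ endlim]) (use c(3) in auto)
    have flim: "(\<lambda>n. f (c (r n) (l (r n)))) \<longlonglongrightarrow> f (\<gamma> m)"
      by (rule continuous_on_tendsto_compose[OF f endlim \<gamma>F]) (use c(3) in auto)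
    let ?I = "\<lambda>n. \<integral>\<^sup>+t\<in>{0..l (r n)}. h (c (r n) t) \<partial>lborel"
    have "(\<integral>\<^sup>+t\<in>{0..m}. h (\<gamma> t) \<partial>lborel) = (\<integral>\<^sup>+t\<in>{0..<m}. h (\<gamma> t) \<partial>lborel)"
    proof (rule nn_integral_cong_AE)
      \<comment> \<open>The endpoint \<open>m\<close> is dropped because only for
        \<open>t < m\<close> is \<open>t\<close> eventually inside
        \<open>{0..l (r n)}\<close>.\<close>
      show "AE t in lborel. h (\<gamma> t) * indicator {0..m} t = h (\<gamma> t) * indicator {0..<m} t"
        using AE_lborel_singleton[of m] by eventually_elim (auto simp: indicator_def)
    qed
    also have "\<dots> \<le> (\<integral>\<^sup>+t. liminf (\<lambda>n. h (c (r n) t) * indicator {0..l (r n)} t) \<partial>lborel)"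
    proof (rule nn_integral_mono)
      fix t :: real
      show "h (\<gamma> t) * indicator {0..<m} t \<le> liminf (\<lambda>n. h (c (r n) t) * indicator {0..l (r n)} t)"
      proof (cases "t \<in> {0..<m}")
        case True
        have "\<forall>\<^sub>F n in sequentially. t < l (r n)"
          using True by (intro order_tendstoD(1)[OF llim]) auto
        then have "\<forall>\<^sub>F n in sequentially. h (c (r n) t) = h (c (r n) t) * indicator {0..l (r n)} t"
          by eventually_elim (use True in \<open>auto simp: indicator_def\<close>)
        then have "liminf (\<lambda>n. h (c (r n) t)) = liminf (\<lambda>n. h (c (r n) t) * indicator {0..l (r n)} t)"
          by (rule Liminf_eq)
        then show ?thesis using lsc_liminf[OF h \<gamma>lim[of t]] True by simp
      qed simp
    qed
    also have "\<dots> \<le> liminf ?I"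
      using lipschitz_integrand_measurable[OF hm c(1)] by (intro nn_integral_liminf) simp
    \<comment> \<open>The boundary value is moved to the right side, where it converges: all the
      endpoints lie in \<open>F\<close> and \<open>f\<close> is continuous there.\<close>
    also have "\<dots> \<le> liminf (\<lambda>n. ennreal (\<alpha> + e (r n) - f (c (r n) (l (r n)))))"
    proof (rule Liminf_mono, rule always_eventually, rule allI)
      fix n
      let ?f = "f (c (r n) (l (r n)))"
      have "?I n \<noteq> top" using cost[of "r n"] by auto
      then obtain i where i: "?I n = ennreal i" "0 \<le> i" by (cases "?I n") auto
      have "ennreal (?f + i) < ennreal (\<alpha> + e (r n))"
        using cost[of "r n"] i f0 by (simp del: ennreal_plus add: ennreal_plus[symmetric])
      then have "i \<le> \<alpha> + e (r n) - ?f"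
        using f0 i by (subst (asm) ennreal_less_iff) auto
      then show "?I n \<le> ennreal (\<alpha> + e (r n) - ?f)" using i by (simp add: ennreal_leI)
    qed
    also have "\<dots> = ennreal (\<alpha> + 0 - f (\<gamma> m))"
    proof (rule lim_imp_Liminf)
      show "(\<lambda>n. ennreal (\<alpha> + e (r n) - f (c (r n) (l (r n))))) \<longlonglongrightarrow> ennreal (\<alpha> + 0 - f (\<gamma> m))"
        using LIMSEQ_subseq_LIMSEQ[OF elim rm]
        by (intro tendsto_ennrealI tendsto_diff tendsto_add flim tendsto_const) (simp add: o_def)
    qed simp
    finally have I: "(\<integral>\<^sup>+t\<in>{0..m}. h (\<gamma> t) \<partial>lborel) \<le> ennreal (\<alpha> - f (\<gamma> m))" by simp
    have f\<alpha>: "f (\<gamma> m) \<le> \<alpha>"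
    proof -
      have "f (c (r n) (l (r n))) \<le> \<alpha> + e (r n)" for n
      proof -
        have "ennreal (f (c (r n) (l (r n)))) \<le> ennreal (\<alpha> + e (r n))"
          using order.strict_trans1[OF _ cost[of "r n"]] by (meson add_increasing2 less_imp_le order_refl zero_le)
        then show ?thesis using e[of "r n"] \<alpha> by (subst (asm) ennreal_le_iff) auto
      qed
      moreover have "(\<lambda>n. \<alpha> + e (r n)) \<longlonglongrightarrow> \<alpha> + 0"
        using LIMSEQ_subseq_LIMSEQ[OF elim rm] by (intro tendsto_add tendsto_const) (simp add: o_def)
      ultimately show ?thesis using LIMSEQ_le[OF flim, of "\<lambda>n. \<alpha> + e (r n)" "\<alpha> + 0"] by auto
    qed
    have "curve_inf f F h y \<le> ennreal (f (\<gamma> m)) + (\<integral>\<^sup>+t\<in>{0..m}. h (\<gamma> t) \<partial>lborel)"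
      using r2(2) m(1) \<gamma>0 \<gamma>F by (intro curve_inf_le) auto
    also have "\<dots> \<le> ennreal (f (\<gamma> m)) + ennreal (\<alpha> - f (\<gamma> m))" using I by (rule add_left_mono)
    also have "\<dots> = ennreal \<alpha>" using f0 f\<alpha> by (subst ennreal_plus[symmetric]) auto
    finally show "y \<in> {x. curve_inf f F h x \<le> a}" using \<alpha> by simp
  qed
qed

text \<open>The competitor is the constant curve with \<open>l = 0\<close>.\<close>

lemma curve_inf_le_boundary:
  assumes "x \<in> F"
  shows "curve_inf f F h x \<le> ennreal (f x)"
  using curve_inf_le[of "\<lambda>_. x" 0 x F f h] assms
  by (simp add: lipschitz_on_def nn_integral_cmult_indicator)

text \<open>By the upper gradient inequality along Lipschitz curves, no competitor can start cheaper
  than \<open>f x\<close>; the cap is harmless because \<open>f \<le> 1\<close>.\<close>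

lemma curve_inf_ge:
  fixes f :: "'a::metric_space \<Rightarrow> real"
  assumes ug: "upper_gradient UNIV (\<lambda>x. ereal (f x)) h" and f: "\<And>x. 0 \<le> f x" "\<And>x. f x \<le> 1"
  shows "ennreal (f x) \<le> curve_inf f F h x"
proof (rule curve_inf_geI)
  show "ennreal (f x) \<le> 1" using f(2)[of x] by (simp add: ennreal_le_1)
  fix c :: "real \<Rightarrow> 'a" and l :: real
  assume c: "1-lipschitz_on UNIV c" "0 \<le> l" "c 0 = x" "c l \<in> F"
  have "ennreal (f x) \<le> ennreal (f (c l) + \<bar>f (c 0) - f (c l)\<bar>)"
    using c by (intro ennreal_leI) auto
  also have "\<dots> = ennreal (f (c l)) + ennreal \<bar>f (c 0) - f (c l)\<bar>" using f by simp
  also have "\<dots> \<le> ennreal (f (c l)) + (\<integral>\<^sup>+t\<in>{0..l}. h (c t) \<partial>lborel)"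
    using upper_gradient_lipschitz_curve[OF ug c(1,2)] by (intro add_left_mono)
  finally show "ennreal (f x) \<le> ennreal (f (c l)) + (\<integral>\<^sup>+t\<in>{0..l}. h (c t) \<partial>lborel)" .
qed

section \<open>Completed Borel measures on the whole space\<close>

lemma restrict_space_UNIV_eq:
  assumes "space M = UNIV"
  shows "restrict_space M UNIV = M"
proof (rule measure_eqI)
  have "(\<inter>) UNIV ` sets M = sets M" by simp
  then show eq: "sets (restrict_space M UNIV) = sets M" by (simp add: sets_restrict_space)
  fix A assume "A \<in> sets (restrict_space M UNIV)"
  then show "emeasure (restrict_space M UNIV) A = emeasure M A"
    using assms sets.top[of M] by (intro emeasure_restrict_space) auto
qed

lemma complete_Borel_measureE:
  assumes "complete_Borel_measure M"
  obtains N where "sets N = sets borel" "M = completion N" "space M = UNIV" "space N = UNIV"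
    "sets borel \<subseteq> sets M"
proof -
  obtain N where N: "sets N = sets borel" "M = completion N"
    using assms by (auto simp: complete_Borel_measure_def)
  moreover have "space N = UNIV" using sets_eq_imp_space_eq[OF N(1)] by simp
  moreover have "sets borel \<subseteq> sets M" unfolding N(2) using N(1) sets_completionI_sets by blast
  ultimately show ?thesis using that by simp
qed

lemma complete_Borel_measurable:
  assumes "complete_Borel_measure M" "f \<in> borel_measurable borel"
  shows "f \<in> borel_measurable M"
proof -
  obtain N where N: "sets N = sets borel" "M = completion N"
    using complete_Borel_measureE[OF assms(1)] by metis
  have "f \<in> borel_measurable N" using assms(2) N(1) by (simp cong: measurable_cong_sets)
  then show ?thesis unfolding N(2) by (rule measurable_completion)
qed

subsection \<open>Capacity\<close>

lemma capacity_le: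
  assumes p: "0 < p" and u: "u \<in> borel_measurable (restrict_space M S)" "upper_gradient S u g" "\<And>x. x \<in> E \<Longrightarrow> 1 \<le> u x"
  shows "capacity p M S E \<le> (\<integral>\<^sup>+x. epowr (e2ennreal \<bar>u x\<bar>) p \<partial>restrict_space M S) + (\<integral>\<^sup>+x. epowr (g x) p \<partial>restrict_space M S)"
    (is "_ \<le> ?R")
proof (cases "?R < top")
  case True
  have le: "newton_norm p M S u \<le> epowr ?R (1 / p)"
    unfolding newton_norm_def using p u
    by (intro epowr_mono add_left_mono INF_lower2[of g]) auto
  also have "\<dots> < top" using True by simp
  finally have "u \<in> newton p M S" using u by (simp add: newton_def)
  then have "capacity p M S E \<le> epowr (newton_norm p M S u) p"
    unfolding capacity_def using u by (intro INF_lower) auto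
  also have "\<dots> \<le> epowr (epowr ?R (1 / p)) p" using le p by (intro epowr_mono) auto
  finally show ?thesis using p by (simp add: epowr_epowr)
next
  case False
  then have "?R = top" using less_top by blast
  then show ?thesis by (simp only: top_greatest)
qed

text \<open>The infimum over upper gradients need not be attained; the strict inequality leaves room
  for an actual one. All quantities are finite, so the subtraction is legitimate.\<close>

lemma newton_normE:
  assumes p: "0 < p" and "epowr (newton_norm p M S u) p < a"
  obtains g where "upper_gradient S u g"
    "(\<integral>\<^sup>+x. epowr (e2ennreal \<bar>u x\<bar>) p \<partial>restrict_space M S) + (\<integral>\<^sup>+x. epowr (g x) p \<partial>restrict_space M S) < a"
proof -
  define I where "I = (\<integral>\<^sup>+x. epowr (e2ennreal \<bar>u x\<bar>) p \<partial>restrict_space M S)"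
  define J where "J = (INF g\<in>{g. upper_gradient S u g}. \<integral>\<^sup>+x. epowr (g x) p \<partial>restrict_space M S)"
  have "I + J < a" using assms by (simp add: newton_norm_def epowr_epowr I_def J_def)
  then obtain b where b: "I + J < b" "b < a" using dense by blast
  have fin: "I \<noteq> top" "b \<noteq> top" "J \<noteq> top" using b by auto
  have "J < b - I"
  proof -
    obtain i j c where r: "I = ennreal i" "J = ennreal j" "b = ennreal c" "0 \<le> i" "0 \<le> j" "0 \<le> c"
      using fin by (metis ennreal_cases)
    then have "i + j < c" using b(1) by (simp add: ennreal_less_iff flip: ennreal_plus)
    then show ?thesis using r by (simp add: ennreal_minus ennreal_less_iff)
  qed
  then obtain g where g: "upper_gradient S u g" "(\<integral>\<^sup>+x. epowr (g x) p \<partial>restrict_space M S) < b - I"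
    unfolding J_def INF_less_iff by auto
  then have "I + (\<integral>\<^sup>+x. epowr (g x) p \<partial>restrict_space M S) \<le> I + (b - I)"
    by (intro add_left_mono less_imp_le)
  also have "\<dots> = b"
  proof -
    have "I \<le> b" using b(1) by (meson add_increasing2 less_imp_le order_refl order_trans zero_le)
    then show ?thesis using fin by (simp add: add_diff_inverse_ennreal)
  qed
  finally show ?thesis using that[OF g(1)] b(2) by (simp add: I_def)
qed

lemma capacity_lessE:
  assumes "0 < p" "capacity p M S E < a"
  obtains u g where "u \<in> borel_measurable (restrict_space M S)" "upper_gradient S u g" "\<And>x. x \<in> E \<Longrightarrow> 1 \<le> u x"
    "(\<integral>\<^sup>+x. epowr (e2ennreal \<bar>u x\<bar>) p \<partial>restrict_space M S) + (\<integral>\<^sup>+x. epowr (g x) p \<partial>restrict_space M S) < a"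
proof -
  obtain u where u: "u \<in> newton p M S" "\<forall>x\<in>E. 1 \<le> u x" "epowr (newton_norm p M S u) p < a"
    using assms(2) unfolding capacity_def INF_less_iff by auto
  obtain g where "upper_gradient S u g"
    "(\<integral>\<^sup>+x. epowr (e2ennreal \<bar>u x\<bar>) p \<partial>restrict_space M S) + (\<integral>\<^sup>+x. epowr (g x) p \<partial>restrict_space M S) < a"
    using newton_normE[OF assms(1) u(3)] by metis
  then show ?thesis using that u by (auto simp: newton_def)
qed

lemma capacity_mono: "E \<subseteq> E' \<Longrightarrow> capacity p M S E \<le> capacity p M S E'"
  unfolding capacity_def by (intro INF_superset_mono) auto

lemma upper_gradient_real:
  "upper_gradient UNIV (\<lambda>x. ereal (w x)) g \<longleftrightarrow> g \<in> borel_measurable borel \<and>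
     (\<forall>l \<gamma>. arc_length_curve UNIV l \<gamma> \<longrightarrow>
       ennreal \<bar>w (\<gamma> 0) - w (\<gamma> l)\<bar> \<le> (\<integral>\<^sup>+t\<in>{0..l}. g (\<gamma> t) \<partial>lborel))"
  by (simp add: upper_gradient_def restrict_space_UNIV_eq)

lemma capacity_le_real:
  assumes p: "0 < p" and M: "complete_Borel_measure M" and w: "w \<in> borel_measurable M" "\<And>x. 0 \<le> w x"
    "\<And>x. x \<in> E \<Longrightarrow> 1 \<le> w x" "upper_gradient UNIV (\<lambda>x. ereal (w x)) g"
  shows "capacity p M UNIV E \<le> (\<integral>\<^sup>+x. epowr (ennreal (w x)) p \<partial>M) + (\<integral>\<^sup>+x. epowr (g x) p \<partial>M)"
proof -
  have [simp]: "restrict_space M UNIV = M"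
    using complete_Borel_measureE[OF M] restrict_space_UNIV_eq by metis
  have "capacity p M UNIV E \<le> (\<integral>\<^sup>+x. epowr (e2ennreal \<bar>ereal (w x)\<bar>) p \<partial>restrict_space M UNIV) + (\<integral>\<^sup>+x. epowr (g x) p \<partial>restrict_space M UNIV)"
    using p w by (intro capacity_le) auto
  also have "\<dots> = (\<integral>\<^sup>+x. epowr (ennreal (w x)) p \<partial>M) + (\<integral>\<^sup>+x. epowr (g x) p \<partial>M)"
    using w(2) by (simp add: e2ennreal_ereal)
  finally show ?thesis .
qed

section \<open>Truncation of capacity test functions to real values\<close>

definition unit_clamp :: "ereal \<Rightarrow> real" where
  "unit_clamp a = real_of_ereal (max 0 (min 1 a))"

lemma unit_clamp_props:
  "0 \<le> unit_clamp a" "unit_clamp a \<le> 1" "1 \<le> a \<Longrightarrow> unit_clamp a = 1"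
  "ennreal (unit_clamp a) \<le> e2ennreal \<bar>a\<bar>"
  "ennreal \<bar>unit_clamp a - unit_clamp b\<bar> \<le> ext_diff a b"
proof -
  have r: "unit_clamp (ereal x) = max 0 (min 1 x)" for x
    by (auto simp: unit_clamp_def max_def min_def zero_ereal_def one_ereal_def)
  have i: "unit_clamp \<infinity> = 1" "unit_clamp (-\<infinity>) = 0" by (auto simp: unit_clamp_def)
  show "0 \<le> unit_clamp a" "unit_clamp a \<le> 1"
    by (cases a; simp add: r i)+
  show "1 \<le> a \<Longrightarrow> unit_clamp a = 1" by (cases a) (auto simp: r i one_ereal_def)
  show "ennreal (unit_clamp a) \<le> e2ennreal \<bar>a\<bar>"
    by (cases a) (auto simp: r i e2ennreal_ereal intro!: ennreal_leI)
  show "ennreal \<bar>unit_clamp a - unit_clamp b\<bar> \<le> ext_diff a b"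
    by (cases a; cases b) (auto simp: r ext_diff_def e2ennreal_ereal intro!: ennreal_leI)
qed

lemma unit_clamp_measurable [measurable]: "unit_clamp \<in> borel_measurable borel"
  unfolding unit_clamp_def by measurable

lemma upper_gradient_contraction:
  assumes "upper_gradient S u g" "\<And>a b. ext_diff (\<phi> a) (\<phi> b) \<le> ext_diff a b"
  shows "upper_gradient S (\<lambda>x. \<phi> (u x)) g"
  unfolding upper_gradient_def
proof (intro conjI allI impI)
  show "g \<in> borel_measurable (restrict_space borel S)"
    using assms(1) by (simp add: upper_gradient_def)
  fix l \<gamma> assume "arc_length_curve S l \<gamma>"
  then have "ext_diff (u (\<gamma> 0)) (u (\<gamma> l)) \<le> (\<integral>\<^sup>+t\<in>{0..l}. g (\<gamma> t) \<partial>lborel)"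
    using assms(1) by (simp add: upper_gradient_def)
  then show "ext_diff (\<phi> (u (\<gamma> 0))) (\<phi> (u (\<gamma> l))) \<le> (\<integral>\<^sup>+t\<in>{0..l}. g (\<gamma> t) \<partial>lborel)"
    using assms(2) order_trans by blast
qed

text \<open>Truncation to \<open>[0,1]\<close> does not increase the absolute value and keeps every
  upper gradient, also at infinite values. From here on test functions are real-valued and equal to
  1 on \<open>E\<close>.\<close>

lemma capacity_lessE_real:
  assumes p: "0 < p" and M: "complete_Borel_measure M" and "capacity p M UNIV E < a"
  obtains w g where "w \<in> borel_measurable M" "\<And>x. 0 \<le> w x" "\<And>x. w x \<le> (1::real)" "\<And>x. x \<in> E \<Longrightarrow> w x = 1"
    "upper_gradient UNIV (\<lambda>x. ereal (w x)) g"
    "(\<integral>\<^sup>+x. epowr (ennreal (w x)) p \<partial>M) + (\<integral>\<^sup>+x. epowr (g x) p \<partial>M) < a"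
proof -
  have [simp]: "restrict_space M UNIV = M"
    using complete_Borel_measureE[OF M] restrict_space_UNIV_eq by metis
  obtain u g where u: "u \<in> borel_measurable M" "upper_gradient UNIV u g" "\<And>x. x \<in> E \<Longrightarrow> 1 \<le> u x"
    and less: "(\<integral>\<^sup>+x. epowr (e2ennreal \<bar>u x\<bar>) p \<partial>M) + (\<integral>\<^sup>+x. epowr (g x) p \<partial>M) < a"
    using capacity_lessE[OF p assms(3)] by (metis \<open>restrict_space M UNIV = M\<close>)
  show ?thesis
  proof (rule that)
    show "(\<lambda>x. unit_clamp (u x)) \<in> borel_measurable M" using u(1) by measurable
    show "upper_gradient UNIV (\<lambda>x. ereal (unit_clamp (u x))) g"
      using u(2) by (rule upper_gradient_contraction) (simp add: unit_clamp_props)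
    have "(\<integral>\<^sup>+x. epowr (ennreal (unit_clamp (u x))) p \<partial>M) \<le> (\<integral>\<^sup>+x. epowr (e2ennreal \<bar>u x\<bar>) p \<partial>M)"
      using p by (intro nn_integral_mono epowr_mono unit_clamp_props) auto
    then show "(\<integral>\<^sup>+x. epowr (ennreal (unit_clamp (u x))) p \<partial>M) + (\<integral>\<^sup>+x. epowr (g x) p \<partial>M) < a"
      using less by (meson add_right_mono order.strict_trans1)
  qed (use u(3) in \<open>auto simp: unit_clamp_props\<close>)
qed

lemma emeasure_le_capacity:
  assumes p: "0 < p" and M: "complete_Borel_measure M" and E: "E \<in> sets M"
  shows "emeasure M E \<le> capacity p M UNIV E"
proof (rule ccontr)
  assume "\<not> emeasure M E \<le> capacity p M UNIV E"
  then have "capacity p M UNIV E < emeasure M E" by simp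
  from capacity_lessE_real[OF p M this]
  obtain w g where w: "\<And>x. x \<in> E \<Longrightarrow> w x = (1::real)"
    "(\<integral>\<^sup>+x. epowr (ennreal (w x)) p \<partial>M) + (\<integral>\<^sup>+x. epowr (g x) p \<partial>M) < emeasure M E" by metis
  have "emeasure M E = (\<integral>\<^sup>+x. indicator E x \<partial>M)" using E by simp
  also have "\<dots> \<le> (\<integral>\<^sup>+x. epowr (ennreal (w x)) p \<partial>M)"
    using w(1) by (intro nn_integral_mono) (auto simp: indicator_def)
  also have "\<dots> \<le> (\<integral>\<^sup>+x. epowr (ennreal (w x)) p \<partial>M) + (\<integral>\<^sup>+x. epowr (g x) p \<partial>M)" by simp
  finally show False using w(2) by simp
qed

lemma capacity_empty:
  assumes p: "0 < p" and M: "complete_Borel_measure M"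
  shows "capacity p M UNIV {} = 0"
proof -
  have "upper_gradient UNIV (\<lambda>x. ereal 0) (\<lambda>x. 0)" by (simp add: upper_gradient_real)
  then have "capacity p M UNIV {} \<le> (\<integral>\<^sup>+x. epowr (ennreal 0) p \<partial>M) + (\<integral>\<^sup>+x. epowr 0 p \<partial>M)"
    by (intro capacity_le_real[OF p M]) auto
  then show ?thesis by simp
qed

text \<open>The supremum of nearly optimal test functions is a test function for the union, with the
  supremum of their gradients as upper gradient. The p-th power of a supremum is at most the sum of
  the p-th powers, and the capacity carries no p-th root.\<close>

lemma capacity_UN:
  fixes G :: "nat \<Rightarrow> 'a::metric_space set"
  assumes p: "0 < p" and M: "complete_Borel_measure M"
  shows "capacity p M UNIV (\<Union>j. G j) \<le> (\<Sum>j. capacity p M UNIV (G j))"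
proof (rule ennreal_le_epsilon)
  fix e :: real assume fin: "(\<Sum>j. capacity p M UNIV (G j)) < top" and e: "0 < e"
  define good where "good j w g \<longleftrightarrow> w \<in> borel_measurable M \<and> (\<forall>x. 0 \<le> w x) \<and> (\<forall>x. w x \<le> 1) \<and> (\<forall>x\<in>G j. w x = 1) \<and>
    upper_gradient UNIV (\<lambda>x. ereal (w x)) g \<and>
    (\<integral>\<^sup>+x. epowr (ennreal (w x)) p \<partial>M) + (\<integral>\<^sup>+x. epowr (g x) p \<partial>M) < capacity p M UNIV (G j) + ennreal (e * (1/2) ^ Suc j)"
    for j and w :: "'a \<Rightarrow> real" and g
  have "\<exists>w g. good j w g" for j
  proof -
    have "capacity p M UNIV (G j) \<le> (\<Sum>j. capacity p M UNIV (G j))" by (rule le_suminf_ennreal)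
    then have "capacity p M UNIV (G j) < top" using fin by (rule order.strict_trans1)
    moreover have "0 < ennreal (e * (1/2) ^ Suc j)" using e by simp
    ultimately have "capacity p M UNIV (G j) < capacity p M UNIV (G j) + ennreal (e * (1/2) ^ Suc j)"
      by (metis add.right_neutral ennreal_add_left_cancel_less infinity_ennreal_def less_irrefl)
    from capacity_lessE_real[OF p M this] show ?thesis unfolding good_def by metis
  qed
  then obtain w g where "\<And>j. good j (w j) (g j)" by metis
  then have w: "\<And>j. w j \<in> borel_measurable M" "\<And>j x. 0 \<le> w j x" "\<And>j x. w j x \<le> 1" "\<And>j x. x \<in> G j \<Longrightarrow> w j x = 1"
    "\<And>j. upper_gradient UNIV (\<lambda>x. ereal (w j x)) (g j)"
    "\<And>j. (\<integral>\<^sup>+x. epowr (ennreal (w j x)) p \<partial>M) + (\<integral>\<^sup>+x. epowr (g j x) p \<partial>M) < capacity p M UNIV (G j) + ennreal (e * (1/2) ^ Suc j)"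
    unfolding good_def by blast+
  have gm: "g j \<in> borel_measurable borel" for j using w(5) by (simp add: upper_gradient_real)
  define W where "W x = enn2real (SUP j. ennreal (w j x))" for x
  have sup1: "(SUP j. ennreal (w j x)) \<le> 1" for x
    by (intro SUP_least) (simp add: w(3) ennreal_le_1)
  have W: "ennreal (W x) = (SUP j. ennreal (w j x))" for x
    unfolding W_def using sup1[of x] by (intro ennreal_enn2real) (auto intro: order.strict_trans1)
  have W0: "0 \<le> W x" for x by (simp add: W_def)
  have wW: "w j x \<le> W x" for j x
  proof -
    have "ennreal (w j x) \<le> ennreal (W x)" unfolding W by (rule SUP_upper) simp
    then show ?thesis using W0 by (simp add: ennreal_le_iff)
  qed
  define h where "h x = (SUP j. g j x)" for x
  have hm: "h \<in> borel_measurable borel" unfolding h_def using gm by measurable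
  have ug: "upper_gradient UNIV (\<lambda>x. ereal (W x)) h"
    unfolding upper_gradient_real
  proof (intro conjI allI impI hm)
    fix l :: real and \<gamma> :: "real \<Rightarrow> 'a" assume arc: "arc_length_curve UNIV l \<gamma>"
    define I where "I = (\<integral>\<^sup>+t\<in>{0..l}. h (\<gamma> t) \<partial>lborel)"
    have wI: "ennreal \<bar>w j (\<gamma> 0) - w j (\<gamma> l)\<bar> \<le> I" for j
    proof -
      have "ennreal \<bar>w j (\<gamma> 0) - w j (\<gamma> l)\<bar> \<le> (\<integral>\<^sup>+t\<in>{0..l}. g j (\<gamma> t) \<partial>lborel)"
        using w(5)[of j] arc by (simp add: upper_gradient_real)
      also have "\<dots> \<le> I" unfolding I_def h_def
        by (intro nn_integral_mono mult_right_mono SUP_upper) auto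
      finally show ?thesis .
    qed
    show "ennreal \<bar>W (\<gamma> 0) - W (\<gamma> l)\<bar> \<le> I"
    proof (cases "I = top")
      case False
      then obtain r where r: "I = ennreal r" "0 \<le> r" by (cases I) auto
      have wr: "\<bar>w j (\<gamma> 0) - w j (\<gamma> l)\<bar> \<le> r" for j using wI[of j] r by (simp add: ennreal_le_iff)
      have *: "W x \<le> W y + r" if "\<And>j. \<bar>w j x - w j y\<bar> \<le> r" for x y
      proof -
        have "ennreal (w j x) \<le> ennreal (W y + r)" for j
          using that[of j] wW[of j y] by (intro ennreal_leI) linarith
        then have "ennreal (W x) \<le> ennreal (W y + r)" unfolding W[of x] by (intro SUP_least)
        then show ?thesis using W0[of y] r(2) by (subst (asm) ennreal_le_iff) auto
      qed
      have "W (\<gamma> 0) \<le> W (\<gamma> l) + r" "W (\<gamma> l) \<le> W (\<gamma> 0) + r"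
        using wr by (auto intro!: * simp: abs_minus_commute)
      then show ?thesis unfolding r(1) by (intro ennreal_leI) linarith
    qed simp
  qed
  have Wm: "W \<in> borel_measurable M" unfolding W_def using w(1) by measurable
  have gM: "(\<lambda>x. epowr (g j x) p) \<in> borel_measurable M" for j
    using complete_Borel_measurable[OF M gm[of j]] by measurable
  have wM: "(\<lambda>x. epowr (ennreal (w j x)) p) \<in> borel_measurable M" for j
    using w(1)[of j] by measurable
  have "capacity p M UNIV (\<Union>j. G j) \<le> (\<integral>\<^sup>+x. epowr (ennreal (W x)) p \<partial>M) + (\<integral>\<^sup>+x. epowr (h x) p \<partial>M)"
  proof (rule capacity_le_real[OF p M Wm W0 _ ug])
    fix x assume "x \<in> (\<Union>j. G j)"
    then obtain j where "x \<in> G j" by blast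
    then show "1 \<le> W x" using wW[of j x] w(4)[of x j] by simp
  qed
  also have "\<dots> \<le> (\<integral>\<^sup>+x. (\<Sum>j. epowr (ennreal (w j x)) p) \<partial>M) + (\<integral>\<^sup>+x. (\<Sum>j. epowr (g j x) p) \<partial>M)"
    unfolding W h_def using p
    by (intro add_mono nn_integral_mono epowr_SUP_le le_suminf_ennreal[of "\<lambda>j. epowr (ennreal (w j _)) p"] le_suminf_ennreal[of "\<lambda>j. epowr (g j _) p"])
  also have "\<dots> = (\<Sum>j. (\<integral>\<^sup>+x. epowr (ennreal (w j x)) p \<partial>M) + (\<integral>\<^sup>+x. epowr (g j x) p \<partial>M))"
    using gM wM by (simp add: nn_integral_suminf suminf_add)
  also have "\<dots> \<le> (\<Sum>j. capacity p M UNIV (G j) + ennreal (e * (1/2) ^ Suc j))"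
    using w(6) by (intro suminf_le summableI less_imp_le)
  also have "\<dots> = (\<Sum>j. capacity p M UNIV (G j)) + ennreal e"
    by (simp only: suminf_add[OF summableI summableI, symmetric] suminf_half_ennreal[OF less_imp_le[OF e]])
  finally show "capacity p M UNIV (\<Union>j. G j) \<le> (\<Sum>j. capacity p M UNIV (G j)) + ennreal e" .
qed

lemma capacity_Un:
  fixes A B :: "'a::metric_space set"
  assumes p: "0 < p" and M: "complete_Borel_measure M"
  shows "capacity p M UNIV (A \<union> B) \<le> capacity p M UNIV A + capacity p M UNIV B"
proof -
  define G where "G j = (if j = 0 then A else if j = 1 then B else {})" for j :: nat
  have "(\<Union>j. G j) = A \<union> B"
    unfolding G_def by (auto split: if_splits intro: exI[of _ 0] exI[of _ 1])
  moreover have "(\<Sum>j. capacity p M UNIV (G j)) = (\<Sum>j\<in>{0, 1}. capacity p M UNIV (G j))"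
    by (rule suminf_finite) (auto simp: G_def capacity_empty[OF p M])
  ultimately show ?thesis using capacity_UN[OF p M, of G] by (simp add: G_def)
qed

subsection \<open>Operations on upper gradients\<close>

lemma upper_gradient_realD:
  fixes w :: "'a::metric_space \<Rightarrow> real"
  assumes ug: "upper_gradient UNIV (\<lambda>x. ereal (w x)) g" and arc: "arc_length_curve UNIV l \<gamma>"
    and st: "0 \<le> s" "s \<le> t" "t \<le> l"
  shows "ennreal \<bar>w (\<gamma> s) - w (\<gamma> t)\<bar> \<le> (\<integral>\<^sup>+r\<in>{s..t}. g (\<gamma> r) \<partial>lborel)"
proof (cases "s = t")
  case False
  then show ?thesis using upper_gradient_subcurve[OF ug arc st(1) _ st(3)] st by simp
qed simp

lemma arc_integrand_measurable:
  fixes g :: "'a::metric_space \<Rightarrow> ennreal"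
  assumes "g \<in> borel_measurable borel" "arc_length_curve UNIV l \<gamma>" "{s..t} \<subseteq> {0..l}"
  shows "(\<lambda>r. g (\<gamma> r) * indicator {s..t} r) \<in> borel_measurable borel"
  using assms unfolding arc_length_curve_def
  by (intro curve_integrand_measurable[where S = UNIV])
    (auto simp: restrict_space_UNIV_eq elim!: continuous_on_subset)

lemma set_nn_integral_mono_Icc:
  fixes k k' :: "real \<Rightarrow> ennreal"
  assumes "a \<le> s" "t \<le> b" "\<And>r. s < r \<Longrightarrow> r < t \<Longrightarrow> k r \<le> k' r"
  shows "(\<integral>\<^sup>+r\<in>{s..t}. k r \<partial>lborel) \<le> (\<integral>\<^sup>+r\<in>{a..b}. k' r \<partial>lborel)"
proof (rule nn_integral_mono_AE)
  show "AE r in lborel. k r * indicator {s..t} r \<le> k' r * indicator {a..b} r"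
    using AE_lborel_singleton[of s] AE_lborel_singleton[of t]
    by eventually_elim (use assms in \<open>auto simp: indicator_def\<close>)
qed

text \<open>Cut the interval at the first and the last zero.\<close>

lemma first_last_zero_bound:
  fixes V :: "real \<Rightarrow> real"
  assumes l: "0 \<le> l" and Z: "closed Z" "Z \<subseteq> {0..l}" and V0: "\<And>t. t \<in> {0..l} \<Longrightarrow> 0 \<le> V t"
    and none: "Z = {} \<Longrightarrow> ennreal \<bar>V 0 - V l\<bar> \<le> I"
    and first: "\<And>a. a \<in> Z \<Longrightarrow> \<forall>r\<in>Z. a \<le> r \<Longrightarrow> ennreal (V 0) \<le> I"
    and last: "\<And>b. b \<in> Z \<Longrightarrow> \<forall>r\<in>Z. r \<le> b \<Longrightarrow> ennreal (V l) \<le> I"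
  shows "ennreal \<bar>V 0 - V l\<bar> \<le> I"
proof (cases "Z = {}")
  case False
  have bd: "bdd_below Z" "bdd_above Z" using Z(2) by (meson bdd_below_Icc bdd_above_Icc bdd_below_mono bdd_above_mono)+
  have "Inf Z \<in> Z" "Sup Z \<in> Z"
    using closed_contains_Inf[OF False bd(1) Z(1)] closed_contains_Sup[OF False bd(2) Z(1)] by auto
  moreover have "\<forall>r\<in>Z. Inf Z \<le> r" "\<forall>r\<in>Z. r \<le> Sup Z" using bd cInf_lower cSup_upper by blast+
  ultimately have "ennreal (V 0) \<le> I" "ennreal (V l) \<le> I" using first last by blast+
  moreover have "ennreal \<bar>V 0 - V l\<bar> \<le> max (ennreal (V 0)) (ennreal (V l))"
    using V0[of 0] V0[of l] l by (auto simp: le_max_iff_disj abs_if intro!: ennreal_leI)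
  ultimately show ?thesis by (meson max.bounded_iff order_trans)
qed (use none in simp)

lemma before_first:
  fixes a :: real
  assumes "a \<in> {t \<in> {0..l}. P t}" "\<forall>r\<in>{t \<in> {0..l}. P t}. a \<le> r" "0 \<le> r" "r < a"
  shows "\<not> P r"
proof
  assume "P r"
  then have "r \<in> {t \<in> {0..l}. P t}" using assms by auto
  then show False using assms(2,4) by auto
qed

lemma after_last:
  fixes b :: real
  assumes "b \<in> {t \<in> {0..l}. P t}" "\<forall>r\<in>{t \<in> {0..l}. P t}. r \<le> b" "b < r" "r \<le> l"
  shows "\<not> P r"
proof
  assume "P r"
  then have "r \<in> {t \<in> {0..l}. P t}" using assms by auto
  then show False using assms(2,3) by auto
qed

lemma closed_curve_preimage:
  assumes "arc_length_curve UNIV l \<gamma>" "closed F"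
  shows "closed {t \<in> {0..l}. \<gamma> t \<in> F}"
  using continuous_closed_preimage[of "{0..l}" \<gamma> F] assms
  by (simp add: arc_length_curve_def vimage_def Int_def)

text \<open>A curve meeting \<open>F\<close> is cut at its first and last visit. \<open>D\<close>
  vanishes at both, so each endpoint value is bounded by the integral over a piece that avoids
  \<open>F\<close>. Closedness of \<open>F\<close> makes the two visits exist, without any
  continuity of \<open>D\<close>.\<close>

lemma upper_gradient_cut:
  fixes D :: "'a::metric_space \<Rightarrow> real"
  assumes ug: "upper_gradient UNIV (\<lambda>x. ereal (D x)) k" and D: "\<And>x. 0 \<le> D x"
    and F: "closed F" "\<And>x. x \<in> F \<Longrightarrow> D x = 0"
  shows "upper_gradient UNIV (\<lambda>x. ereal (D x)) (\<lambda>x. k x * indicator (- F) x)"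
  unfolding upper_gradient_real
proof (intro conjI allI impI)
  have "k \<in> borel_measurable borel" using ug by (simp add: upper_gradient_real)
  then show "(\<lambda>x. k x * indicator (- F) x) \<in> borel_measurable borel"
    using F(1) by (intro borel_measurable_times_ennreal borel_measurable_indicator) auto
  fix l :: real and \<gamma> :: "real \<Rightarrow> 'a" assume arc: "arc_length_curve UNIV l \<gamma>"
  then have l: "0 \<le> l" by (simp add: arc_length_curve_def)
  have *: "ennreal \<bar>D (\<gamma> s) - D (\<gamma> t)\<bar> \<le> (\<integral>\<^sup>+r\<in>{0..l}. k (\<gamma> r) * indicator (- F) (\<gamma> r) \<partial>lborel)"
    if "0 \<le> s" "s \<le> t" "t \<le> l" "\<And>r. s < r \<Longrightarrow> r < t \<Longrightarrow> \<gamma> r \<notin> F" for s t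
  proof -
    have "ennreal \<bar>D (\<gamma> s) - D (\<gamma> t)\<bar> \<le> (\<integral>\<^sup>+r\<in>{s..t}. k (\<gamma> r) \<partial>lborel)"
      using upper_gradient_realD[OF ug arc that(1-3)] .
    also have "\<dots> \<le> (\<integral>\<^sup>+r\<in>{0..l}. k (\<gamma> r) * indicator (- F) (\<gamma> r) \<partial>lborel)"
      using that by (intro set_nn_integral_mono_Icc) auto
    finally show ?thesis .
  qed
  show "ennreal \<bar>D (\<gamma> 0) - D (\<gamma> l)\<bar> \<le> (\<integral>\<^sup>+t\<in>{0..l}. k (\<gamma> t) * indicator (- F) (\<gamma> t) \<partial>lborel)"
  proof (rule first_last_zero_bound[OF l closed_curve_preimage[OF arc F(1)]])
    fix a assume a: "a \<in> {t \<in> {0..l}. \<gamma> t \<in> F}" "\<forall>r\<in>{t \<in> {0..l}. \<gamma> t \<in> F}. a \<le> r"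
    then have "ennreal \<bar>D (\<gamma> 0) - D (\<gamma> a)\<bar> \<le> (\<integral>\<^sup>+r\<in>{0..l}. k (\<gamma> r) * indicator (- F) (\<gamma> r) \<partial>lborel)"
      by (intro *) (use a(1) before_first[OF a] in auto)
    then show "ennreal (D (\<gamma> 0)) \<le> (\<integral>\<^sup>+t\<in>{0..l}. k (\<gamma> t) * indicator (- F) (\<gamma> t) \<partial>lborel)"
      using a F(2) D by simp
  next
    fix b assume b: "b \<in> {t \<in> {0..l}. \<gamma> t \<in> F}" "\<forall>r\<in>{t \<in> {0..l}. \<gamma> t \<in> F}. r \<le> b"
    then have "ennreal \<bar>D (\<gamma> b) - D (\<gamma> l)\<bar> \<le> (\<integral>\<^sup>+r\<in>{0..l}. k (\<gamma> r) * indicator (- F) (\<gamma> r) \<partial>lborel)"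
      by (intro *) (use b(1) after_last[OF b] in auto)
    then show "ennreal (D (\<gamma> l)) \<le> (\<integral>\<^sup>+t\<in>{0..l}. k (\<gamma> t) * indicator (- F) (\<gamma> t) \<partial>lborel)"
      using b F(2) D by simp
  qed (use D l in \<open>auto intro!: *\<close>)
qed

text \<open>Absolute continuity of the integral: the integrals over shrinking intervals tend to 0 by
  dominated convergence.\<close>

lemma continuous_on_integral_bound:
  fixes V :: "real \<Rightarrow> real" and k :: "real \<Rightarrow> ennreal"
  assumes m: "(\<lambda>r. k r * indicator {0..l} r) \<in> borel_measurable borel"
    and fin: "(\<integral>\<^sup>+r\<in>{0..l}. k r \<partial>lborel) < top"
    and V: "\<And>s t. 0 \<le> s \<Longrightarrow> s \<le> t \<Longrightarrow> t \<le> l \<Longrightarrow> ennreal \<bar>V s - V t\<bar> \<le> (\<integral>\<^sup>+r\<in>{s..t}. k r \<partial>lborel)"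
  shows "continuous_on {0..l} V"
  unfolding continuous_on_sequentially
proof (intro allI ballI impI, elim conjE)
  fix x :: "nat \<Rightarrow> real" and a assume a: "a \<in> {0..l}" and x: "\<forall>n. x n \<in> {0..l}" and lim: "x \<longlonglongrightarrow> a"
  let ?J = "\<lambda>n. {min (x n) a..max (x n) a}"
  let ?k = "\<lambda>r. k r * indicator {0..l} r"
  have le: "ennreal \<bar>V (x n) - V a\<bar> \<le> (\<integral>\<^sup>+r. ?k r * indicator (?J n) r \<partial>lborel)" for n
  proof -
    have "ennreal \<bar>V (x n) - V a\<bar> = ennreal \<bar>V (min (x n) a) - V (max (x n) a)\<bar>"
      by (auto simp: min_def max_def abs_minus_commute)
    also have "\<dots> \<le> (\<integral>\<^sup>+r\<in>?J n. k r \<partial>lborel)"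
      using a x by (intro V) auto
    also have "\<dots> = (\<integral>\<^sup>+r. ?k r * indicator (?J n) r \<partial>lborel)"
      using a x[rule_format, of n] by (intro nn_integral_cong) (auto simp: indicator_def min_def max_def split: if_splits)
    finally show ?thesis .
  qed
  have "(\<lambda>n. \<integral>\<^sup>+r. ?k r * indicator (?J n) r \<partial>lborel) \<longlonglongrightarrow> (\<integral>\<^sup>+(r::real). 0 \<partial>lborel)"
  proof (rule nn_integral_dominated_convergence[where w = ?k])
    show "(\<lambda>r. ?k r * indicator (?J n) r) \<in> borel_measurable lborel" for n
      by (rule borel_measurable_times_ennreal) (use m in auto)
    show "AE r in lborel. ?k r * indicator (?J n) r \<le> ?k r" for n
      by (auto simp: indicator_def)
    show "AE r in lborel. (\<lambda>n. ?k r * indicator (?J n) r) \<longlonglongrightarrow> 0"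
      using AE_lborel_singleton[of a]
    proof eventually_elim
      case (elim r)
      then have "\<forall>\<^sub>F n in sequentially. dist (x n) a < dist r a"
        by (intro tendstoD[OF lim]) simp
      then have "\<forall>\<^sub>F n in sequentially. ?k r * indicator (?J n) r = 0"
      proof eventually_elim
        case (elim n)
        then have "r \<notin> ?J n" by (auto simp: dist_real_def)
        then show ?case by simp
      qed
      then show ?case by (rule tendsto_eventually)
    qed
  qed (use m fin in auto)
  then have lim0: "(\<lambda>n. \<integral>\<^sup>+r. ?k r * indicator (?J n) r \<partial>lborel) \<longlonglongrightarrow> 0" by simp
  have "(\<lambda>n. ennreal \<bar>V (x n) - V a\<bar>) \<longlonglongrightarrow> ennreal 0"
    unfolding ennreal_0
    by (rule tendsto_sandwich[OF always_eventually[OF allI[OF zero_le]] always_eventually[OF allI[OF le]] tendsto_const lim0])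
  then have "(\<lambda>n. \<bar>V (x n) - V a\<bar>) \<longlonglongrightarrow> 0"
    by (subst (asm) tendsto_ennreal_iff) auto
  then show "(V \<circ> x) \<longlonglongrightarrow> V a"
    by - (rule iffD2[OF tendsto_dist_iff], simp add: o_def dist_real_def)
qed

lemma curve_continuous:
  fixes w :: "'a::metric_space \<Rightarrow> real"
  assumes ug: "upper_gradient UNIV (\<lambda>x. ereal (w x)) g" and arc: "arc_length_curve UNIV l \<gamma>"
    and fin: "(\<integral>\<^sup>+r\<in>{0..l}. g (\<gamma> r) \<partial>lborel) < top"
  shows "continuous_on {0..l} (\<lambda>t. w (\<gamma> t))"
proof (rule continuous_on_integral_bound[OF _ fin])
  show "(\<lambda>r. g (\<gamma> r) * indicator {0..l} r) \<in> borel_measurable borel"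
    using ug arc by (intro arc_integrand_measurable) (auto simp: upper_gradient_real)
qed (use upper_gradient_realD[OF ug arc] in auto)

text \<open>The term \<open>\<theta> * k\<close> discards the curves along which \<open>k\<close> is not integrable, where
  \<open>D\<close> need not be continuous.\<close>

lemma upper_gradient_concentrate:
  fixes D :: "'a::metric_space \<Rightarrow> real"
  assumes ug: "upper_gradient UNIV (\<lambda>x. ereal (D x)) k" and D: "\<And>x. 0 \<le> D x"
    and N: "N \<in> sets borel" "\<And>x. x \<notin> N \<Longrightarrow> D x = 0" and \<theta>: "0 < \<theta>"
  shows "upper_gradient UNIV (\<lambda>x. ereal (D x)) (\<lambda>x. k x * indicator N x + ennreal \<theta> * k x)"
    (is "upper_gradient _ _ ?k")
  unfolding upper_gradient_real
proof (intro conjI allI impI)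
  have k: "k \<in> borel_measurable borel" using ug by (simp add: upper_gradient_real)
  then show "?k \<in> borel_measurable borel"
    using N(1) by (intro borel_measurable_add borel_measurable_times_ennreal borel_measurable_indicator) auto
  fix l :: real and \<gamma> :: "real \<Rightarrow> 'a" assume arc: "arc_length_curve UNIV l \<gamma>"
  then have l: "0 \<le> l" by (simp add: arc_length_curve_def)
  have km: "(\<lambda>r. k (\<gamma> r) * indicator {0..l} r) \<in> borel_measurable borel"
    using arc_integrand_measurable[OF k arc] by simp
  show "ennreal \<bar>D (\<gamma> 0) - D (\<gamma> l)\<bar> \<le> (\<integral>\<^sup>+t\<in>{0..l}. ?k (\<gamma> t) \<partial>lborel)"
  proof (cases "(\<integral>\<^sup>+t\<in>{0..l}. k (\<gamma> t) \<partial>lborel) < top")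
    case False
    have "top = ennreal \<theta> * (\<integral>\<^sup>+t\<in>{0..l}. k (\<gamma> t) \<partial>lborel)"
      using False \<theta> by (simp add: less_top[symmetric] ennreal_mult_top)
    also have "\<dots> = (\<integral>\<^sup>+t. ennreal \<theta> * (k (\<gamma> t) * indicator {0..l} t) \<partial>lborel)"
      using km by (intro nn_integral_cmult[symmetric]) simp
    also have "\<dots> \<le> (\<integral>\<^sup>+t\<in>{0..l}. ?k (\<gamma> t) \<partial>lborel)"
      by (intro nn_integral_mono) (auto simp: indicator_def)
    finally show ?thesis by (simp add: top_unique)
  next
    case True
    have cont: "continuous_on {0..l} (\<lambda>t. D (\<gamma> t))" by (rule curve_continuous[OF ug arc True])
    have Z: "closed {t \<in> {0..l}. D (\<gamma> t) = 0}"
      using continuous_closed_preimage_constant[OF cont, of 0] by simp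
    have *: "ennreal \<bar>D (\<gamma> s) - D (\<gamma> t)\<bar> \<le> (\<integral>\<^sup>+r\<in>{0..l}. ?k (\<gamma> r) \<partial>lborel)"
      if "0 \<le> s" "s \<le> t" "t \<le> l" "\<And>r. s < r \<Longrightarrow> r < t \<Longrightarrow> D (\<gamma> r) \<noteq> 0" for s t
    proof -
      have "ennreal \<bar>D (\<gamma> s) - D (\<gamma> t)\<bar> \<le> (\<integral>\<^sup>+r\<in>{s..t}. k (\<gamma> r) \<partial>lborel)"
        using upper_gradient_realD[OF ug arc that(1-3)] .
      also have "\<dots> \<le> (\<integral>\<^sup>+r\<in>{0..l}. ?k (\<gamma> r) \<partial>lborel)"
      proof (rule set_nn_integral_mono_Icc)
        fix r assume "s < r" "r < t"
        then have "\<gamma> r \<in> N" using that(4) N(2) by blast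
        then show "k (\<gamma> r) \<le> ?k (\<gamma> r)" by simp
      qed (use that in auto)
      finally show ?thesis .
    qed
    show ?thesis
    proof (rule first_last_zero_bound[OF l Z])
      fix a assume a: "a \<in> {t \<in> {0..l}. D (\<gamma> t) = 0}" "\<forall>r\<in>{t \<in> {0..l}. D (\<gamma> t) = 0}. a \<le> r"
      then have "ennreal \<bar>D (\<gamma> 0) - D (\<gamma> a)\<bar> \<le> (\<integral>\<^sup>+r\<in>{0..l}. ?k (\<gamma> r) \<partial>lborel)"
        by (intro *) (use a(1) before_first[OF a] in auto)
      then show "ennreal (D (\<gamma> 0)) \<le> (\<integral>\<^sup>+r\<in>{0..l}. ?k (\<gamma> r) \<partial>lborel)"
        using a D by simp
    next
      fix b assume b: "b \<in> {t \<in> {0..l}. D (\<gamma> t) = 0}" "\<forall>r\<in>{t \<in> {0..l}. D (\<gamma> t) = 0}. r \<le> b"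
      then have "ennreal \<bar>D (\<gamma> b) - D (\<gamma> l)\<bar> \<le> (\<integral>\<^sup>+r\<in>{0..l}. ?k (\<gamma> r) \<partial>lborel)"
        by (intro *) (use b(1) after_last[OF b] in auto)
      then show "ennreal (D (\<gamma> l)) \<le> (\<integral>\<^sup>+r\<in>{0..l}. ?k (\<gamma> r) \<partial>lborel)"
        using b D by simp
    qed (use D l in \<open>auto intro!: *\<close>)
  qed
qed

text \<open>On a piece where \<open>\<zeta>\<close> is positive the curve stays in \<open>S\<close>,
  and the Leibniz rule with both factors in \<open>[0,1]\<close> gives the sum of the gradients.
  Otherwise the curve is cut at the first and last zero of \<open>\<zeta>\<close>, where the product
  vanishes too.\<close>

lemma upper_gradient_product:
  fixes a \<zeta> :: "'a::metric_space \<Rightarrow> real"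
  assumes ug: "upper_gradient UNIV (\<lambda>x. ereal (\<zeta> x)) k" and k': "k' \<in> borel_measurable borel"
    and a: "\<And>l \<gamma> s t. arc_length_curve UNIV l \<gamma> \<Longrightarrow> 0 \<le> s \<Longrightarrow> s \<le> t \<Longrightarrow> t \<le> l \<Longrightarrow> \<gamma> ` {s..t} \<subseteq> S \<Longrightarrow>
        ennreal \<bar>a (\<gamma> s) - a (\<gamma> t)\<bar> \<le> (\<integral>\<^sup>+r\<in>{s..t}. k' (\<gamma> r) \<partial>lborel)"
    and a01: "\<And>x. 0 \<le> a x" "\<And>x. a x \<le> 1" and \<zeta>01: "\<And>x. 0 \<le> \<zeta> x" "\<And>x. \<zeta> x \<le> 1"
    and S: "\<And>x. 0 < \<zeta> x \<Longrightarrow> x \<in> S"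
  shows "upper_gradient UNIV (\<lambda>x. ereal (a x * \<zeta> x)) (\<lambda>x. k x + k' x)"
  unfolding upper_gradient_real
proof (intro conjI allI impI)
  have k: "k \<in> borel_measurable borel" using ug by (simp add: upper_gradient_real)
  then show "(\<lambda>x. k x + k' x) \<in> borel_measurable borel" using k' by measurable
  fix l :: real and \<gamma> :: "real \<Rightarrow> 'a" assume arc: "arc_length_curve UNIV l \<gamma>"
  then have l: "0 \<le> l" by (simp add: arc_length_curve_def)
  define I where "I = (\<integral>\<^sup>+t\<in>{0..l}. (k (\<gamma> t) + k' (\<gamma> t)) \<partial>lborel)"
  let ?V = "\<lambda>t. a (\<gamma> t) * \<zeta> (\<gamma> t)"
  show "ennreal \<bar>?V 0 - ?V l\<bar> \<le> (\<integral>\<^sup>+t\<in>{0..l}. (k (\<gamma> t) + k' (\<gamma> t)) \<partial>lborel)"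
    unfolding I_def[symmetric]
  proof (cases "I = top")
    case False
    then obtain r where r: "I = ennreal r" "0 \<le> r" by (cases I) auto
    have "(\<integral>\<^sup>+t\<in>{0..l}. k (\<gamma> t) \<partial>lborel) \<le> I"
      unfolding I_def by (intro nn_integral_mono) (auto simp: indicator_def)
    then have fin: "(\<integral>\<^sup>+t\<in>{0..l}. k (\<gamma> t) \<partial>lborel) < top"
      using False by (simp add: less_top order.strict_trans1)
    have cont: "continuous_on {0..l} (\<lambda>t. \<zeta> (\<gamma> t))" by (rule curve_continuous[OF ug arc fin])
    let ?Z = "{t \<in> {0..l}. \<zeta> (\<gamma> t) = 0}"
    have Z: "closed ?Z" using continuous_closed_preimage_constant[OF cont, of 0] by simp
    have *: "\<bar>?V s - ?V t\<bar> \<le> r"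
      if st: "0 \<le> s" "s \<le> t" "t \<le> l" "\<And>q. q \<in> {s..t} \<Longrightarrow> \<zeta> (\<gamma> q) \<noteq> 0" for s t
    proof -
      have im: "\<gamma> ` {s..t} \<subseteq> S"
        using st(4) S \<zeta>01(1) by (force simp: less_le)
      have sub: "{s..t} \<subseteq> {0..l}" using st by auto
      have "?V s - ?V t = a (\<gamma> s) * (\<zeta> (\<gamma> s) - \<zeta> (\<gamma> t)) + (a (\<gamma> s) - a (\<gamma> t)) * \<zeta> (\<gamma> t)"
        by (simp add: algebra_simps)
      also have "\<bar>\<dots>\<bar> \<le> \<bar>\<zeta> (\<gamma> s) - \<zeta> (\<gamma> t)\<bar> + \<bar>a (\<gamma> s) - a (\<gamma> t)\<bar>"
        using a01 \<zeta>01
        by (intro order_trans[OF abs_triangle_ineq] add_mono) (auto simp: abs_mult mult_left_le_one_le mult_right_le_one_le)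
      finally have "ennreal \<bar>?V s - ?V t\<bar> \<le> ennreal \<bar>\<zeta> (\<gamma> s) - \<zeta> (\<gamma> t)\<bar> + ennreal \<bar>a (\<gamma> s) - a (\<gamma> t)\<bar>"
        by (simp add: ennreal_leI flip: ennreal_plus)
      also have "\<dots> \<le> (\<integral>\<^sup>+r\<in>{s..t}. k (\<gamma> r) \<partial>lborel) + (\<integral>\<^sup>+r\<in>{s..t}. k' (\<gamma> r) \<partial>lborel)"
        using upper_gradient_realD[OF ug arc st(1-3)] a[OF arc st(1-3) im] by (rule add_mono)
      also have "\<dots> = (\<integral>\<^sup>+r. k (\<gamma> r) * indicator {s..t} r + k' (\<gamma> r) * indicator {s..t} r \<partial>lborel)"
        using arc_integrand_measurable[OF k arc sub] arc_integrand_measurable[OF k' arc sub]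
        by (intro nn_integral_add[symmetric]) auto
      also have "\<dots> \<le> I"
        unfolding I_def using sub by (intro nn_integral_mono) (auto simp: indicator_def)
      finally show ?thesis using r by (simp add: ennreal_le_iff)
    qed
    have V\<zeta>: "?V t \<le> \<zeta> (\<gamma> t)" for t using a01 \<zeta>01 by (simp add: mult_left_le_one_le)
    have near: "\<exists>d>0. \<forall>t\<in>{0..l}. dist t q < d \<longrightarrow> \<zeta> (\<gamma> t) < e" if "q \<in> ?Z" "0 < e" for q e
      using cont that \<zeta>01 unfolding continuous_on_iff by (force simp: dist_real_def)
    show "ennreal \<bar>?V 0 - ?V l\<bar> \<le> I"
    proof (rule first_last_zero_bound[OF l Z])
      assume "?Z = {}"
      then show "ennreal \<bar>?V 0 - ?V l\<bar> \<le> I" unfolding r(1) using l by (intro ennreal_leI *) auto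
    next
      fix b assume b: "b \<in> ?Z" "\<forall>r\<in>?Z. b \<le> r"
      \<comment> \<open>The point at parameter \<open>b\<close> may lie outside \<open>S\<close>,
        where \<open>a\<close> is not controlled. So the piece stops slightly before
        \<open>b\<close>, where the product is small because it is at most \<open>\<zeta>\<close>
        and \<open>\<zeta>\<close> is continuous along the curve.\<close>
      have "?V 0 \<le> r"
      proof (rule ccontr)
        assume neg: "\<not> ?V 0 \<le> r"
        then have "b \<noteq> 0" using b(1) r by auto
        then have b0: "0 < b" using b(1) by auto
        obtain d where d: "0 < d" "\<And>t. t \<in> {0..l} \<Longrightarrow> dist t b < d \<Longrightarrow> \<zeta> (\<gamma> t) < ?V 0 - r"
          using near[OF b(1), of "?V 0 - r"] neg by auto
        define t where "t = max 0 (b - d / 2)"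
        have t: "0 \<le> t" "t < b" "dist t b < d" using b0 d(1) by (auto simp: t_def dist_real_def)
        have "\<bar>?V 0 - ?V t\<bar> \<le> r"
          by (intro *) (use t b(1) before_first[OF b] in auto)
        moreover have "\<zeta> (\<gamma> t) < ?V 0 - r" using d(2)[of t] t b(1) by auto
        ultimately show False using V\<zeta>[of t] by linarith
      qed
      then show "ennreal (?V 0) \<le> I" unfolding r(1) by (rule ennreal_leI)
    next
      fix b assume b: "b \<in> ?Z" "\<forall>r\<in>?Z. r \<le> b"
      have "?V l \<le> r"
      proof (rule ccontr)
        assume neg: "\<not> ?V l \<le> r"
        then have "b \<noteq> l" using b(1) r by auto
        then have b0: "b < l" using b(1) by auto
        obtain d where d: "0 < d" "\<And>t. t \<in> {0..l} \<Longrightarrow> dist t b < d \<Longrightarrow> \<zeta> (\<gamma> t) < ?V l - r"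
          using near[OF b(1), of "?V l - r"] neg by auto
        define t where "t = min l (b + d / 2)"
        have t: "t \<le> l" "b < t" "dist t b < d" using b0 d(1) by (auto simp: t_def dist_real_def)
        have "\<bar>?V t - ?V l\<bar> \<le> r"
          by (intro *) (use t b(1) after_last[OF b] in auto)
        moreover have "\<zeta> (\<gamma> t) < ?V l - r" using d(2)[of t] t b(1) by auto
        ultimately show False using V\<zeta>[of t] by linarith
      qed
      then show "ennreal (?V l) \<le> I" unfolding r(1) by (rule ennreal_leI)
    qed (use a01 \<zeta>01 in auto)
  qed simp
qed

subsection \<open>Quasicontinuity of bounded functions with bounded support\<close>

lemma ennreal_abs_diff_le:
  assumes "0 \<le> s" "0 \<le> t" "ennreal s \<le> ennreal t + I" "ennreal t \<le> ennreal s + I"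
  shows "ennreal \<bar>s - t\<bar> \<le> I"
proof (cases "I = top")
  case False
  then obtain r where r: "I = ennreal r" "0 \<le> r" by (cases I) auto
  have "s \<le> t + r" "t \<le> s + r"
    using assms r by (simp_all add: ennreal_le_iff flip: ennreal_plus)
  then show ?thesis unfolding r(1) by (intro ennreal_leI) linarith
qed simp

lemma upper_gradient_scale:
  fixes D :: "'a::metric_space \<Rightarrow> real"
  assumes ug: "upper_gradient UNIV (\<lambda>x. ereal (D x)) k" and c: "0 \<le> c"
  shows "upper_gradient UNIV (\<lambda>x. ereal (c * D x)) (\<lambda>x. ennreal c * k x)"
  unfolding upper_gradient_real
proof (intro conjI allI impI)
  have k: "k \<in> borel_measurable borel" using ug by (simp add: upper_gradient_real)
  then show "(\<lambda>x. ennreal c * k x) \<in> borel_measurable borel" by measurable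
  fix l :: real and \<gamma> :: "real \<Rightarrow> 'a" assume arc: "arc_length_curve UNIV l \<gamma>"
  have "ennreal \<bar>c * D (\<gamma> 0) - c * D (\<gamma> l)\<bar> = ennreal c * ennreal \<bar>D (\<gamma> 0) - D (\<gamma> l)\<bar>"
    using c by (simp add: abs_mult right_diff_distrib[symmetric] ennreal_mult[symmetric])
  also have "\<dots> \<le> ennreal c * (\<integral>\<^sup>+t\<in>{0..l}. k (\<gamma> t) \<partial>lborel)"
    using ug arc by (intro mult_left_mono) (auto simp: upper_gradient_real)
  also have "\<dots> = (\<integral>\<^sup>+t. ennreal c * (k (\<gamma> t) * indicator {0..l} t) \<partial>lborel)"
    using arc_integrand_measurable[OF k arc, of 0 l] by (intro nn_integral_cmult[symmetric]) simp
  also have "\<dots> = (\<integral>\<^sup>+t\<in>{0..l}. ennreal c * k (\<gamma> t) \<partial>lborel)"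
    by (simp add: mult.assoc)
  finally show "ennreal \<bar>c * D (\<gamma> 0) - c * D (\<gamma> l)\<bar> \<le> (\<integral>\<^sup>+t\<in>{0..l}. ennreal c * k (\<gamma> t) \<partial>lborel)" .
qed

lemma upper_gradient_mono:
  fixes u :: "'a::metric_space \<Rightarrow> ereal"
  assumes "upper_gradient UNIV u g" "\<And>x. g x \<le> h x" "h \<in> borel_measurable borel"
  shows "upper_gradient UNIV u h"
  unfolding upper_gradient_def
proof (intro conjI allI impI)
  show "h \<in> borel_measurable (restrict_space borel UNIV)"
    using assms(3) by (simp add: restrict_space_UNIV_eq)
  fix l :: real and \<gamma> :: "real \<Rightarrow> 'a" assume "arc_length_curve UNIV l \<gamma>"
  then have "ext_diff (u (\<gamma> 0)) (u (\<gamma> l)) \<le> (\<integral>\<^sup>+t\<in>{0..l}. g (\<gamma> t) \<partial>lborel)"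
    using assms(1) by (simp add: upper_gradient_def)
  also have "\<dots> \<le> (\<integral>\<^sup>+t\<in>{0..l}. h (\<gamma> t) \<partial>lborel)"
    using assms(2) by (intro nn_integral_mono mult_right_mono) auto
  finally show "ext_diff (u (\<gamma> 0)) (u (\<gamma> l)) \<le> (\<integral>\<^sup>+t\<in>{0..l}. h (\<gamma> t) \<partial>lborel)" .
qed

text \<open>The condition on the sum is split at a rational number into one condition on each
  summand.\<close>

lemma open_sum_superlevel:
  fixes T1 T2 :: "'a::topological_space \<Rightarrow> real"
  assumes "\<And>a. open {x. a < T1 x}" "\<And>a. open {x. a < T2 x}"
  shows "open {x. c < T1 x + T2 x}"
proof -
  have "{x. c < T1 x + T2 x} = (\<Union>q::rat. {x. of_rat q < T1 x} \<inter> {x. c - of_rat q < T2 x})"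
  proof (intro equalityI subsetI)
    fix x assume "x \<in> {x. c < T1 x + T2 x}"
    then have "c - T2 x < T1 x" by auto
    then obtain q where "c - T2 x < of_rat q" "of_rat q < T1 x" using of_rat_dense by blast
    then show "x \<in> (\<Union>q::rat. {x. of_rat q < T1 x} \<inter> {x. c - of_rat q < T2 x})"
      by (intro UN_I[of q]) auto
  qed auto
  then show ?thesis using assms by (auto intro!: open_UN open_Int)
qed

text \<open>Adding the exceptional set of a quasicontinuous function to its superlevel set produces
  an open set; this is how sets of small capacity are enlarged to open ones.\<close>

lemma open_Un_superlevel:
  fixes v :: "'a::topological_space \<Rightarrow> real"
  assumes "open G" "continuous_on (- G) v"
  shows "open (G \<union> {x. t < v x})"
proof -
  obtain A where A: "open A" "A \<inter> - G = v -` {t<..} \<inter> - G"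
    using assms(2) open_greaterThan[of t] unfolding continuous_on_open_invariant by blast
  then have "G \<union> {x. t < v x} = G \<union> A" by auto
  then show ?thesis using assms(1) A(1) by auto
qed

text \<open>Completeness and doubling are replaced by the compactness of closed balls that they
  imply.\<close>

locale proper_newton =
  fixes M :: "'a::metric_space measure" and p :: real
  assumes p1: "1 \<le> p" and cbm: "complete_Borel_measure M"
    and fin_ball: "\<And>x r. emeasure M (ball x r) < \<infinity>"
    and proper: "\<And>(x::'a) r. compact (cball x r)"
begin

lemma p0: "0 < p" using p1 by simp

text \<open>\<open>T1\<close> and \<open>T2\<close> are the curve infima of \<open>f\<close> and of
  \<open>1 - f\<close>. Thus \<open>1 - T2 \<le> f \<le> T1\<close>, and the superlevel set in the
  last conclusion is where the two bounds differ by more than \<open>\<delta>\<close>.\<close>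

lemma semicontinuous_sandwich:
  fixes f :: "'a \<Rightarrow> real"
  assumes f: "f \<in> borel_measurable M" "\<And>x. 0 \<le> f x" "\<And>x. f x \<le> 1" "\<And>x. x \<notin> ball x0 R \<Longrightarrow> f x = 0"
    and ug: "upper_gradient UNIV (\<lambda>x. ereal (f x)) g"
    and g: "(\<integral>\<^sup>+x\<in>ball x0 R. epowr (g x) p \<partial>M) < \<infinity>"
    and \<delta>: "0 < \<delta>" and e: "0 < e"
  obtains T1 T2 :: "'a \<Rightarrow> real" where "\<And>a. open {x. a < T1 x}" "\<And>a. open {x. a < T2 x}"
    "\<And>x. f x \<le> T1 x" "\<And>x. 1 - f x \<le> T2 x" "capacity p M UNIV {x. 1 + \<delta> < T1 x + T2 x} \<le> ennreal e"
proof -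
  define B where "B = ball x0 R"
  obtain N where N: "sets N = sets borel" "M = completion N" "space N = UNIV"
    using complete_Borel_measureE[OF cbm] by metis
  have Nm: "\<phi> \<in> borel_measurable N" if "\<phi> \<in> borel_measurable borel" for \<phi> :: "'a \<Rightarrow> ennreal"
    using that N(1) by (simp cong: measurable_cong_sets)
  have B[simp]: "B \<in> sets N" "B \<in> sets borel" "open B" unfolding B_def using N(1) by auto
  have gm: "g \<in> borel_measurable borel" using ug by (simp add: upper_gradient_real)
  have iB: "indicator B \<in> borel_measurable borel" by simp
  have gp: "(\<lambda>x. epowr (g x) p) \<in> borel_measurable borel" using gm by measurable

  \<comment> \<open>Restricting to the ball makes the measure finite, and \<open>N\<close> instead
    of its completion \<open>M\<close> keeps it Borel; both are needed for regularity.\<close>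
  define Q0 where "Q0 = density N (indicator B)"
  have "emeasure N B < \<infinity>" using fin_ball[of x0 R] N(2) B(1) by (simp add: B_def)
  then have Q0: "finite_measure Q0" "sets Q0 = sets borel"
    unfolding Q0_def using N Nm[OF iB] by (auto intro!: finite_measureI simp: emeasure_density)
  have "(\<integral>\<^sup>+x. epowr (g x) p \<partial>Q0) = (\<integral>\<^sup>+x\<in>B. epowr (g x) p \<partial>N)"
    unfolding Q0_def using Nm[OF iB] Nm[OF gp] by (simp add: nn_integral_density mult.commute)
  also have "\<dots> < \<infinity>" using g unfolding N(2) nn_integral_completion B_def .
  finally obtain h where h: "\<And>a. open {x. a < h x}" "\<And>x. g x \<le> h x" "\<And>x. 1 \<le> h x"
    "(\<integral>\<^sup>+x. epowr (h x) p \<partial>Q0) < \<infinity>"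
    using lsc_majorant[OF Q0 p1 gm] by metis
  have hm: "h \<in> borel_measurable borel" using h(1) by (rule borel_measurable_lsc)
  have hp: "(\<lambda>x. epowr (h x) p) \<in> borel_measurable borel" using hm by measurable
  let ?H = "\<lambda>x. epowr (h x) p * indicator B x"
  have H: "?H \<in> borel_measurable N"
    by (intro Nm borel_measurable_times_ennreal hp iB)

  \<comment> \<open>Weighting by the p-th power of \<open>h\<close> turns smallness of the Lusin
    exceptional set into smallness of the energy of \<open>h\<close> on it.\<close>
  define Q1 where "Q1 = density N ?H"
  have "(\<integral>\<^sup>+x. epowr (h x) p \<partial>Q0) = (\<integral>\<^sup>+x. ?H x \<partial>N)"
    unfolding Q0_def using Nm[OF iB] Nm[OF hp] by (simp add: nn_integral_density mult.commute)
  moreover have "emeasure Q1 (space Q1) = (\<integral>\<^sup>+x. ?H x * indicator (space N) x \<partial>N)"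
    unfolding Q1_def space_density using H by (rule emeasure_density) simp
  ultimately have "emeasure Q1 (space Q1) \<noteq> \<infinity>"
    using h(4) N(3) by simp
  then have Q1: "finite_measure Q1" "sets Q1 = sets borel"
    using N(1) by (rule_tac finite_measureI, simp_all add: Q1_def)

  \<comment> \<open>Lusin's theorem applies to a Borel representative. The closed set will avoid the
    null set \<open>N0\<close>, so the continuity obtained is that of \<open>f\<close>
    itself.\<close>
  obtain f0 where f0: "f0 \<in> borel_measurable N" "AE x in N. f x = f0 x"
    using completion_ex_borel_measurable_real[of f N] f(1) N(2) by blast
  then obtain N0 where N0: "N0 \<in> null_sets N" "{x \<in> space N. f x \<noteq> f0 x} \<subseteq> N0"
    unfolding eventually_ae_filter by auto
  have f0m: "f0 \<in> borel_measurable borel" using f0(1) N(1) by (simp cong: measurable_cong_sets)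
  have N0b: "N0 \<in> sets borel" using N0(1) N(1) by auto

  \<comment> \<open>The two summands are the factors with which the function term and the gradient
    term of the capacity estimate will appear.\<close>
  define C where "C = (1 / \<delta>) powr p + (2 / \<delta>) powr p"
  have C: "0 < C" unfolding C_def using \<delta> by (intro add_pos_pos) auto
  obtain K where K: "closed K" "K \<subseteq> B - N0" "emeasure Q1 (B - N0 - K) < ennreal (e / C)" "continuous_on K f0"
  proof (rule lusin_closed[OF Q1 _ f0m])
    show "B - N0 \<in> sets borel" using N0b by auto
    show "0 < e / C" using C e by simp
  qed (rule that)
  have contK: "continuous_on K f"
    using K(4)
  proof (rule continuous_on_eq)
    fix x assume "x \<in> K"
    then have "x \<notin> N0" using K(2) by blast
    then show "f0 x = f x" using N0(2) N(3) by force
  qed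
  \<comment> \<open>Including the complement of the ball confines the gap to \<open>B - K\<close>.
    There \<open>f\<close> vanishes, and both pieces are closed, so continuity on them
    glues.\<close>
  define F where "F = K \<union> - B"
  have F: "closed F" "- F = B - K" unfolding F_def using closed_Un[OF K(1) closed_Compl[OF B(3)]] by auto
  have "continuous_on (- B) f"
    by (rule continuous_on_eq[OF continuous_on_const[of _ 0]]) (use f(4) in \<open>auto simp: B_def\<close>)
  then have contF: "continuous_on F f"
    unfolding F_def using contK by (intro continuous_on_closed_Un K(1) closed_Compl B(3))

  have small: "(\<integral>\<^sup>+x. epowr (h x) p * indicator (- F) x \<partial>M) \<le> ennreal (e / C)"
  proof -
    have sF: "- F \<in> sets N" using F(1) N(1) by auto
    have "(\<integral>\<^sup>+x. epowr (h x) p * indicator (- F) x \<partial>M) = (\<integral>\<^sup>+x. ?H x * indicator (- F) x \<partial>N)"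
      unfolding N(2) nn_integral_completion F(2) by (intro nn_integral_cong) (auto simp: indicator_def)
    also have "\<dots> = emeasure Q1 (- F)"
      unfolding Q1_def using H sF by (rule emeasure_density[symmetric])
    also have "\<dots> \<le> emeasure Q1 ((B - N0 - K) \<union> N0)"
      unfolding F(2) using N0b K(1) Q1(2) by (intro emeasure_mono) auto
    also have "\<dots> \<le> emeasure Q1 (B - N0 - K) + emeasure Q1 N0"
      using N0b K(1) Q1(2) by (intro emeasure_subadditive) auto
    also have "emeasure Q1 N0 = 0"
    proof -
      have "N0 \<in> null_sets Q1"
        unfolding Q1_def null_sets_density_iff[OF H] using N0(1) AE_not_in[OF N0(1)] by auto
      then show ?thesis by auto
    qed
    finally show ?thesis using K(3) by simp
  qed

  let ?T = "\<lambda>f x. enn2real (curve_inf f F h x)"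
  have T: "ennreal (?T f' x) = curve_inf f' F h x" for f' x
    using curve_inf_le_1[of f' F h x] by (intro ennreal_enn2real) (auto intro: order.strict_trans1)
  have T01: "0 \<le> ?T f' x" "?T f' x \<le> 1" for f' x
  proof -
    have "ennreal (?T f' x) \<le> ennreal 1" unfolding T using curve_inf_le_1 by simp
    then show "?T f' x \<le> 1" by (subst (asm) ennreal_le_iff) auto
  qed simp
  have lsc: "open {x. a < ?T f' x}" if "continuous_on F f'" "\<And>x. 0 \<le> f' x" for a f'
  proof (cases "a < 0")
    case True
    then have "{x. a < ?T f' x} = UNIV" using T01(1) by (auto intro: less_le_trans)
    then show ?thesis by simp
  next
    case False
    have "a < ?T f' x \<longleftrightarrow> \<not> curve_inf f' F h x \<le> ennreal a" for x
    proof -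
      have "curve_inf f' F h x \<le> ennreal a \<longleftrightarrow> ennreal (?T f' x) \<le> ennreal a" by (simp only: T)
      also have "\<dots> \<longleftrightarrow> ?T f' x \<le> a" using False by (intro ennreal_le_iff) simp
      finally show ?thesis by auto
    qed
    then have "{x. a < ?T f' x} = - {x. curve_inf f' F h x \<le> ennreal a}" by auto
    then show ?thesis
      using curve_inf_lsc[OF proper h(1,3) F(1) that] by (simp only: open_Compl)
  qed
  have ugh: "upper_gradient UNIV (\<lambda>x. ereal (f x)) h"
    using ug h(2) hm by (rule upper_gradient_mono)
  have ugh': "upper_gradient UNIV (\<lambda>x. ereal (1 - f x)) h"
    using ugh by (simp add: upper_gradient_real abs_minus_commute)
  have geT: "f' x \<le> ?T f' x" if "upper_gradient UNIV (\<lambda>x. ereal (f' x)) h" "\<And>x. 0 \<le> f' x" "\<And>x. f' x \<le> 1" for f' x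
  proof -
    have "ennreal (f' x) \<le> ennreal (?T f' x)" unfolding T using that by (rule curve_inf_ge)
    then show ?thesis using T01(1)[of f' x] by (subst (asm) ennreal_le_iff) auto
  qed
  have leT: "?T f' x \<le> f' x" if "x \<in> F" "0 \<le> f' x" for f' x
  proof -
    have "ennreal (?T f' x) \<le> ennreal (f' x)" unfolding T using that(1) by (rule curve_inf_le_boundary)
    then show ?thesis using that(2) by (subst (asm) ennreal_le_iff) auto
  qed
  let ?T1 = "?T f" and ?T2 = "?T (\<lambda>x. 1 - f x)"
  have T1: "f x \<le> ?T1 x" for x using ugh f(2,3) by (rule geT)
  have T2: "1 - f x \<le> ?T2 x" for x using ugh' f(2,3) by (intro geT) auto
  \<comment> \<open>The gap between the upper bound \<open>?T1\<close> and the lower bound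
    \<open>1 - ?T2\<close>.\<close>
  define D where "D x = ?T1 x + ?T2 x - 1" for x
  have D0: "0 \<le> D x" for x using T1[of x] T2[of x] by (simp add: D_def)
  have D1: "D x \<le> 1" for x using T01(2)[of f x] T01(2)[of "\<lambda>x. 1 - f x" x] by (simp add: D_def)
  have DF: "D x = 0" if "x \<in> F" for x
    using D0[of x] leT[OF that, of f] leT[OF that, of "\<lambda>x. 1 - f x"] f(2,3)[of x] by (simp add: D_def)
  have o1: "open {x. a < ?T1 x}" for a using contF f(2) by (rule lsc)
  have o2: "open {x. a < ?T2 x}" for a
    using contF f(3) by (intro lsc) (auto intro!: continuous_intros)
  have Dm: "D \<in> borel_measurable M"
  proof (rule complete_Borel_measurable[OF cbm])
    have "?T1 \<in> borel_measurable borel" "?T2 \<in> borel_measurable borel"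
      using o1 o2 by (auto intro!: borel_measurableI_greater)
    then show "D \<in> borel_measurable borel" unfolding D_def by measurable
  qed
  have ugD: "upper_gradient UNIV (\<lambda>x. ereal (D x)) (\<lambda>x. 2 * h x)"
    unfolding upper_gradient_real
  proof (intro conjI allI impI)
    show "(\<lambda>x. 2 * h x) \<in> borel_measurable borel" using hm by measurable
    fix l :: real and \<gamma> :: "real \<Rightarrow> 'a" assume arc: "arc_length_curve UNIV l \<gamma>"
    let ?I = "\<integral>\<^sup>+t\<in>{0..l}. h (\<gamma> t) \<partial>lborel"
    have *: "ennreal \<bar>?T f' (\<gamma> 0) - ?T f' (\<gamma> l)\<bar> \<le> ?I" for f'
      by (rule ennreal_abs_diff_le) (use curve_inf_arc[OF hm arc, of f' F] in \<open>simp_all add: T\<close>)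
    have "ennreal \<bar>D (\<gamma> 0) - D (\<gamma> l)\<bar> \<le> ennreal (\<bar>?T1 (\<gamma> 0) - ?T1 (\<gamma> l)\<bar> + \<bar>?T2 (\<gamma> 0) - ?T2 (\<gamma> l)\<bar>)"
      by (intro ennreal_leI) (simp add: D_def)
    also have "\<dots> \<le> ?I + ?I" using *[of f] *[of "\<lambda>x. 1 - f x"] by (simp add: add_mono)
    also have "\<dots> = 2 * ?I" by (simp add: mult_2)
    also have "\<dots> = (\<integral>\<^sup>+t. 2 * (h (\<gamma> t) * indicator {0..l} t) \<partial>lborel)"
      using arc_integrand_measurable[OF hm arc, of 0 l] by (intro nn_integral_cmult[symmetric]) simp
    also have "\<dots> = (\<integral>\<^sup>+t\<in>{0..l}. 2 * h (\<gamma> t) \<partial>lborel)" by (simp add: mult.assoc)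
    finally show "ennreal \<bar>D (\<gamma> 0) - D (\<gamma> l)\<bar> \<le> (\<integral>\<^sup>+t\<in>{0..l}. 2 * h (\<gamma> t) \<partial>lborel)" .
  qed
  \<comment> \<open>Dividing the gap by \<open>\<delta>\<close> gives a test function for its
    superlevel set. As the gap vanishes on the closed set \<open>F\<close>, its gradient may be cut
    off there.\<close>
  let ?k = "\<lambda>x. ennreal (1 / \<delta>) * (2 * h x * indicator (- F) x)"
  have ugk: "upper_gradient UNIV (\<lambda>x. ereal (1 / \<delta> * D x)) ?k"
    using \<delta> by (intro upper_gradient_scale upper_gradient_cut[OF ugD D0 F(1) DF]) auto
  have "capacity p M UNIV {x. 1 + \<delta> < ?T1 x + ?T2 x} \<le>
     (\<integral>\<^sup>+x. epowr (ennreal (1 / \<delta> * D x)) p \<partial>M) + (\<integral>\<^sup>+x. epowr (?k x) p \<partial>M)"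
  proof (rule capacity_le_real[OF p0 cbm _ _ _ ugk])
    show "(\<lambda>x. 1 / \<delta> * D x) \<in> borel_measurable M" using Dm by measurable
    show "0 \<le> 1 / \<delta> * D x" for x using \<delta> D0 by simp
    show "1 \<le> 1 / \<delta> * D x" if "x \<in> {x. 1 + \<delta> < ?T1 x + ?T2 x}" for x
      using that \<delta> by (simp add: D_def field_simps)
  qed
  also have "\<dots> \<le> ennreal ((1 / \<delta>) powr p) * ennreal (e / C) + ennreal ((2 / \<delta>) powr p) * ennreal (e / C)"
  proof (rule add_mono)
    have hF: "(\<lambda>x. epowr (h x) p * indicator (- F) x) \<in> borel_measurable M"
      using hp F(1) by (intro complete_Borel_measurable[OF cbm] borel_measurable_times_ennreal borel_measurable_indicator) auto
    have bound: "(\<integral>\<^sup>+x. \<phi> x \<partial>M) \<le> ennreal c * ennreal (e / C)"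
      if "\<And>x. \<phi> x \<le> ennreal c * (epowr (h x) p * indicator (- F) x)" for \<phi> c
    proof -
      have "(\<integral>\<^sup>+x. \<phi> x \<partial>M) \<le> (\<integral>\<^sup>+x. ennreal c * (epowr (h x) p * indicator (- F) x) \<partial>M)"
        using that by (intro nn_integral_mono)
      also have "\<dots> = ennreal c * (\<integral>\<^sup>+x. epowr (h x) p * indicator (- F) x \<partial>M)"
        using hF by (rule nn_integral_cmult)
      also have "\<dots> \<le> ennreal c * ennreal (e / C)" using small by (rule mult_left_mono) simp
      finally show ?thesis .
    qed
    show "(\<integral>\<^sup>+x. epowr (ennreal (1 / \<delta> * D x)) p \<partial>M) \<le> ennreal ((1 / \<delta>) powr p) * ennreal (e / C)"
    proof (rule bound)
      fix x
      show "epowr (ennreal (1 / \<delta> * D x)) p \<le> ennreal ((1 / \<delta>) powr p) * (epowr (h x) p * indicator (- F) x)"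
      proof (cases "x \<in> F")
        case False
        \<comment> \<open>Here \<open>D x \<le> 1 \<le> h x\<close> bounds the function by the
          gradient weight, so its p-th power is again controlled by \<open>small\<close>.\<close>
        have "ennreal (1 / \<delta> * D x) \<le> ennreal (1 / \<delta>)"
          using D1[of x] \<delta> by (intro ennreal_leI) (simp add: divide_right_mono)
        also have "\<dots> \<le> ennreal (1 / \<delta>) * h x"
          using h(3)[of x] mult_left_mono[of 1 "h x" "ennreal (1 / \<delta>)"] by simp
        finally have "epowr (ennreal (1 / \<delta> * D x)) p \<le> epowr (ennreal (1 / \<delta>) * h x) p"
          using p0 by (intro epowr_mono) auto
        also have "\<dots> = ennreal ((1 / \<delta>) powr p) * epowr (h x) p"
          using \<delta> by (intro epowr_cmult) simp
        finally show ?thesis using False by simp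
      qed (simp add: DF)
    qed
    show "(\<integral>\<^sup>+x. epowr (?k x) p \<partial>M) \<le> ennreal ((2 / \<delta>) powr p) * ennreal (e / C)"
    proof (rule bound)
      fix x
      show "epowr (?k x) p \<le> ennreal ((2 / \<delta>) powr p) * (epowr (h x) p * indicator (- F) x)"
      proof (cases "x \<in> F")
        case False
        have "?k x = ennreal (2 / \<delta>) * h x"
          using False \<delta> ennreal_mult[of "1 / \<delta>" 2] by (simp add: mult.assoc[symmetric])
        then have "epowr (?k x) p = ennreal ((2 / \<delta>) powr p) * epowr (h x) p"
          using \<delta> by (simp only:) (intro epowr_cmult, simp)
        then show ?thesis using False by simp
      qed simp
    qed
  qed
  also have "\<dots> = ennreal (C * (e / C))"
    using C e by (simp add: C_def ennreal_plus[symmetric] ennreal_mult[symmetric] distrib_right add_divide_distrib del: ennreal_plus)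
  also have "C * (e / C) = e" using C by simp
  finally have "capacity p M UNIV {x. 1 + \<delta> < ?T1 x + ?T2 x} \<le> ennreal e" .
  then show ?thesis using that[of ?T1 ?T2] o1 o2 T1 T2 by blast
qed

text \<open>\<open>G\<close> collects the open sets where the \<open>n\<close>-th gap exceeds
  \<open>\<delta> n\<close>. Off \<open>G\<close> both \<open>T1 n - \<delta> n \<le> f\<close> and
  \<open>1 + \<delta> n - T2 n \<ge> f\<close> hold up to the next comparison with \<open>f\<close>,
  with errors tending to 0; the superlevel sets of \<open>T1 n\<close> and \<open>T2 n\<close> then
  serve as neighbourhoods for the two halves of continuity.\<close>

lemma bounded_quasicontinuous:
  fixes f :: "'a \<Rightarrow> real"
  assumes f: "f \<in> borel_measurable M" "\<And>x. 0 \<le> f x" "\<And>x. f x \<le> 1" "\<And>x. x \<notin> ball x0 R \<Longrightarrow> f x = 0"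
    and ug: "upper_gradient UNIV (\<lambda>x. ereal (f x)) g"
    and g: "(\<integral>\<^sup>+x\<in>ball x0 R. epowr (g x) p \<partial>M) < \<infinity>"
    and e: "0 < e"
  obtains G where "open G" "capacity p M UNIV G < ennreal e" "continuous_on (- G) f"
proof -
  define \<delta> :: "nat \<Rightarrow> real" where "\<delta> n = (1/2) ^ n" for n
  define good where "good n T1 T2 \<longleftrightarrow> (\<forall>a. open {x. a < T1 x}) \<and> (\<forall>a. open {x. a < T2 x}) \<and>
    (\<forall>x. f x \<le> T1 x) \<and> (\<forall>x. 1 - f x \<le> T2 x) \<and>
    capacity p M UNIV {x. 1 + \<delta> n < T1 x + T2 x} \<le> ennreal (e / 2 * (1/2) ^ Suc n)" for n and T1 T2 :: "'a \<Rightarrow> real"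
  have "\<exists>T1 T2. good n T1 T2" for n
  proof -
    have "0 < \<delta> n" "0 < e / 2 * (1/2) ^ Suc n" using e by (auto simp: \<delta>_def)
    from semicontinuous_sandwich[OF f ug g this]
    obtain T1 T2 :: "'a \<Rightarrow> real" where "\<And>a. open {x. a < T1 x}" "\<And>a. open {x. a < T2 x}"
      "\<And>x. f x \<le> T1 x" "\<And>x. 1 - f x \<le> T2 x"
      "capacity p M UNIV {x. 1 + \<delta> n < T1 x + T2 x} \<le> ennreal (e / 2 * (1/2) ^ Suc n)" by blast
    then have "good n T1 T2" unfolding good_def by (intro conjI allI)
    then show ?thesis by blast
  qed
  then obtain T1 T2 where "\<And>n. good n (T1 n) (T2 n)" by metis
  then have T: "\<And>n a. open {x. a < T1 n x}" "\<And>n a. open {x. a < T2 n x}" "\<And>n x. f x \<le> T1 n x" "\<And>n x. 1 - f x \<le> T2 n x"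
    "\<And>n. capacity p M UNIV {x. 1 + \<delta> n < T1 n x + T2 n x} \<le> ennreal (e / 2 * (1/2) ^ Suc n)"
    unfolding good_def by simp_all
  define G where "G = (\<Union>n. {x. 1 + \<delta> n < T1 n x + T2 n x})"
  have oG: "open G" unfolding G_def using T(1,2) by (intro open_UN ballI open_sum_superlevel)
  have "capacity p M UNIV G \<le> (\<Sum>n. capacity p M UNIV {x. 1 + \<delta> n < T1 n x + T2 n x})"
    unfolding G_def by (rule capacity_UN[OF p0 cbm])
  also have "\<dots> \<le> (\<Sum>n. ennreal (e / 2 * (1/2) ^ Suc n))"
    using T(5) by (intro suminf_le summableI)
  also have "\<dots> = ennreal (e / 2)" using e by (intro suminf_half_ennreal) simp
  also have "\<dots> < ennreal e" using e by (simp add: ennreal_less_iff)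
  finally have cap: "capacity p M UNIV G < ennreal e" .
  have lim\<delta>: "\<delta> \<longlonglongrightarrow> 0" unfolding \<delta>_def by (rule LIMSEQ_power_zero) simp
  have small: "\<exists>n. \<delta> n < r" if "0 < r" for r
    using order_tendstoD(2)[OF lim\<delta> that] eventually_happens trivial_limit_sequentially by blast
  have GD: "T1 n x + T2 n x \<le> 1 + \<delta> n" if "x \<in> - G" for n x using that by (auto simp: G_def not_less)
  have "continuous_on (- G) f"
    unfolding continuous_on_def
  proof
    fix x assume x: "x \<in> - G"
    show "(f \<longlongrightarrow> f x) (at x within - G)"
    proof (rule order_tendstoI)
      fix a assume "a < f x"
      then obtain n where n: "\<delta> n < f x - a" using small[of "f x - a"] by auto
      have "a < f y" if "y \<in> {y. a + \<delta> n < T1 n y}" "y \<in> - G" for y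
        using that GD[of y n] T(4)[of y n] by auto
      moreover have "x \<in> {y. a + \<delta> n < T1 n y}" using n T(3)[of x n] by auto
      ultimately show "\<forall>\<^sub>F y in at x within - G. a < f y"
        unfolding eventually_at_topological using T(1)[of "a + \<delta> n" n] by blast
    next
      fix b assume "f x < b"
      then obtain n where n: "\<delta> n < b - f x" using small[of "b - f x"] by auto
      have "f y < b" if "y \<in> {y. 1 + \<delta> n - b < T2 n y}" "y \<in> - G" for y
        using that GD[of y n] T(3)[of y n] by auto
      moreover have "x \<in> {y. 1 + \<delta> n - b < T2 n y}" using n T(4)[of x n] by auto
      ultimately show "\<forall>\<^sub>F y in at x within - G. f y < b"
        unfolding eventually_at_topological using T(2)[of "1 + \<delta> n - b" n] by blast
    qed
  qed
  then show ?thesis using that oG cap by blast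
qed

text \<open>The gradient of \<open>v\<close> can be concentrated on a Borel null set, up to an
  arbitrarily small multiple of \<open>g\<close>, so the superlevel set has small capacity.
  Quasicontinuity of \<open>v\<close> then encloses it in an open set.\<close>

lemma null_superlevel_small_capacity:
  fixes v :: "'a \<Rightarrow> real"
  assumes v: "v \<in> borel_measurable M" "\<And>x. 0 \<le> v x" "\<And>x. v x \<le> 1" "\<And>x. x \<notin> ball x0 R \<Longrightarrow> v x = 0"
    and ug: "upper_gradient UNIV (\<lambda>x. ereal (v x)) g" and g: "(\<integral>\<^sup>+x. epowr (g x) p \<partial>M) < \<infinity>"
    and null: "AE x in M. v x = 0" and t: "0 < t" and e: "0 < e"
  obtains G where "open G" "{x. t < v x} \<subseteq> G" "capacity p M UNIV G < ennreal e"
proof -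
  obtain N where N: "sets N = sets borel" "M = completion N" "space N = UNIV"
    using complete_Borel_measureE[OF cbm] by metis
  have "AE x in N. v x = 0" using null unfolding N(2) AE_completion_iff .
  then obtain N0 where N0: "N0 \<in> null_sets N" "{x \<in> space N. v x \<noteq> 0} \<subseteq> N0"
    unfolding eventually_ae_filter by auto
  have N0b: "N0 \<in> sets borel" using N0(1) N(1) by auto
  have AE0: "AE x in M. x \<notin> N0" unfolding N(2) AE_completion_iff using N0(1) by (rule AE_not_in)
  obtain j where j: "(\<integral>\<^sup>+x. epowr (g x) p \<partial>M) = ennreal j" "0 \<le> j"
    using g by (cases "\<integral>\<^sup>+x. epowr (g x) p \<partial>M") auto
  \<comment> \<open>With this \<open>\<eta>\<close> the gradient term is
    \<open>(e / 2) * (j / (j + 1))\<close>, strictly below \<open>e / 2\<close>; adding 1 to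
    \<open>j\<close> also avoids division by zero.\<close>
  define \<eta> where "\<eta> = (e / (2 * (j + 1))) powr (1 / p)"
  have \<eta>: "0 < \<eta>" "\<eta> powr p = e / (2 * (j + 1))"
    using e j p0 by (auto simp: \<eta>_def powr_powr)
  have gm: "g \<in> borel_measurable borel" using ug by (simp add: upper_gradient_real)
  have gpM: "(\<lambda>x. epowr (g x) p) \<in> borel_measurable M"
    using complete_Borel_measurable[OF cbm gm] by measurable
  \<comment> \<open>The multiple is \<open>t * \<eta>\<close> so that the scaling by
    \<open>1 / t\<close> leaves exactly \<open>\<eta>\<close> off \<open>N0\<close>.\<close>
  let ?k = "\<lambda>x. ennreal (1 / t) * (g x * indicator N0 x + ennreal (t * \<eta>) * g x)"
  have ugk: "upper_gradient UNIV (\<lambda>x. ereal (1 / t * v x)) ?k"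
    using t \<eta> N0(2) N(3) by (intro upper_gradient_scale upper_gradient_concentrate[OF ug v(2) N0b]) auto
  have "capacity p M UNIV {x. t < v x} \<le> (\<integral>\<^sup>+x. epowr (ennreal (1 / t * v x)) p \<partial>M) + (\<integral>\<^sup>+x. epowr (?k x) p \<partial>M)"
  proof (rule capacity_le_real[OF p0 cbm _ _ _ ugk])
    show "(\<lambda>x. 1 / t * v x) \<in> borel_measurable M" using v(1) by measurable
  qed (use t v in \<open>auto simp: field_simps\<close>)
  also have "(\<integral>\<^sup>+x. epowr (ennreal (1 / t * v x)) p \<partial>M) = (\<integral>\<^sup>+x. 0 \<partial>M)"
    by (rule nn_integral_cong_AE) (use null in eventually_elim, simp)
  also have "(\<integral>\<^sup>+x. epowr (?k x) p \<partial>M) = (\<integral>\<^sup>+x. ennreal (\<eta> powr p) * epowr (g x) p \<partial>M)"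
  proof (rule nn_integral_cong_AE)
    show "AE x in M. epowr (?k x) p = ennreal (\<eta> powr p) * epowr (g x) p"
      using AE0
    proof eventually_elim
      case (elim x)
      have "?k x = ennreal \<eta> * g x"
        using elim t \<eta> ennreal_mult[of "1 / t" "t * \<eta>"] by (simp add: mult.assoc[symmetric])
      then show ?case using \<eta>(1) by (simp only: epowr_cmult)
    qed
  qed
  also have "\<dots> = ennreal (\<eta> powr p) * ennreal j"
    unfolding j(1)[symmetric] using gpM by (rule nn_integral_cmult)
  also have "(\<integral>\<^sup>+x. 0 \<partial>M) + ennreal (\<eta> powr p) * ennreal j = ennreal (\<eta> powr p * j)"
    using j(2) by (simp add: ennreal_mult)
  also have "\<eta> powr p * j = e / (2 * (j + 1)) * j" by (simp only: \<eta>(2))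
  also have "ennreal \<dots> < ennreal (e / 2)"
    using e j(2) by (intro ennreal_lessI) (auto simp: field_simps)
  finally have cap: "capacity p M UNIV {x. t < v x} < ennreal (e / 2)" .
  have "(\<integral>\<^sup>+x\<in>ball x0 R. epowr (g x) p \<partial>M) \<le> (\<integral>\<^sup>+x. epowr (g x) p \<partial>M)"
    by (intro nn_integral_mono) (auto simp: indicator_def)
  then have g': "(\<integral>\<^sup>+x\<in>ball x0 R. epowr (g x) p \<partial>M) < \<infinity>" using g by (rule order.strict_trans1)
  obtain G where G: "open G" "capacity p M UNIV G < ennreal (e / 2)" "continuous_on (- G) v"
    by (rule bounded_quasicontinuous[OF v ug g' half_gt_zero[OF e]])
  have "capacity p M UNIV (G \<union> {x. t < v x}) \<le> capacity p M UNIV G + capacity p M UNIV {x. t < v x}"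
    by (rule capacity_Un[OF p0 cbm])
  also have "\<dots> < ennreal (e / 2) + ennreal (e / 2)"
    using G(2) cap by (rule add_strict_mono)
  also have "\<dots> = ennreal e" using e by (simp flip: ennreal_plus)
  finally show ?thesis using that[of "G \<union> {x. t < v x}"] open_Un_superlevel[OF G(1,3)] by auto
qed

end

subsection \<open>Properness\<close>

lemma doubling_iterate:
  assumes "\<And>(x::'a::metric_space) r. 0 < r \<Longrightarrow> emeasure M (ball x (2 * r)) \<le> ennreal C * emeasure M (ball x r)" "0 \<le> C" "0 < r"
  shows "emeasure M (ball x (2 ^ k * r)) \<le> ennreal (C ^ k) * emeasure M (ball x r)"
proof (induction k)
  case (Suc k)
  have "emeasure M (ball x (2 ^ Suc k * r)) \<le> ennreal C * emeasure M (ball x (2 ^ k * r))"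
    using assms(1)[of "2 ^ k * r" x] assms(3) by (simp add: mult.assoc)
  also have "\<dots> \<le> ennreal C * (ennreal (C ^ k) * emeasure M (ball x r))"
    using Suc by (rule mult_left_mono) simp
  finally show ?case using assms(2) by (simp add: ennreal_mult mult.assoc)
qed simp

text \<open>The balls of radius \<open>e / 2\<close> about the points of \<open>P\<close> are
  disjoint and lie in \<open>ball x (r + e)\<close>. Enlarging the radius of any of them by
  \<open>2 ^ k\<close> covers that ball, so each holds at least the fraction
  \<open>1 / C ^ k\<close> of its measure, which is positive and finite.\<close>

lemma doubling_separated_card:
  fixes M :: "'a::metric_space measure" and x :: 'a
  assumes cbm: "complete_Borel_measure M"
    and dbl: "\<And>(x::'a) r. 0 < r \<Longrightarrow> emeasure M (ball x (2 * r)) \<le> ennreal C * emeasure M (ball x r)"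
    and pos: "\<And>(x::'a) r. 0 < r \<Longrightarrow> 0 < emeasure M (ball x (2 * r))" and C: "0 \<le> C"
    and fin: "\<And>(x::'a) r. emeasure M (ball x r) < \<infinity>"
    and P: "finite P" "P \<subseteq> cball x r" "\<And>y z. y \<in> P \<Longrightarrow> z \<in> P \<Longrightarrow> y \<noteq> z \<Longrightarrow> e \<le> dist y z"
    and e: "0 < e" and r: "0 \<le> r" and k: "2 * r + e \<le> 2 ^ k * (e / 2)"
  shows "real (card P) \<le> C ^ k"
proof -
  have bm: "ball y s \<in> sets M" for y :: 'a and s
    using complete_Borel_measureE[OF cbm] by (metis borel_open open_ball subsetD)
  define m where "m = emeasure M (ball x (r + e))"
  have m: "0 < m" "m < top"
    using pos[of "(r + e) / 2" x, unfolded mult_2 field_sum_of_halves] fin[of x "r + e"] r e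
    by (simp_all add: m_def)
  have "of_nat (card P) * m = (\<Sum>y\<in>P. m)" by simp
  also have "\<dots> \<le> (\<Sum>y\<in>P. ennreal (C ^ k) * emeasure M (ball y (e / 2)))"
  proof (rule sum_mono)
    fix y assume "y \<in> P"
    then have xy: "dist x y \<le> r" using P(2) by auto
    have "ball x (r + e) \<subseteq> ball y (2 ^ k * (e / 2))"
    proof
      fix z assume "z \<in> ball x (r + e)"
      then have "dist y z < r + (r + e)"
        using xy dist_triangle[of y z x] by (simp add: dist_commute)
      then show "z \<in> ball y (2 ^ k * (e / 2))" using k by simp
    qed
    then have "m \<le> emeasure M (ball y (2 ^ k * (e / 2)))"
      unfolding m_def by (intro emeasure_mono bm)
    also have "\<dots> \<le> ennreal (C ^ k) * emeasure M (ball y (e / 2))"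
      using e by (intro doubling_iterate dbl C) auto
    finally show "m \<le> ennreal (C ^ k) * emeasure M (ball y (e / 2))" .
  qed
  also have "\<dots> = ennreal (C ^ k) * emeasure M (\<Union>y\<in>P. ball y (e / 2))"
  proof -
    have "disjoint_family_on (\<lambda>y. ball y (e / 2)) P"
      unfolding disjoint_family_on_def
    proof (intro ballI impI)
      fix y z assume "y \<in> P" "z \<in> P" "y \<noteq> z"
      then have "e \<le> dist y z" by (rule P(3))
      then show "ball y (e / 2) \<inter> ball z (e / 2) = {}"
        using dist_triangle_half_l[of y _ e z] by (fastforce simp: dist_commute)
    qed
    then show ?thesis
      using P(1) bm by (subst sum_distrib_left[symmetric], subst sum_emeasure) auto
  qed
  also have "\<dots> \<le> ennreal (C ^ k) * m"
  proof (rule mult_left_mono)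
    have "ball y (e / 2) \<subseteq> ball x (r + e)" if "y \<in> P" for y
    proof
      fix z assume "z \<in> ball y (e / 2)"
      moreover have "dist x y \<le> r" using P(2) that by auto
      ultimately show "z \<in> ball x (r + e)" using dist_triangle[of x z y] e by simp
    qed
    then show "emeasure M (\<Union>y\<in>P. ball y (e / 2)) \<le> m"
      unfolding m_def by (intro emeasure_mono bm) auto
  qed simp
  finally have le: "of_nat (card P) * m \<le> ennreal (C ^ k) * m" .
  obtain m' where m': "m = ennreal m'" "0 < m'"
    using m by (cases m) auto
  then have "ennreal (real (card P) * m') \<le> ennreal (C ^ k * m')"
    using le C by (simp add: ennreal_mult ennreal_of_nat_eq_real_of_nat)
  then have "real (card P) * m' \<le> C ^ k * m'"
    using C m' by (subst (asm) ennreal_le_iff) auto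
  then show ?thesis using m'(2) by simp
qed

text \<open>Separated subsets of the ball have bounded cardinality, and one of maximal cardinality
  is a finite net; complete and totally bounded sets are compact.\<close>

lemma doubling_imp_proper:
  fixes M :: "'a::metric_space measure" and x :: 'a
  assumes cbm: "complete_Borel_measure M" and "doubling M" and compl: "complete (UNIV :: 'a set)"
    and fin: "\<forall>(x::'a) r. emeasure M (ball x r) < \<infinity>"
  shows "compact (cball x r)"
proof (cases "r < 0")
  case False
  then have r: "0 \<le> r" by simp
  obtain C where C: "0 < C" and dbl: "\<And>(x::'a) r. 0 < r \<Longrightarrow> emeasure M (ball x (2 * r)) \<le> ennreal C * emeasure M (ball x r)"
    and pos: "\<And>(x::'a) r. 0 < r \<Longrightarrow> 0 < emeasure M (ball x (2 * r))"
    using assms(2) unfolding doubling_def by blast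
  have "complete (cball x r)"
    using complete_Int_closed[OF compl, of "cball x r"] by simp
  moreover have "\<exists>k. finite k \<and> cball x r \<subseteq> (\<Union>y\<in>k. ball y e)" if e: "0 < e" for e
  proof -
    obtain k where k: "2 * (2 * r + e) / e < 2 ^ k" using real_arch_pow[of 2 "2 * (2 * r + e) / e"] by auto
    then have k: "2 * r + e \<le> 2 ^ k * (e / 2)" using e by (simp add: field_simps)
    define sep where "sep P \<longleftrightarrow> finite P \<and> P \<subseteq> cball x r \<and> (\<forall>y\<in>P. \<forall>z\<in>P. y \<noteq> z \<longrightarrow> e \<le> dist y z)" for P
    have "sep {}" by (simp add: sep_def)
    moreover have "\<forall>P. sep P \<longrightarrow> card P < Suc (nat \<lfloor>C ^ k\<rfloor>)"
    proof (intro allI impI)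
      fix P assume "sep P"
      then have "real (card P) \<le> C ^ k"
        unfolding sep_def using C fin by (intro doubling_separated_card[OF cbm dbl pos _ _ _ _ _ e r k]) auto
      then show "card P < Suc (nat \<lfloor>C ^ k\<rfloor>)" by (simp add: le_nat_floor less_Suc_eq_le)
    qed
    ultimately obtain P where P: "sep P" "\<And>P'. sep P' \<Longrightarrow> card P' \<le> card P"
      using ex_has_greatest_nat[of sep "{}" card "Suc (nat \<lfloor>C ^ k\<rfloor>)"] by auto
    have "z \<in> (\<Union>y\<in>P. ball y e)" if z: "z \<in> cball x r" for z
    proof (rule ccontr)
      assume nz: "z \<notin> (\<Union>y\<in>P. ball y e)"
      then have far: "e \<le> dist y z" if "y \<in> P" for y using that by auto
      then have "z \<notin> P" using e by force
      moreover have "sep (insert z P)"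
        using P(1) z far unfolding sep_def by (auto simp: dist_commute)
      ultimately show False using P(2)[of "insert z P"] P(1) by (simp add: sep_def)
    qed
    then show ?thesis using P(1) by (auto simp: sep_def)
  qed
  ultimately show ?thesis unfolding compact_eq_totally_bounded by blast
qed simp

text \<open>In a proper space every open set is a countable union of compact sets, each of which
  needs finitely many of the balls.\<close>

lemma (in proper_newton) countable_ball_cover:
  fixes U :: "'a set" and r :: "'a \<Rightarrow> real"
  assumes r: "\<And>x. x \<in> U \<Longrightarrow> 0 < r x"
  obtains C where "countable C" "C \<subseteq> U" "U \<subseteq> (\<Union>x\<in>C. ball x (r x))"
proof -
  fix a :: 'a
  define V where "V = (\<Union>x\<in>U. ball x (r x))"
  have oV: "open V" by (auto simp: V_def)
  \<comment> \<open>Points of bounded distance from \<open>a\<close> that keep distance at least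
    \<open>1 / Suc n\<close> from the complement of \<open>V\<close>.\<close>
  define K where "K n = cball a (real n) - (\<Union>y\<in>- V. ball y (1 / real (Suc n)))" for n
  have cK: "compact (K n)" for n unfolding K_def by (intro compact_diff proper) auto
  have KV: "K n \<subseteq> V" for n
  proof
    fix x assume x: "x \<in> K n"
    show "x \<in> V"
    proof (rule ccontr)
      assume "x \<notin> V"
      then have "x \<in> (\<Union>y\<in>- V. ball y (1 / real (Suc n)))" by (intro UN_I[of x]) auto
      then show False using x by (simp add: K_def)
    qed
  qed
  have VK: "V \<subseteq> (\<Union>n. K n)"
  proof
    fix x assume "x \<in> V"
    then obtain d where d: "0 < d" "ball x d \<subseteq> V" using oV open_contains_ball by blast
    obtain n1 where n1: "1 / real (Suc n1) < d" using nat_approx_posE[OF d(1)] by blast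
    obtain n2 where n2: "dist a x \<le> real n2" using real_arch_simple by blast
    let ?n = "max n1 n2"
    have "1 / real (Suc ?n) \<le> 1 / real (Suc n1)" by (intro divide_left_mono) auto
    then have lt: "1 / real (Suc ?n) < d" using n1 by linarith
    have "dist y x \<ge> 1 / real (Suc ?n)" if "y \<notin> V" for y
    proof (rule ccontr)
      assume "\<not> dist y x \<ge> 1 / real (Suc ?n)"
      then have "y \<in> ball x d" using lt by (simp add: dist_commute)
      then show False using d(2) that by blast
    qed
    then have "x \<notin> (\<Union>y\<in>- V. ball y (1 / real (Suc ?n)))" by (force simp: not_less)
    moreover have "x \<in> cball a (real ?n)" using n2 by auto
    ultimately show "x \<in> (\<Union>n. K n)" unfolding K_def by blast
  qed
  have ex: "\<forall>n. \<exists>D. D \<subseteq> U \<and> finite D \<and> K n \<subseteq> (\<Union>x\<in>D. ball x (r x))"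
  proof
    fix n
    have cover: "K n \<subseteq> (\<Union>x\<in>U. ball x (r x))" using KV by (simp add: V_def)
    obtain D where "D \<subseteq> U" "finite D" "K n \<subseteq> (\<Union>x\<in>D. ball x (r x))"
      by (rule compactE_image[OF cK[of n] open_ball cover]) (rule that)
    then show "\<exists>D. D \<subseteq> U \<and> finite D \<and> K n \<subseteq> (\<Union>x\<in>D. ball x (r x))"
      by (intro exI[of _ D] conjI)
  qed
  from choice[OF ex] obtain D where "\<forall>n. D n \<subseteq> U \<and> finite (D n) \<and> K n \<subseteq> (\<Union>x\<in>D n. ball x (r x))" ..
  then have D: "\<And>n. D n \<subseteq> U" "\<And>n. finite (D n)" "\<And>n. K n \<subseteq> (\<Union>x\<in>D n. ball x (r x))"
    by simp_all
  show ?thesis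
  proof (rule that[of "\<Union>n. D n"])
    show "countable (\<Union>n. D n)" using D(2) by (auto intro: countable_finite)
    show "(\<Union>n. D n) \<subseteq> U" using D(1) by auto
    show "U \<subseteq> (\<Union>x\<in>(\<Union>n. D n). ball x (r x))"
    proof
      fix y assume "y \<in> U"
      then have "y \<in> V" unfolding V_def using r by (intro UN_I[of y]) auto
      then obtain n where "y \<in> K n" using VK by blast
      then have "y \<in> (\<Union>x\<in>D n. ball x (r x))" by (rule subsetD[OF D(3)])
      then show "y \<in> (\<Union>x\<in>(\<Union>n. D n). ball x (r x))" by blast
    qed
  qed
qed

subsection \<open>Subspaces\<close>

text \<open>A smaller space has fewer curves to test.\<close>

lemma upper_gradient_subset:
  assumes "upper_gradient S u g" "T \<subseteq> S"
  shows "upper_gradient T u g"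
  unfolding upper_gradient_def
proof (intro conjI allI impI)
  show "g \<in> borel_measurable (restrict_space borel T)"
    using assms by (auto simp: upper_gradient_def intro: measurable_restrict_mono)
  fix l \<gamma> assume "arc_length_curve T l \<gamma>"
  then have "arc_length_curve S l \<gamma>" using assms(2) by (auto simp: arc_length_curve_def)
  then show "ext_diff (u (\<gamma> 0)) (u (\<gamma> l)) \<le> (\<integral>\<^sup>+t\<in>{0..l}. g (\<gamma> t) \<partial>lborel)"
    using assms(1) by (simp add: upper_gradient_def)
qed

lemma nn_integral_restrict_space_mono:
  assumes "T \<subseteq> S" "S \<in> sets M" "T \<in> sets M"
  shows "(\<integral>\<^sup>+x. \<phi> x \<partial>restrict_space M T) \<le> (\<integral>\<^sup>+x. \<phi> x \<partial>restrict_space M S)"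
  using assms by (subst (1 2) nn_integral_restrict_space) (auto intro!: nn_integral_mono simp: indicator_def)

lemma newton_norm_mono:
  assumes p: "0 < p" and TS: "T \<subseteq> S" "S \<in> sets M" "T \<in> sets M"
  shows "newton_norm p M T u \<le> newton_norm p M S u"
  unfolding newton_norm_def
proof (intro epowr_mono add_mono)
  show "(INF g\<in>{g. upper_gradient T u g}. \<integral>\<^sup>+x. epowr (g x) p \<partial>restrict_space M T)
     \<le> (INF g\<in>{g. upper_gradient S u g}. \<integral>\<^sup>+x. epowr (g x) p \<partial>restrict_space M S)"
  proof (rule INF_mono)
    fix g assume "g \<in> {g. upper_gradient S u g}"
    then have "upper_gradient T u g" using upper_gradient_subset TS(1) by blast
    then show "\<exists>g'\<in>{g. upper_gradient T u g}. (\<integral>\<^sup>+x. epowr (g' x) p \<partial>restrict_space M T) \<le> (\<integral>\<^sup>+x. epowr (g x) p \<partial>restrict_space M S)"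
      by (intro bexI[of _ g] nn_integral_restrict_space_mono[OF TS]) simp
  qed
  show "(\<integral>\<^sup>+x. epowr (e2ennreal \<bar>u x\<bar>) p \<partial>restrict_space M T) \<le> (\<integral>\<^sup>+x. epowr (e2ennreal \<bar>u x\<bar>) p \<partial>restrict_space M S)"
    by (rule nn_integral_restrict_space_mono[OF TS])
  show "0 \<le> 1 / p" using p by simp
qed

lemma newton_subset:
  assumes p: "0 < p" and TS: "T \<subseteq> S" "S \<in> sets M" "T \<in> sets M" and u: "u \<in> newton p M S"
  shows "u \<in> newton p M T"
proof -
  have "newton_norm p M T u < \<infinity>"
    by (rule order.strict_trans1[OF newton_norm_mono[OF p TS]]) (use u in \<open>simp add: newton_def\<close>)
  moreover have "u \<in> borel_measurable (restrict_space M T)"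
    by (rule measurable_restrict_mono[OF _ TS(1)]) (use u in \<open>simp add: newton_def\<close>)
  ultimately show ?thesis by (simp add: newton_def)
qed

text \<open>Test functions restrict to the subspace without increasing the norm. This bounds the
  intrinsic capacity by the ambient one.\<close>

lemma capacity_subspace_le:
  assumes p: "0 < p" and TS: "T \<subseteq> S" "S \<in> sets M" "T \<in> sets M"
  shows "capacity p M T E \<le> capacity p M S E"
  unfolding capacity_def
proof (rule INF_mono)
  fix u assume u: "u \<in> {u \<in> newton p M S. \<forall>x\<in>E. 1 \<le> u x}"
  show "\<exists>v\<in>{u \<in> newton p M T. \<forall>x\<in>E. 1 \<le> u x}. epowr (newton_norm p M T v) p \<le> epowr (newton_norm p M S u) p"
  proof (rule bexI[of _ u])
    show "epowr (newton_norm p M T u) p \<le> epowr (newton_norm p M S u) p"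
      using p by (intro epowr_mono newton_norm_mono[OF p TS]) simp
    show "u \<in> {u \<in> newton p M T. \<forall>x\<in>E. 1 \<le> u x}" using u newton_subset[OF p TS, of u] by simp
  qed
qed

text \<open>The sets \<open>G n \<union> U\<close> are open, and their intersection exceeds
  \<open>U\<close> only by a part of the intersection of the \<open>G n\<close>. The latter is null
  because capacity dominates measure, and subsets of null sets are measurable in the
  completion.\<close>

lemma quasiopen_measurable:
  assumes p: "0 < p" and cbm: "complete_Borel_measure M" and U: "quasiopen p M U"
  shows "U \<in> sets M"
proof -
  obtain N where N: "M = completion N" "space M = UNIV" "sets borel \<subseteq> sets M"
    using complete_Borel_measureE[OF cbm] by metis
  have "\<forall>n. \<exists>G. open G \<and> capacity p M UNIV G < ennreal (1 / real (Suc n)) \<and> open (G \<union> U)"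
    using U unfolding quasiopen_def by simp
  then obtain G where G: "\<And>n. open (G n)" "\<And>n. capacity p M UNIV (G n) < ennreal (1 / real (Suc n))" "\<And>n. open (G n \<union> U)"
    by metis
  define Z where "Z = (\<Inter>n. G n)"
  have Gm: "G n \<in> sets M" "G n \<union> U \<in> sets M" for n using G N(3) by auto
  then have Zm: "Z \<in> sets M" unfolding Z_def by auto
  have le: "emeasure M Z \<le> ennreal (1 / real (Suc n))" for n
  proof -
    have "emeasure M Z \<le> emeasure M (G n)" using Gm by (intro emeasure_mono) (auto simp: Z_def)
    also have "\<dots> \<le> capacity p M UNIV (G n)" using Gm by (intro emeasure_le_capacity p cbm)
    finally show ?thesis using G(2)[of n] by simp
  qed
  have "emeasure M Z = 0"
  proof (rule ccontr)
    assume nz: "emeasure M Z \<noteq> 0"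
    have "emeasure M Z \<noteq> top" using le[of 0] by (auto simp: top_unique)
    then obtain z where z: "emeasure M Z = ennreal z" "0 < z"
      using nz by (cases "emeasure M Z") (auto simp: less_le)
    obtain n where "1 / real (Suc n) < z" using nat_approx_posE[OF z(2)] by blast
    then show False using le[of n] z by (simp add: ennreal_le_iff2)
  qed
  then have "Z \<in> null_sets M" using Zm by auto
  then have "Z - U \<in> null_sets M" unfolding N(1) by (rule null_sets_completion_subset[rotated]) auto
  moreover have "U = (\<Inter>n. G n \<union> U) - (Z - U)" by (auto simp: Z_def)
  moreover have "(\<Inter>n. G n \<union> U) \<in> sets M"
    using Gm(2) sets.top[of M] N(2) by (intro sets.countable_INT'') auto
  ultimately show ?thesis by (metis null_setsD2 sets.Diff)
qed

text \<open>\<open>S\<close> need not be Borel, so extension by zero could fail to be Borel. Instead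
  each trace \<open>{q < g}\<close> on \<open>S\<close> is extended to a Borel set
  \<open>A q\<close>, and the function is rebuilt as the supremum of the rational levels.\<close>

lemma borel_measurable_extend:
  fixes g :: "'a::topological_space \<Rightarrow> ennreal"
  assumes "g \<in> borel_measurable (restrict_space borel S)"
  obtains g' where "g' \<in> borel_measurable borel" "\<And>x. x \<in> S \<Longrightarrow> g' x = g x"
proof -
  have "\<exists>A\<in>sets borel. {x \<in> S. ennreal (of_rat q) < g x} = A \<inter> S" for q
  proof -
    have "{x \<in> space (restrict_space borel S). ennreal (of_rat q) < g x} \<in> sets (restrict_space borel S)"
      using assms by measurable
    then show ?thesis by (auto simp: sets_restrict_space space_restrict_space)
  qed
  then obtain A where A: "\<And>q. A q \<in> sets borel" "\<And>q. {x \<in> S. ennreal (of_rat q) < g x} = A q \<inter> S" by metis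
  define g' where "g' x = (SUP q. ennreal (of_rat q) * indicator (A q) x)" for x
  have "g' \<in> borel_measurable borel"
    unfolding g'_def using A(1) by (intro borel_measurable_SUP) auto
  moreover have "g' x = g x" if x: "x \<in> S" for x
  proof (rule antisym)
    show "g' x \<le> g x" unfolding g'_def
    proof (rule SUP_least)
      fix q show "ennreal (of_rat q) * indicator (A q) x \<le> g x"
      proof (cases "x \<in> A q")
        case True
        then have "x \<in> {x \<in> S. ennreal (of_rat q) < g x}" unfolding A(2) using x by blast
        then show ?thesis using True by (simp add: less_imp_le)
      qed simp
    qed
    show "g x \<le> g' x"
    proof (rule ccontr)
      assume "\<not> g x \<le> g' x"
      then obtain q where q: "g' x < ennreal (of_rat q)" "ennreal (of_rat q) < g x"
        using ennreal_rat_dense[of "g' x" "g x"] unfolding not_le by blast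
      then have "x \<in> A q" using A(2)[of q] x by blast
      then have "ennreal (of_rat q) \<le> g' x" unfolding g'_def by (intro SUP_upper2[of q]) auto
      then show False using q(1) by simp
    qed
  qed
  ultimately show ?thesis by (rule that)
qed

subsection \<open>Local quasicontinuity\<close>

definition softsign :: "real \<Rightarrow> real" where
  "softsign r = r / (1 + \<bar>r\<bar>)"

text \<open>A contraction into \<open>[0,1]\<close> that is injective on the finite values. Infinite
  arguments get the value \<open>1 / 2\<close>; this does not disturb the contraction property,
  since \<open>ext_diff\<close> is infinite there.\<close>

definition squash :: "ereal \<Rightarrow> real" where
  "squash a = (1 + softsign (real_of_ereal a)) / 2"

definition unsquash :: "real \<Rightarrow> real" where
  "unsquash s = (2 * s - 1) / (1 - \<bar>2 * s - 1\<bar>)"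

lemma abs_softsign_less_1: "\<bar>softsign r\<bar> < 1"
  by (simp add: abs_divide softsign_def)

lemma squash_01: "0 \<le> squash a" "squash a \<le> 1"
  using abs_softsign_less_1[of "real_of_ereal a"] by (auto simp: squash_def abs_less_iff)

lemma double_squash: "2 * squash a - 1 = softsign (real_of_ereal a)"
  unfolding squash_def by (simp add: field_simps)

lemma unsquash_squash: "unsquash (squash a) = real_of_ereal a"
proof -
  define r where "r = real_of_ereal a"
  have "1 - \<bar>r / (1 + \<bar>r\<bar>)\<bar> = 1 / (1 + \<bar>r\<bar>)"
    by (simp add: abs_divide field_simps)
  then show ?thesis unfolding unsquash_def double_squash r_def[symmetric] by (simp add: softsign_def)
qed

lemma squash_less_1: "\<bar>2 * squash a - 1\<bar> < 1"
  unfolding double_squash by (rule abs_softsign_less_1)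

text \<open>Over the common denominator the numerator is
  \<open>(r - s) + (r * \<bar>s\<bar> - s * \<bar>r\<bar>)\<close>. The second bracket vanishes for
  equal signs, and for opposite signs
  \<open>\<bar>r - s\<bar> = \<bar>r\<bar> + \<bar>s\<bar>\<close>.\<close>

lemma softsign_diff_le: "\<bar>softsign r - softsign s\<bar> \<le> \<bar>r - s\<bar>"
proof -
  have d: "0 < (1 + \<bar>r\<bar>) * (1 + \<bar>s\<bar>)" by (intro mult_pos_pos) auto
  have "r / (1 + \<bar>r\<bar>) - s / (1 + \<bar>s\<bar>) = (r * (1 + \<bar>s\<bar>) - s * (1 + \<bar>r\<bar>)) / ((1 + \<bar>r\<bar>) * (1 + \<bar>s\<bar>))"
    by (subst diff_frac_eq) auto
  then have eq: "\<bar>r / (1 + \<bar>r\<bar>) - s / (1 + \<bar>s\<bar>)\<bar> = \<bar>r * (1 + \<bar>s\<bar>) - s * (1 + \<bar>r\<bar>)\<bar> / ((1 + \<bar>r\<bar>) * (1 + \<bar>s\<bar>))"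
    using d by (simp add: abs_divide abs_mult)
  have "\<bar>r * (1 + \<bar>s\<bar>) - s * (1 + \<bar>r\<bar>)\<bar> \<le> \<bar>r - s\<bar> * ((1 + \<bar>r\<bar>) * (1 + \<bar>s\<bar>))"
  proof -
    have "\<bar>r * \<bar>s\<bar> - s * \<bar>r\<bar>\<bar> \<le> \<bar>r - s\<bar> * (\<bar>r\<bar> + \<bar>s\<bar>)"
    proof (cases "0 \<le> r * s")
      case True
      then have "r * \<bar>s\<bar> = s * \<bar>r\<bar>" by (auto simp: abs_if zero_le_mult_iff)
      then show ?thesis by simp
    next
      case False
      then consider "r < 0" "0 < s" | "0 < r" "s < 0" by (auto simp: not_le mult_less_0_iff)
      then have "\<bar>r - s\<bar> = \<bar>r\<bar> + \<bar>s\<bar>" and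
        "r * \<bar>s\<bar> - s * \<bar>r\<bar> = 2 * (r * s) \<or> r * \<bar>s\<bar> - s * \<bar>r\<bar> = - (2 * (r * s))"
        by (cases; simp)+
      then have "\<bar>r - s\<bar> = \<bar>r\<bar> + \<bar>s\<bar>" "\<bar>r * \<bar>s\<bar> - s * \<bar>r\<bar>\<bar> = 2 * (\<bar>r\<bar> * \<bar>s\<bar>)"
        by (auto simp: abs_mult)
      moreover have "2 * (\<bar>r\<bar> * \<bar>s\<bar>) \<le> (\<bar>r\<bar> + \<bar>s\<bar>) * (\<bar>r\<bar> + \<bar>s\<bar>)"
        by (simp add: algebra_simps)
      ultimately show ?thesis by simp
    qed
    moreover have "\<bar>r * (1 + \<bar>s\<bar>) - s * (1 + \<bar>r\<bar>)\<bar> \<le> \<bar>r - s\<bar> + \<bar>r * \<bar>s\<bar> - s * \<bar>r\<bar>\<bar>"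
      by (simp add: algebra_simps)
    moreover have "0 \<le> \<bar>r - s\<bar> * (\<bar>r\<bar> * \<bar>s\<bar>)" by simp
    moreover have "\<bar>r - s\<bar> * ((1 + \<bar>r\<bar>) * (1 + \<bar>s\<bar>)) =
        \<bar>r - s\<bar> + \<bar>r - s\<bar> * (\<bar>r\<bar> + \<bar>s\<bar>) + \<bar>r - s\<bar> * (\<bar>r\<bar> * \<bar>s\<bar>)"
      by (simp only: distrib_left distrib_right mult_1 mult_1_right ac_simps)
    ultimately show ?thesis by linarith
  qed
  then show ?thesis unfolding softsign_def eq using d by (simp add: pos_divide_le_eq)
qed

lemma squash_contraction: "ext_diff (ereal (squash a)) (ereal (squash b)) \<le> ext_diff a b"
proof (cases "\<bar>a\<bar> = \<infinity> \<or> \<bar>b\<bar> = \<infinity>")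
  case False
  then obtain r s where rs: "a = ereal r" "b = ereal s" by (cases a; cases b) auto
  have "\<bar>squash a - squash b\<bar> = \<bar>softsign r - softsign s\<bar> / 2"
    unfolding squash_def rs by (simp add: diff_divide_distrib[symmetric])
  also have "\<dots> \<le> \<bar>softsign r - softsign s\<bar>" by simp
  also have "\<dots> \<le> \<bar>r - s\<bar>" by (rule softsign_diff_le)
  finally show ?thesis unfolding rs by (simp add: ennreal_leI)
next
  case True
  then have "ext_diff a b = \<infinity>" by (simp only: ext_diff_def if_True)
  then show ?thesis by simp
qed

lemma squash_measurable [measurable]: "squash \<in> borel_measurable borel"
  unfolding squash_def softsign_def by measurable

text \<open>The indicator of infinite values is also a contraction for \<open>ext_diff\<close>, so
  composing it with \<open>u\<close> keeps the upper gradients of \<open>u\<close>.\<close>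

definition at_infty :: "ereal \<Rightarrow> real" where
  "at_infty a = (if \<bar>a\<bar> = \<infinity> then 1 else 0)"

lemma at_infty_measurable [measurable]: "at_infty \<in> borel_measurable borel"
  unfolding at_infty_def by measurable

lemma at_infty_contraction: "ext_diff (ereal (at_infty a)) (ereal (at_infty b)) \<le> ext_diff a b"
  by (auto simp: at_infty_def ext_diff_def)

context proper_newton
begin

lemma measurable_superset_borel:
  assumes "S \<in> sets M"
  obtains H where "H \<in> sets borel" "S \<subseteq> H" "AE x in M. x \<in> H \<longrightarrow> x \<in> S"
proof -
  obtain N where N: "sets N = sets borel" "M = completion N" "space N = UNIV"
    using complete_Borel_measureE[OF cbm] by metis
  obtain A Z Z' where A: "S = A \<union> Z" "Z \<subseteq> Z'" "Z' \<in> null_sets N" "A \<in> sets N"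
    using assms unfolding N(2) by (rule sets_completionE)
  have "AE x in M. x \<notin> Z'" unfolding N(2) AE_completion_iff using A(3) by (rule AE_not_in)
  then have "AE x in M. x \<in> A \<union> Z' \<longrightarrow> x \<in> S" by eventually_elim (use A in auto)
  moreover have "A \<union> Z' \<in> sets borel" using A(3,4) N(1) by auto
  ultimately show ?thesis using that[of "A \<union> Z'"] A(1,2) by auto
qed

text \<open>An upper gradient on the subspace \<open>S\<close> becomes a Borel function of finite
  energy on the whole space that still controls every piece of a curve lying in
  \<open>S\<close>.\<close>

lemma newton_upper_gradient_extend:
  assumes S: "S \<in> sets M" and u: "u \<in> newton p M S"
  obtains g where "g \<in> borel_measurable borel" "(\<integral>\<^sup>+x. epowr (g x) p \<partial>M) < \<infinity>"
    "\<And>l \<gamma> s t. arc_length_curve UNIV l \<gamma> \<Longrightarrow> 0 \<le> s \<Longrightarrow> s < t \<Longrightarrow> t \<le> l \<Longrightarrow> \<gamma> ` {s..t} \<subseteq> S \<Longrightarrow>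
        ext_diff (u (\<gamma> s)) (u (\<gamma> t)) \<le> (\<integral>\<^sup>+r\<in>{s..t}. g (\<gamma> r) \<partial>lborel)"
    "(\<integral>\<^sup>+x\<in>S. epowr (e2ennreal \<bar>u x\<bar>) p \<partial>M) < \<infinity>"
proof -
  have sp: "space M = UNIV" using complete_Borel_measureE[OF cbm] by metis
  have "epowr (newton_norm p M S u) p < top" using u by (simp add: newton_def)
  then obtain g where g: "upper_gradient S u g"
    "(\<integral>\<^sup>+x. epowr (e2ennreal \<bar>u x\<bar>) p \<partial>restrict_space M S) + (\<integral>\<^sup>+x. epowr (g x) p \<partial>restrict_space M S) < top"
    by (rule newton_normE[OF p0])
  have "g \<in> borel_measurable (restrict_space borel S)" using g(1) by (simp add: upper_gradient_def)
  then obtain g' where g': "g' \<in> borel_measurable borel" "\<And>x. x \<in> S \<Longrightarrow> g' x = g x"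
    using borel_measurable_extend by blast
  obtain H where H: "H \<in> sets borel" "S \<subseteq> H" "AE x in M. x \<in> H \<longrightarrow> x \<in> S"
    using measurable_superset_borel[OF S] by blast
  have fin: "(\<integral>\<^sup>+x. epowr (e2ennreal \<bar>u x\<bar>) p \<partial>restrict_space M S) < top"
    "(\<integral>\<^sup>+x. epowr (g x) p \<partial>restrict_space M S) < top"
    using g(2) by simp_all
  have r: "(\<integral>\<^sup>+x. \<phi> x \<partial>restrict_space M S) = (\<integral>\<^sup>+x\<in>S. \<phi> x \<partial>M)" for \<phi>
    using S sp by (intro nn_integral_restrict_space) simp
  show ?thesis
  proof (rule that)
    \<comment> \<open>The extension \<open>g'\<close> is uncontrolled off \<open>S\<close>. Cutting
      it to a Borel set \<open>H\<close> that exceeds \<open>S\<close> by a null set makes its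
      energy at most that of \<open>g\<close> on \<open>S\<close>.\<close>
    show "(\<lambda>x. g' x * indicator H x) \<in> borel_measurable borel"
      using g'(1) H(1) by (intro borel_measurable_times_ennreal borel_measurable_indicator)
    have "(\<integral>\<^sup>+x. epowr (g' x * indicator H x) p \<partial>M) \<le> (\<integral>\<^sup>+x\<in>S. epowr (g x) p \<partial>M)"
    proof (rule nn_integral_mono_AE)
      show "AE x in M. epowr (g' x * indicator H x) p \<le> epowr (g x) p * indicator S x"
        using H(3) by eventually_elim (use g'(2) in \<open>auto simp: indicator_def\<close>)
    qed
    also have "\<dots> < \<infinity>" using fin(2) unfolding r by simp
    finally show "(\<integral>\<^sup>+x. epowr (g' x * indicator H x) p \<partial>M) < \<infinity>" .
    show "(\<integral>\<^sup>+x\<in>S. epowr (e2ennreal \<bar>u x\<bar>) p \<partial>M) < \<infinity>" using fin(1) unfolding r by simp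
    fix l \<gamma> s t
    assume arc: "arc_length_curve UNIV l \<gamma>" "0 \<le> s" "s < t" "t \<le> l" and im: "\<gamma> ` {s..t} \<subseteq> S"
    have "ext_diff (u (\<gamma> s)) (u (\<gamma> t)) \<le> (\<integral>\<^sup>+r\<in>{s..t}. g (\<gamma> r) \<partial>lborel)"
      by (rule upper_gradient_subcurve[OF g(1) arc im])
    also have "\<dots> = (\<integral>\<^sup>+r\<in>{s..t}. (g' (\<gamma> r) * indicator H (\<gamma> r)) \<partial>lborel)"
      using im H(2) g'(2) by (intro nn_integral_cong) (auto simp: indicator_def image_subset_iff)
    finally show "ext_diff (u (\<gamma> s)) (u (\<gamma> t)) \<le> (\<integral>\<^sup>+r\<in>{s..t}. (g' (\<gamma> r) * indicator H (\<gamma> r)) \<partial>lborel)" .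
  qed
qed

text \<open>Three bounded functions are treated: \<open>\<zeta>\<close>,
  \<open>squash (u x) * \<zeta> x\<close> and \<open>at_infty (u x) * \<zeta> x\<close>. Where
  \<open>1 / 2 < \<zeta>\<close>, the first two determine \<open>u\<close> by division and inversion
  of \<open>squash\<close>, once the third has shown \<open>u\<close> to be finite.\<close>

lemma local_quasicontinuous:
  fixes \<zeta> :: "'a \<Rightarrow> real"
  assumes S: "S \<in> sets M" "S \<subseteq> ball x0 R" and u: "u \<in> newton p M S"
    and \<zeta>: "\<zeta> \<in> borel_measurable M" "\<And>x. 0 \<le> \<zeta> x" "\<And>x. \<zeta> x \<le> 1" "\<And>x. 0 < \<zeta> x \<Longrightarrow> x \<in> S"
    and ug: "upper_gradient UNIV (\<lambda>x. ereal (\<zeta> x)) k" and k: "(\<integral>\<^sup>+x. epowr (k x) p \<partial>M) < \<infinity>"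
    and e: "0 < e"
  obtains G where "open G" "capacity p M UNIV G < ennreal e" "continuous_on (- G) \<zeta>"
    "\<And>x. x \<notin> G \<Longrightarrow> 1 / 2 < \<zeta> x \<Longrightarrow> \<bar>u x\<bar> \<noteq> \<infinity>" "continuous_on ({x. 1 / 2 < \<zeta> x} - G) u"
proof -
  have sp: "space M = UNIV" using complete_Borel_measureE[OF cbm] by metis
  obtain g where g: "g \<in> borel_measurable borel" "(\<integral>\<^sup>+x. epowr (g x) p \<partial>M) < \<infinity>"
    "\<And>l \<gamma> s t. arc_length_curve UNIV l \<gamma> \<Longrightarrow> 0 \<le> s \<Longrightarrow> s < t \<Longrightarrow> t \<le> l \<Longrightarrow> \<gamma> ` {s..t} \<subseteq> S \<Longrightarrow>
        ext_diff (u (\<gamma> s)) (u (\<gamma> t)) \<le> (\<integral>\<^sup>+r\<in>{s..t}. g (\<gamma> r) \<partial>lborel)"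
    and uL: "(\<integral>\<^sup>+x\<in>S. epowr (e2ennreal \<bar>u x\<bar>) p \<partial>M) < \<infinity>"
    by (rule newton_upper_gradient_extend[OF S(1) u]) (rule that)
  have um: "u \<in> borel_measurable (restrict_space M S)" using u by (simp add: newton_def)
  have km: "k \<in> borel_measurable borel" using ug by (simp add: upper_gradient_real)
  have \<zeta>0: "\<zeta> x = 0" if "x \<notin> S" for x using \<zeta>(2)[of x] \<zeta>(4)[of x] that by fastforce
  have kg: "(\<integral>\<^sup>+x. epowr (k x + g x) p \<partial>M) < \<infinity>"
  proof -
    have m: "(\<lambda>x. epowr (k x) p) \<in> borel_measurable M" "(\<lambda>x. epowr (g x) p) \<in> borel_measurable M"
      using complete_Borel_measurable[OF cbm km] complete_Borel_measurable[OF cbm g(1)] by measurable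
    have "(\<integral>\<^sup>+x. epowr (k x + g x) p \<partial>M) \<le> (\<integral>\<^sup>+x. ennreal (2 powr p) * (epowr (k x) p + epowr (g x) p) \<partial>M)"
      using p0 by (intro nn_integral_mono epowr_add_le) simp
    also have "\<dots> = ennreal (2 powr p) * ((\<integral>\<^sup>+x. epowr (k x) p \<partial>M) + (\<integral>\<^sup>+x. epowr (g x) p \<partial>M))"
      using m by (simp add: nn_integral_cmult nn_integral_add)
    also have "\<dots> < \<infinity>" using k g(2) by (simp add: ennreal_mult_less_top)
    finally show ?thesis .
  qed
  have prod: "(\<lambda>x. \<phi> (u x) * \<zeta> x) \<in> borel_measurable M"
    "upper_gradient UNIV (\<lambda>x. ereal (\<phi> (u x) * \<zeta> x)) (\<lambda>x. k x + g x)"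
    "\<And>x. 0 \<le> \<phi> (u x) * \<zeta> x" "\<And>x. \<phi> (u x) * \<zeta> x \<le> 1" "\<And>x. x \<notin> ball x0 R \<Longrightarrow> \<phi> (u x) * \<zeta> x = 0"
    if \<phi>: "\<phi> \<in> borel_measurable borel" "\<And>a. 0 \<le> \<phi> a" "\<And>a. \<phi> a \<le> 1"
      "\<And>a b. ext_diff (ereal (\<phi> a)) (ereal (\<phi> b)) \<le> ext_diff a b" for \<phi> :: "ereal \<Rightarrow> real"
  proof -
    have "(\<lambda>x. \<phi> (u x)) \<in> borel_measurable (restrict_space M S)"
      by (rule measurable_compose[OF um \<phi>(1)])
    then have "(\<lambda>x. indicator S x *\<^sub>R \<phi> (u x)) \<in> borel_measurable M"
      using S(1) sp by (subst (asm) borel_measurable_restrict_space_iff) simp_all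
    then have "(\<lambda>x. (indicator S x *\<^sub>R \<phi> (u x)) * \<zeta> x) \<in> borel_measurable M"
      using \<zeta>(1) by (rule borel_measurable_times)
    moreover have "(\<lambda>x. (indicator S x *\<^sub>R \<phi> (u x)) * \<zeta> x) = (\<lambda>x. \<phi> (u x) * \<zeta> x)"
    proof
      fix x show "(indicator S x *\<^sub>R \<phi> (u x)) * \<zeta> x = \<phi> (u x) * \<zeta> x"
        using \<zeta>0[of x] by (cases "x \<in> S") auto
    qed
    ultimately show "(\<lambda>x. \<phi> (u x) * \<zeta> x) \<in> borel_measurable M" by simp
    show "upper_gradient UNIV (\<lambda>x. ereal (\<phi> (u x) * \<zeta> x)) (\<lambda>x. k x + g x)"
    proof (rule upper_gradient_product[OF ug g(1)])
      fix l s t :: real and \<gamma> :: "real \<Rightarrow> 'a"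
      assume arc: "arc_length_curve UNIV l \<gamma>" "0 \<le> s" "s \<le> t" "t \<le> l" and im: "\<gamma> ` {s..t} \<subseteq> S"
      show "ennreal \<bar>\<phi> (u (\<gamma> s)) - \<phi> (u (\<gamma> t))\<bar> \<le> (\<integral>\<^sup>+r\<in>{s..t}. g (\<gamma> r) \<partial>lborel)"
      proof (cases "s = t")
        case False
        then have "s < t" using arc(3) by simp
        have "ennreal \<bar>\<phi> (u (\<gamma> s)) - \<phi> (u (\<gamma> t))\<bar> \<le> ext_diff (u (\<gamma> s)) (u (\<gamma> t))"
          using \<phi>(4)[of "u (\<gamma> s)" "u (\<gamma> t)"] by simp
        also have "\<dots> \<le> (\<integral>\<^sup>+r\<in>{s..t}. g (\<gamma> r) \<partial>lborel)"
          by (rule g(3)[OF arc(1,2) \<open>s < t\<close> arc(4) im])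
        finally show ?thesis .
      qed simp
    qed (use \<phi>(2,3) \<zeta>(2,3,4) in auto)
    show "0 \<le> \<phi> (u x) * \<zeta> x" for x using \<phi>(2) \<zeta>(2) by simp
    show "\<phi> (u x) * \<zeta> x \<le> 1" for x using \<phi>(2,3) \<zeta>(2,3) by (simp add: mult_le_one)
    show "\<phi> (u x) * \<zeta> x = 0" if "x \<notin> ball x0 R" for x
      using \<zeta>0[of x] subsetD[OF S(2), of x] that by force
  qed
  have ballint: "(\<integral>\<^sup>+x\<in>ball x0 R. \<psi> x \<partial>M) < \<infinity>" if "(\<integral>\<^sup>+x. \<psi> x \<partial>M) < \<infinity>" for \<psi>
    by (rule order.strict_trans1[OF _ that]) (auto intro!: nn_integral_mono simp: indicator_def)
  have e3: "0 < e / 3" using e by simp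
  have \<zeta>B: "\<zeta> x = 0" if "x \<notin> ball x0 R" for x 
    using \<zeta>0[of x] subsetD[OF S(2), of x] that by blast
  obtain G1 where G1: "open G1" "capacity p M UNIV G1 < ennreal (e / 3)" "continuous_on (- G1) \<zeta>"
    by (rule bounded_quasicontinuous[OF \<zeta>(1-3) \<zeta>B ug ballint[OF k] e3]) (assumption, rule that)
  note sq = prod[of squash, OF squash_measurable squash_01 squash_contraction]
  obtain G2 where G2: "open G2" "capacity p M UNIV G2 < ennreal (e / 3)" "continuous_on (- G2) (\<lambda>x. squash (u x) * \<zeta> x)"
    by (rule bounded_quasicontinuous[OF sq(1,3,4,5,2) ballint[OF kg] e3]) (assumption, rule that)
  have a01: "0 \<le> at_infty a" "at_infty a \<le> 1" for a by (auto simp: at_infty_def)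
  note ai = prod[of at_infty, OF at_infty_measurable a01 at_infty_contraction]
  \<comment> \<open>\<open>u\<close> is finite almost everywhere on \<open>S\<close> because its
    p-th power is integrable there, and \<open>\<zeta>\<close> vanishes off
    \<open>S\<close>.\<close>
  have "AE x in M. at_infty (u x) * \<zeta> x = 0"
  proof -
    have "(\<lambda>x. epowr (e2ennreal \<bar>u x\<bar>) p) \<in> borel_measurable (restrict_space M S)" using um by measurable
    then have "(\<lambda>x. epowr (e2ennreal \<bar>u x\<bar>) p * indicator S x) \<in> borel_measurable M"
      using S(1) sp by (subst (asm) borel_measurable_restrict_space_iff_ennreal) simp_all
    then have "AE x in M. epowr (e2ennreal \<bar>u x\<bar>) p * indicator S x \<noteq> \<infinity>"
      using uL by (intro nn_integral_PInf_AE) auto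
    then show ?thesis
    proof eventually_elim
      case (elim x)
      show ?case
      proof (cases "x \<in> S")
        case True
        then have "\<bar>u x\<bar> \<noteq> \<infinity>" using elim by auto
        then show ?thesis by (simp add: at_infty_def)
      qed (simp add: \<zeta>0)
    qed
  qed
  from null_superlevel_small_capacity[OF ai(1,3,4,5,2) kg this _ e3, where t = "1 / 2"]
  obtain G3 where G3: "open G3" "{x. 1 / 2 < at_infty (u x) * \<zeta> x} \<subseteq> G3" "capacity p M UNIV G3 < ennreal (e / 3)"
    by auto
  define G where "G = G1 \<union> (G2 \<union> G3)"
  have "capacity p M UNIV G \<le> capacity p M UNIV G1 + capacity p M UNIV (G2 \<union> G3)"
    unfolding G_def by (rule capacity_Un[OF p0 cbm])
  also have "\<dots> \<le> capacity p M UNIV G1 + (capacity p M UNIV G2 + capacity p M UNIV G3)"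
    by (intro add_left_mono capacity_Un[OF p0 cbm])
  also have "\<dots> < ennreal (e / 3) + (ennreal (e / 3) + ennreal (e / 3))"
    using G1(2) G2(2) G3(3) by (intro add_strict_mono)
  also have "\<dots> = ennreal e" using e by (simp flip: ennreal_plus)
  finally have cap: "capacity p M UNIV G < ennreal e" .
  have fin: "\<bar>u x\<bar> \<noteq> \<infinity>" if "x \<notin> G" "1 / 2 < \<zeta> x" for x
  proof
    assume "\<bar>u x\<bar> = \<infinity>"
    then have "x \<in> {x. 1 / 2 < at_infty (u x) * \<zeta> x}" using that(2) by (simp add: at_infty_def)
    then show False using G3(2) that(1) by (auto simp: G_def)
  qed
  let ?Y = "{x. 1 / 2 < \<zeta> x} - G"
  \<comment> \<open>The lower bound \<open>1 / 2 < \<zeta> x\<close> makes the division admissible,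
    and removing \<open>G\<close> makes numerator and denominator continuous.\<close>
  have "continuous_on ?Y (\<lambda>x. (squash (u x) * \<zeta> x) / \<zeta> x)"
    by (intro continuous_on_divide continuous_on_subset[OF G2(3)] continuous_on_subset[OF G1(3)]) (auto simp: G_def)
  then have sqc: "continuous_on ?Y (\<lambda>x. squash (u x))"
    by (rule continuous_on_eq) auto
  have "continuous_on ?Y (\<lambda>x. unsquash (squash (u x)))"
    unfolding unsquash_def
    by (intro continuous_on_divide continuous_intros sqc) (use squash_less_1 in \<open>auto simp: less_le\<close>)
  then have "continuous_on ?Y (\<lambda>x. ereal (real_of_ereal (u x)))"
    unfolding unsquash_squash by (rule continuous_on_ereal)
  then have "continuous_on ?Y u"
    by (rule continuous_on_eq) (use fin in \<open>auto simp: ereal_real\<close>)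
  moreover have "continuous_on (- G) \<zeta>"
    by (rule continuous_on_subset[OF G1(3)]) (auto simp: G_def)
  moreover have "open G" using G1(1) G2(1) G3(1) by (auto simp: G_def)
  ultimately show ?thesis using that cap fin by blast
qed

end

subsection \<open>Quasicontinuity on quasiopen sets\<close>

context proper_newton
begin

text \<open>\<open>\<zeta>\<close> is positive only inside the ball and off \<open>G0\<close>, hence
  only in \<open>U\<close>. The exceptional set \<open>V\<close> is bounded by a small
  \<open>G\<close> and by \<open>{y. 1 / 4 < w y}\<close>, which does not depend on the ball, so
  that the latter is charged once in a countable union.\<close>

lemma cutoff_quasicontinuous:
  assumes R: "0 < R" and U: "U \<in> sets M" and sub: "ball x R \<subseteq> G0 \<union> U"
    and u: "u \<in> newton p M (U \<inter> ball x R)"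
    and w: "w \<in> borel_measurable M" "\<And>y. 0 \<le> w y" "\<And>y. w y \<le> (1::real)" "\<And>y. y \<in> G0 \<Longrightarrow> w y = 1"
    and ugw: "upper_gradient UNIV (\<lambda>y. ereal (w y)) g" and g: "(\<integral>\<^sup>+y. epowr (g y) p \<partial>M) < \<infinity>"
    and e: "0 < e"
  obtains G V where "capacity p M UNIV G < ennreal e" "open V" "V \<subseteq> G \<union> {y. 1 / 4 < w y}"
    "\<And>y. y \<in> ball x (R / 2) - V \<Longrightarrow> \<bar>u y\<bar> \<noteq> \<infinity>" "continuous_on (ball x (R / 2) - V) u"
proof -
  \<comment> \<open>Equal to 1 on the half ball, 0 outside the ball, and Lipschitz with constant
    \<open>2 / R\<close>.\<close>
  define \<psi> where "\<psi> y = max 0 (min 1 (2 - 2 / R * dist x y))" for y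
  define \<zeta> where "\<zeta> y = max 0 (\<psi> y - w y)" for y
  define F where "F = - ball x R"
  have bM: "ball x R \<in> sets M"
    using complete_Borel_measureE[OF cbm] by (metis borel_open open_ball subsetD)
  have \<zeta>01: "0 \<le> \<zeta> y" "\<zeta> y \<le> 1" for y
    using w(2)[of y] by (auto simp: \<zeta>_def \<psi>_def)
  have \<zeta>F: "\<zeta> y = 0" if "y \<in> F" for y
  proof -
    have "2 * R \<le> 2 * dist x y" using that by (simp add: F_def)
    then have "2 \<le> 2 / R * dist x y" using R by (simp add: field_simps)
    then show ?thesis using w(2)[of y] by (simp add: \<zeta>_def \<psi>_def)
  qed
  have \<zeta>S: "y \<in> U \<inter> ball x R" if "0 < \<zeta> y" for y
  proof -
    have "y \<in> ball x R" using \<zeta>F[of y] that by (auto simp: F_def)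
    moreover have "y \<notin> G0" using w(4)[of y] that by (auto simp: \<zeta>_def \<psi>_def)
    ultimately show ?thesis using sub by auto
  qed
  have "continuous_on UNIV \<psi>" unfolding \<psi>_def by (intro continuous_intros)
  then have "\<psi> \<in> borel_measurable M"
    by (intro complete_Borel_measurable[OF cbm] borel_measurable_continuous_onI)
  then have \<zeta>m: "\<zeta> \<in> borel_measurable M" unfolding \<zeta>_def using w(1) by measurable
  have gm: "g \<in> borel_measurable borel" using ugw by (simp add: upper_gradient_real)
  have "upper_gradient UNIV (\<lambda>y. ereal (\<zeta> y)) (\<lambda>y. ennreal (2 / R) + g y)"
    unfolding upper_gradient_real
  proof (intro conjI allI impI)
    show "(\<lambda>y. ennreal (2 / R) + g y) \<in> borel_measurable borel" using gm by measurable
    fix l :: real and \<gamma> :: "real \<Rightarrow> 'a" assume arc: "arc_length_curve UNIV l \<gamma>"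
    then have l: "0 < l" by (simp add: arc_length_curve_def)
    have "\<bar>\<psi> (\<gamma> 0) - \<psi> (\<gamma> l)\<bar> \<le> \<bar>2 / R * dist x (\<gamma> 0) - 2 / R * dist x (\<gamma> l)\<bar>"
      unfolding \<psi>_def by (simp add: max_def min_def abs_minus_commute)
    also have "\<dots> = 2 / R * \<bar>dist x (\<gamma> 0) - dist x (\<gamma> l)\<bar>"
      using R by (simp only: right_diff_distrib[symmetric] abs_mult) simp
    also have "\<dots> \<le> 2 / R * l"
    proof (rule mult_left_mono)
      have "\<bar>dist x (\<gamma> 0) - dist x (\<gamma> l)\<bar> \<le> dist (\<gamma> 0) (\<gamma> l)"
        using dist_triangle[of x "\<gamma> 0" "\<gamma> l"] dist_triangle[of x "\<gamma> l" "\<gamma> 0"] by (simp add: dist_commute)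
      also have "\<dots> \<le> l" using arc_length_curve_dist[OF arc, of 0 l] l by simp
      finally show "\<bar>dist x (\<gamma> 0) - dist x (\<gamma> l)\<bar> \<le> l" .
    qed (use R in simp)
    finally have "\<bar>\<zeta> (\<gamma> 0) - \<zeta> (\<gamma> l)\<bar> \<le> 2 / R * l + \<bar>w (\<gamma> 0) - w (\<gamma> l)\<bar>"
      unfolding \<zeta>_def by linarith
    then have "ennreal \<bar>\<zeta> (\<gamma> 0) - \<zeta> (\<gamma> l)\<bar> \<le> ennreal (2 / R * l) + ennreal \<bar>w (\<gamma> 0) - w (\<gamma> l)\<bar>"
      using R l by (subst ennreal_plus[symmetric]) (auto intro: ennreal_leI simp del: ennreal_plus)
    also have "\<dots> \<le> (\<integral>\<^sup>+t\<in>{0..l}. ennreal (2 / R) \<partial>lborel) + (\<integral>\<^sup>+t\<in>{0..l}. g (\<gamma> t) \<partial>lborel)"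
    proof (rule add_mono)
      show "ennreal (2 / R * l) \<le> (\<integral>\<^sup>+t\<in>{0..l}. ennreal (2 / R) \<partial>lborel)"
      proof -
        have "ennreal (2 / R * l) = ennreal (2 / R) * ennreal l"
          by (rule ennreal_mult) (use R l in auto)
        also have "\<dots> = ennreal (2 / R) * emeasure lborel {0..l}" using l by simp
        also have "\<dots> = (\<integral>\<^sup>+t\<in>{0..l}. ennreal (2 / R) \<partial>lborel)"
          by (rule nn_integral_cmult_indicator[symmetric]) simp
        finally show ?thesis by (simp only: order_refl)
      qed
      show "ennreal \<bar>w (\<gamma> 0) - w (\<gamma> l)\<bar> \<le> (\<integral>\<^sup>+t\<in>{0..l}. g (\<gamma> t) \<partial>lborel)"
        using ugw arc by (simp add: upper_gradient_real)
    qed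
    also have "\<dots> = (\<integral>\<^sup>+t. ennreal (2 / R) * indicator {0..l} t + g (\<gamma> t) * indicator {0..l} t \<partial>lborel)"
      using arc_integrand_measurable[OF gm arc, of 0 l] by (intro nn_integral_add[symmetric]) auto
    also have "\<dots> = (\<integral>\<^sup>+t\<in>{0..l}. (ennreal (2 / R) + g (\<gamma> t)) \<partial>lborel)"
      by (simp add: distrib_right)
    finally show "ennreal \<bar>\<zeta> (\<gamma> 0) - \<zeta> (\<gamma> l)\<bar> \<le> (\<integral>\<^sup>+t\<in>{0..l}. (ennreal (2 / R) + g (\<gamma> t)) \<partial>lborel)" .
  qed
  \<comment> \<open>The constant \<open>2 / R\<close> need not be integrable over the whole space;
    as \<open>\<zeta>\<close> vanishes on \<open>F\<close>, the gradient may be cut to the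
    ball.\<close>
  then have ug: "upper_gradient UNIV (\<lambda>y. ereal (\<zeta> y)) (\<lambda>y. (ennreal (2 / R) + g y) * indicator (- F) y)"
    by (rule upper_gradient_cut[OF _ \<zeta>01(1) _ \<zeta>F]) (simp_all add: F_def closed_Compl)
  have k: "(\<integral>\<^sup>+y. epowr ((ennreal (2 / R) + g y) * indicator (- F) y) p \<partial>M) < \<infinity>"
  proof -
    have gp: "(\<lambda>y. epowr (g y) p) \<in> borel_measurable M"
      using complete_Borel_measurable[OF cbm gm] by measurable
    have "(\<integral>\<^sup>+y. epowr ((ennreal (2 / R) + g y) * indicator (- F) y) p \<partial>M) \<le>
       (\<integral>\<^sup>+y. ennreal (2 powr p) * (epowr (ennreal (2 / R)) p * indicator (ball x R) y + epowr (g y) p) \<partial>M)"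
    proof (rule nn_integral_mono)
      fix y
      show "epowr ((ennreal (2 / R) + g y) * indicator (- F) y) p \<le>
        ennreal (2 powr p) * (epowr (ennreal (2 / R)) p * indicator (ball x R) y + epowr (g y) p)"
        using epowr_add_le[of p "ennreal (2 / R)" "g y"] p0 by (cases "y \<in> ball x R") (auto simp: F_def)
    qed
    also have "\<dots> = ennreal (2 powr p) * ((\<integral>\<^sup>+y. epowr (ennreal (2 / R)) p * indicator (ball x R) y \<partial>M) + (\<integral>\<^sup>+y. epowr (g y) p \<partial>M))"
      using gp bM by (simp add: nn_integral_cmult nn_integral_add)
    also have "\<dots> = ennreal (2 powr p) * (epowr (ennreal (2 / R)) p * emeasure M (ball x R) + (\<integral>\<^sup>+y. epowr (g y) p \<partial>M))"
      using bM by (simp add: nn_integral_cmult_indicator)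
    also have "\<dots> < \<infinity>"
      using g fin_ball[of x R] by (auto simp: ennreal_mult_less_top)
    finally show ?thesis .
  qed
  have SM: "U \<inter> ball x R \<in> sets M" using U bM by auto
  obtain G where G: "open G" "capacity p M UNIV G < ennreal e" "continuous_on (- G) \<zeta>"
    "\<And>y. y \<notin> G \<Longrightarrow> 1 / 2 < \<zeta> y \<Longrightarrow> \<bar>u y\<bar> \<noteq> \<infinity>" "continuous_on ({y. 1 / 2 < \<zeta> y} - G) u"
    by (rule local_quasicontinuous[OF SM Int_lower2 u \<zeta>m \<zeta>01 \<zeta>S ug k e]) (assumption, rule that)
  \<comment> \<open>The set \<open>{1 / 4 < w}\<close> need not be open. On the half ball
    \<open>w = 1 - \<zeta>\<close>, and adding \<open>G\<close> opens the superlevel set since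
    \<open>\<zeta>\<close> is continuous off \<open>G\<close>. Off \<open>V\<close> one has
    \<open>\<zeta> \<ge> 3 / 4\<close> there, above the required \<open>1 / 2\<close>.\<close>
  define V where "V = G \<union> (G \<union> {y. 1 / 4 < 1 - \<zeta> y}) \<inter> ball x (R / 2)"
  have half: "\<zeta> y = 1 - w y" if "y \<in> ball x (R / 2)" for y
  proof -
    have "2 / R * dist x y \<le> 1" using that R by (simp add: field_simps)
    then have "\<psi> y = 1" by (simp add: \<psi>_def)
    then show ?thesis using w(3)[of y] by (simp add: \<zeta>_def)
  qed
  show ?thesis
  proof (rule that[OF G(2)])
    show "open V" unfolding V_def
      by (intro open_Un open_Int G(1) open_ball open_Un_superlevel continuous_intros G(3))
    show "V \<subseteq> G \<union> {y. 1 / 4 < w y}" using half by (auto simp: V_def)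
    have far: "y \<notin> G" "1 / 2 < \<zeta> y" if "y \<in> ball x (R / 2) - V" for y
      using that by (auto simp: V_def)
    show "\<bar>u y\<bar> \<noteq> \<infinity>" if y: "y \<in> ball x (R / 2) - V" for y by (rule G(4)[OF far[OF y]])
    show "continuous_on (ball x (R / 2) - V) u"
      by (rule continuous_on_subset[OF G(5)]) (use far in auto)
  qed
qed

lemma newton_loc_quasicontinuous:
  assumes U: "quasiopen p M U" and u: "u \<in> newton_loc p M U"
  shows "quasicontinuous p M U u"
  unfolding quasicontinuous_def
proof (intro allI impI)
  fix \<epsilon> :: real assume \<epsilon>: "0 < \<epsilon>"
  have UM: "U \<in> sets M" by (rule quasiopen_measurable[OF p0 cbm U])
  have bM: "ball x s \<in> sets M" for x s
    using complete_Borel_measureE[OF cbm] by (metis borel_open open_ball subsetD)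
  \<comment> \<open>Testing \<open>{1 / 4 < w}\<close> with \<open>4 * w\<close> costs the factor
    \<open>4 powr p\<close>, which turns \<open>c\<close> into
    \<open>\<epsilon> / 2\<close>.\<close>
  define c where "c = \<epsilon> / (2 * 4 powr p)"
  have c: "0 < c" "4 powr p * c = \<epsilon> / 2" using \<epsilon> by (auto simp: c_def)
  obtain G0 where G0: "capacity p M UNIV G0 < ennreal c" "open (G0 \<union> U)"
    using U c(1) unfolding quasiopen_def by blast
  from capacity_lessE_real[OF p0 cbm G0(1)] obtain w g where
    w: "w \<in> borel_measurable M" "\<And>y. 0 \<le> w y" "\<And>y. w y \<le> (1::real)" "\<And>y. y \<in> G0 \<Longrightarrow> w y = 1"
    and ugw: "upper_gradient UNIV (\<lambda>y. ereal (w y)) g"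
    and E: "(\<integral>\<^sup>+y. epowr (ennreal (w y)) p \<partial>M) + (\<integral>\<^sup>+y. epowr (g y) p \<partial>M) < ennreal c" by blast
  have gm: "g \<in> borel_measurable borel" using ugw by (simp add: upper_gradient_real)
  have gint: "(\<integral>\<^sup>+y. epowr (g y) p \<partial>M) < \<infinity>"
    by (rule order.strict_trans1[OF _ order.strict_trans[OF E]]) simp_all
  have capw: "capacity p M UNIV {y. 1 / 4 < w y} \<le> ennreal (\<epsilon> / 2)"
  proof -
    have m: "(\<lambda>y. epowr (ennreal (w y)) p) \<in> borel_measurable M" "(\<lambda>y. epowr (g y) p) \<in> borel_measurable M"
      using w(1) complete_Borel_measurable[OF cbm gm] by measurable
    have "capacity p M UNIV {y. 1 / 4 < w y} \<le> (\<integral>\<^sup>+y. epowr (ennreal (4 * w y)) p \<partial>M) + (\<integral>\<^sup>+y. epowr (ennreal 4 * g y) p \<partial>M)"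
      by (rule capacity_le_real[OF p0 cbm _ _ _ upper_gradient_scale[OF ugw]]) (use w(1,2) in auto)
    also have "\<dots> = (\<integral>\<^sup>+y. ennreal (4 powr p) * epowr (ennreal (w y)) p \<partial>M) + (\<integral>\<^sup>+y. ennreal (4 powr p) * epowr (g y) p \<partial>M)"
      using w(2) by (simp only: epowr_cmult[symmetric] ennreal_mult[OF zero_le_numeral] zero_less_numeral)
    also have "\<dots> = ennreal (4 powr p) * ((\<integral>\<^sup>+y. epowr (ennreal (w y)) p \<partial>M) + (\<integral>\<^sup>+y. epowr (g y) p \<partial>M))"
      using m by (simp add: nn_integral_cmult distrib_left)
    also have "\<dots> \<le> ennreal (4 powr p) * ennreal c"
      using E by (intro mult_left_mono) auto
    also have "\<dots> = ennreal (4 powr p * c)" using c(1) by (simp add: ennreal_mult)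
    also have "4 powr p * c = \<epsilon> / 2" by (rule c(2))
    finally show ?thesis .
  qed

  have "\<exists>r>0. ball x r \<subseteq> G0 \<union> U \<and> u \<in> newton p M (U \<inter> ball x r)" if xU: "x \<in> U" for x
  proof -
    obtain r1 where r1: "0 < r1" "u \<in> newton p M (U \<inter> ball x r1)"
      using u xU unfolding newton_loc_def by auto
    have "x \<in> G0 \<union> U" using xU by simp
    then obtain r2 where r2: "0 < r2" "ball x r2 \<subseteq> G0 \<union> U"
      using openE[OF G0(2)] by metis
    let ?r = "min r1 r2"
    have "U \<inter> ball x ?r \<subseteq> U \<inter> ball x r1" by auto
    then have "u \<in> newton p M (U \<inter> ball x ?r)"
      by (rule newton_subset[OF p0 _ sets.Int[OF UM bM] sets.Int[OF UM bM] r1(2)])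
    moreover have "ball x ?r \<subseteq> G0 \<union> U" using r2(2) by auto
    moreover have "0 < ?r" using r1(1) r2(1) by simp
    ultimately show ?thesis by blast
  qed
  then obtain r where r: "\<And>x. x \<in> U \<Longrightarrow> 0 < r x" "\<And>x. x \<in> U \<Longrightarrow> ball x (r x) \<subseteq> G0 \<union> U"
    "\<And>x. x \<in> U \<Longrightarrow> u \<in> newton p M (U \<inter> ball x (r x))" by metis
  obtain C where C: "countable C" "C \<subseteq> U" "U \<subseteq> (\<Union>x\<in>C. ball x (r x / 2))"
    by (rule countable_ball_cover[of U "\<lambda>x. r x / 2", OF half_gt_zero[OF r(1)]]) (assumption, rule that)
  show "\<exists>G. open G \<and> capacity p M UNIV G < ennreal \<epsilon> \<and> (\<forall>x\<in>U - G. \<bar>u x\<bar> \<noteq> \<infinity>) \<and> continuous_on (U - G) u"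
  proof (cases "C = {}")
    case True
    then have "U = {}" using C(3) by auto
    then show ?thesis using \<epsilon> by (intro exI[of _ "{}"]) (simp add: capacity_empty[OF p0 cbm])
  next
    case False
    define z where "z j = from_nat_into C j" for j
    have zC: "z j \<in> C" for j unfolding z_def using False by (rule from_nat_into)
    have zU: "z j \<in> U" for j using zC C(2) by blast
    have zcov: "\<exists>j. y \<in> ball (z j) (r (z j) / 2)" if "y \<in> U" for y
    proof -
      have "y \<in> (\<Union>x\<in>C. ball x (r x / 2))" using C(3) that by blast
      moreover have "C = range z" unfolding z_def using range_from_nat_into[OF False C(1)] by simp
      ultimately show ?thesis by blast
    qed
    \<comment> \<open>The individual parts add up to \<open>\<epsilon> / 4\<close>; together with
      \<open>\<epsilon> / 2\<close> for the common set this stays strictly below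
      \<open>\<epsilon>\<close>.\<close>
    define good where "good j G V \<longleftrightarrow> capacity p M UNIV G < ennreal (\<epsilon> / 4 * (1/2) ^ Suc j) \<and> open V \<and>
        V \<subseteq> G \<union> {y. 1 / 4 < w y} \<and> (\<forall>y\<in>ball (z j) (r (z j) / 2) - V. \<bar>u y\<bar> \<noteq> \<infinity>) \<and>
        continuous_on (ball (z j) (r (z j) / 2) - V) u" for j G V
    have "\<exists>G V. good j G V" for j
    proof -
      have e: "0 < \<epsilon> / 4 * (1/2) ^ Suc j" using \<epsilon> by simp
      obtain G V where "capacity p M UNIV G < ennreal (\<epsilon> / 4 * (1/2) ^ Suc j)" "open V" "V \<subseteq> G \<union> {y. 1 / 4 < w y}"
        "\<And>y. y \<in> ball (z j) (r (z j) / 2) - V \<Longrightarrow> \<bar>u y\<bar> \<noteq> \<infinity>" "continuous_on (ball (z j) (r (z j) / 2) - V) u"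
        by (rule cutoff_quasicontinuous[OF r(1)[OF zU] UM r(2)[OF zU] r(3)[OF zU] w ugw gint e]) (assumption, rule that)
      then have "good j G V" unfolding good_def by (intro conjI ballI)
      then show ?thesis by blast
    qed
    then obtain G V where "\<And>j. good j (G j) (V j)" by metis
    then have GV: "\<And>j. capacity p M UNIV (G j) < ennreal (\<epsilon> / 4 * (1/2) ^ Suc j)" "\<And>j. open (V j)"
      "\<And>j. V j \<subseteq> G j \<union> {y. 1 / 4 < w y}" "\<And>j y. y \<in> ball (z j) (r (z j) / 2) - V j \<Longrightarrow> \<bar>u y\<bar> \<noteq> \<infinity>"
      "\<And>j. continuous_on (ball (z j) (r (z j) / 2) - V j) u"
      unfolding good_def by simp_all
    let ?W = "\<Union>j. V j"
    have "?W \<subseteq> (\<Union>j. G j) \<union> {y. 1 / 4 < w y}"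
    proof
      fix y assume "y \<in> ?W"
      then obtain j where "y \<in> V j" by blast
      then have "y \<in> G j \<union> {y. 1 / 4 < w y}" by (rule subsetD[OF GV(3)])
      then show "y \<in> (\<Union>j. G j) \<union> {y. 1 / 4 < w y}" by blast
    qed
    then have "capacity p M UNIV ?W \<le> capacity p M UNIV ((\<Union>j. G j) \<union> {y. 1 / 4 < w y})"
      by (rule capacity_mono)
    also have "\<dots> \<le> capacity p M UNIV (\<Union>j. G j) + capacity p M UNIV {y. 1 / 4 < w y}"
      by (rule capacity_Un[OF p0 cbm])
    also have "\<dots> \<le> (\<Sum>j. ennreal (\<epsilon> / 4 * (1/2) ^ Suc j)) + ennreal (\<epsilon> / 2)"
    proof (rule add_mono[OF order_trans[OF capacity_UN[OF p0 cbm]] capw])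
      show "(\<Sum>j. capacity p M UNIV (G j)) \<le> (\<Sum>j. ennreal (\<epsilon> / 4 * (1/2) ^ Suc j))"
        using GV(1) by (intro suminf_le summableI less_imp_le)
    qed
    also have "(\<Sum>j. ennreal (\<epsilon> / 4 * (1/2) ^ Suc j)) = ennreal (\<epsilon> / 4)"
      using \<epsilon> by (intro suminf_half_ennreal) simp
    also have "ennreal (\<epsilon> / 4) + ennreal (\<epsilon> / 2) < ennreal \<epsilon>"
      using \<epsilon> by (simp add: ennreal_less_iff flip: ennreal_plus)
    finally have cap: "capacity p M UNIV ?W < ennreal \<epsilon>" .
    have fin: "\<bar>u y\<bar> \<noteq> \<infinity>" if y: "y \<in> U - ?W" for y
    proof -
      obtain j where "y \<in> ball (z j) (r (z j) / 2)" using zcov y by blast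
      then have "y \<in> ball (z j) (r (z j) / 2) - V j" using y by blast
      then show ?thesis by (rule GV(4))
    qed
    have "continuous_on (U - ?W) u"
      unfolding continuous_on_def
    proof
      fix y assume y: "y \<in> U - ?W"
      then obtain j where j: "y \<in> ball (z j) (r (z j) / 2)" using zcov by blast
      let ?B = "ball (z j) (r (z j) / 2)"
      have "(u \<longlongrightarrow> u y) (at y within ?B - V j)"
        by (rule continuous_on_def[THEN iffD1, OF GV(5), THEN bspec]) (use y j in blast)
      \<comment> \<open>Continuity is local and the ball is open, so removing the larger set
        \<open>?W\<close> reduces it to continuity off the single \<open>V j\<close>.\<close>
      then have "(u \<longlongrightarrow> u y) (at y within (U - ?W) \<inter> ?B)"
        by (rule tendsto_within_subset) auto
      moreover have "at y within (U - ?W) = at y within (U - ?W) \<inter> ?B"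
        by (rule at_within_nhd[OF j open_ball]) auto
      ultimately show "(u \<longlongrightarrow> u y) (at y within U - ?W)" by simp
    qed
    then show ?thesis using cap fin GV(2) by (intro exI[of _ ?W]) auto
  qed
qed

end

theorem theorem1p3:
  fixes M :: "'a::metric_space measure"
    and p :: real
    and U :: "'a set"
    and u :: "'a \<Rightarrow> ereal"
  assumes "1 \<le> p"
    and "complete_Borel_measure M"
    and "\<forall>x r. emeasure M (ball x r) < \<infinity>"
    and "complete (UNIV :: 'a set)"
    and "doubling M"
    and "poincare_inequality p M"
    and "quasiopen p M U"
    and "u \<in> newton_loc p M U"
  shows "quasicontinuous p M U u \<and> intrinsic_quasicontinuous p M U u"
proof -
  interpret proper_newton M p
    using assms(1-3) doubling_imp_proper[OF assms(2,5,4,3)] by unfold_locales auto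
  have q: "quasicontinuous p M U u" using assms(7,8) by (rule newton_loc_quasicontinuous)
  have UM: "U \<in> sets M" by (rule quasiopen_measurable[OF p0 cbm assms(7)])
  have top: "UNIV \<in> sets M" using complete_Borel_measureE[OF cbm] by (metis sets.top)
  have "intrinsic_quasicontinuous p M U u"
    unfolding intrinsic_quasicontinuous_def
  proof (intro allI impI)
    fix \<epsilon> :: real assume "0 < \<epsilon>"
    then obtain G where G: "open G" "capacity p M UNIV G < ennreal \<epsilon>"
      "\<forall>x\<in>U - G. \<bar>u x\<bar> \<noteq> \<infinity>" "continuous_on (U - G) u"
      using q unfolding quasicontinuous_def by blast
    \<comment> \<open>The trace of the ambient open set on \<open>U\<close> is relatively open and
      serves for the intrinsic notion.\<close>
    have "capacity p M U (U \<inter> G) \<le> capacity p M UNIV (U \<inter> G)"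
      using UM top by (intro capacity_subspace_le p0) auto
    also have "\<dots> \<le> capacity p M UNIV G" by (intro capacity_mono) auto
    finally have "capacity p M U (U \<inter> G) < ennreal \<epsilon>" using G(2) by (rule order.strict_trans1)
    moreover have "U - U \<inter> G = U - G" by auto
    moreover have "openin (top_of_set U) (U \<inter> G)" using G(1) by (rule openin_open_Int)
    ultimately show "\<exists>G. openin (top_of_set U) G \<and> capacity p M U G < ennreal \<epsilon> \<and>
        (\<forall>x\<in>U - G. \<bar>u x\<bar> \<noteq> \<infinity>) \<and> continuous_on (U - G) u"
      using G(3,4) by (intro exI[of _ "U \<inter> G"]) auto
  qed
  with q show ?thesis by simp
qed

end
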